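(* Let $\mathfrak{e}(t)$, $0\le t\le1$, be the normalized Brownian excursion and let $\mu(\mathfrak{e})=\sup_{0\le u\le1}\mathfrak{e}(u)$. Then, as $\varepsilon\to0+$, $$ \mathsf{P}\{\mu(\mathfrak{e}) \leq \varepsilon \} \sim \frac{\pi^2\sqrt{2\pi}}{\varepsilon^3} \exp\left(- \frac{\pi^2}{2 \varepsilon^{2}}\right). $$
   Context: The normalized Brownian excursion $\mathfrak{e}$ is, informally, the Brownian bridge on $[0,1]$ from $0$ to $0$ conditioned to be positive on $(0,1)$; rigorously, if $W$ is a standard Brownian motion, $g=\sup\{t\le1:W(t)=0\}$ and $d=\inf\{t\ge 1:W(t)=0\}$, then $\mathfrak{e}(t)=|W(g+t(d-g))|/\sqrt{d-g}$, $0\le t\le 1$. The notation $f(\varepsilon)\sim g(\varepsilon)$ means $f(\varepsilon)/g(\varepsilon)\to1$. *)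

theory Defs
  imports "HOL-Probability.Probability" "HOL-Library.Landau_Symbols"
begin

(* The time parameter ranges over the nonnegative reals; values of W at negative times are
   unconstrained. "distributed" also provides the measurability of the increments, hence,
   with W 0 = 0, of every W t with t > 0. *)
locale standard_brownian_motion = prob_space M for M :: "'a measure" +
  fixes W :: "real \<Rightarrow> 'a \<Rightarrow> real"
  assumes start_zero: "\<And>\<omega>. \<omega> \<in> space M \<Longrightarrow> W 0 \<omega> = 0"
    and continuous_paths: "\<And>\<omega>. \<omega> \<in> space M \<Longrightarrow> continuous_on {0..} (\<lambda>t. W t \<omega>)"
    and gaussian_increments: "\<And>s t. 0 \<le> s \<Longrightarrow> s < t \<Longrightarrow>
          distributed M lborel (\<lambda>\<omega>. W t \<omega> - W s \<omega>) (normal_density 0 (sqrt (t - s)))"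
    and independent_increments: "\<And>(n::nat) t. 0 \<le> t 0 \<Longrightarrow> (\<forall>i<n. t i < t (Suc i)) \<Longrightarrow>
          indep_vars (\<lambda>_. borel) (\<lambda>i \<omega>. W (t (Suc i)) \<omega> - W (t i) \<omega>) {..<n}"

definition last_zero :: "(real \<Rightarrow> real) \<Rightarrow> real" where
  "last_zero w = Sup {t. 0 \<le> t \<and> t \<le> 1 \<and> w t = 0}"

definition next_zero :: "(real \<Rightarrow> real) \<Rightarrow> real" where
  "next_zero w = Inf {t. 1 \<le> t \<and> w t = 0}"

(* The infimum defining next_zero is only meaningful when w has a zero in [1, \<infinity>). A Brownian path
   has one almost surely; on the exceptional null set the excursion is set to 0, so that it never
   depends on the unspecified value Inf {} nor on w at negative times.
   If w 1 = 0 (again a null event), then last_zero w = next_zero w = 1, and the value is 0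
   because x / 0 = 0. *)
definition brownian_excursion :: "(real \<Rightarrow> real) \<Rightarrow> real \<Rightarrow> real" where
  "brownian_excursion w t =
     (let g = last_zero w; d = next_zero w
      in if \<exists>s\<ge>1. w s = 0 then \<bar>w (g + t * (d - g))\<bar> / sqrt (d - g) else 0)"

definition path_max :: "(real \<Rightarrow> real) \<Rightarrow> real" where
  "path_max f = (SUP u\<in>{0..1}. f u)"

end

theory Submission
  imports Defs
begin

text \<open>
  Let \<open>g < 1 < d\<close> be the zeros of \<open>W\<close> around time 1 and \<open>H\<close> the maximum of \<open>\<bar>W\<bar>\<close> on \<open>[g, d]\<close>.
  On \<open>W 1 > 0\<close>, the law of \<open>(g, d)\<close> restricted to \<open>H < a\<close> has, for \<open>0 < u < 1 < v\<close>, the density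
  \<open>\<Sum>n\<ge>1. (n pi / a)\<^sup>2 / (2 a) * exp (- (n pi / a)\<^sup>2 (v - u) / 2) / sqrt (2 pi u)\<close>.
  The only martingales used are the bounded ones \<open>exp (c\<^sup>2 t / 2) sin (c W t + b)\<close>. With \<open>c = n pi / a\<close> and \<open>b = 0\<close>
  they vanish at \<open>0\<close> and \<open>a\<close>; the one with boundary value \<open>0\<close> at \<open>a\<close> becomes \<open>1 - W t / a\<close> as \<open>c\<close> tends to 0
  and gives the probability of reaching 0 before \<open>a\<close>. Since \<open>g\<close> is not a stopping time, the path before time 1 is
  handled by locating \<open>g\<close> in a cell of a grid: after that cell, killing at 0 only and killing at 0 and \<open>a\<close>
  give the same expectation of \<open>sin (n pi W 1 / a)\<close>.

  The density depends on \<open>a\<close> only through \<open>a / sqrt (v - u)\<close>, up to the factor \<open>(v - u) powr (- 3 / 2)\<close>, so the event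
  \<open>H \<le> \<epsilon> * sqrt (d - g)\<close> has an explicit probability, of which the term \<open>n = 1\<close> dominates as \<open>\<epsilon>\<close> tends to 0.
\<close>

section \<open>Gaussian expectations and the natural filtration\<close>

text \<open>Killing at a level where the sine vanishes leaves its martingale integral unchanged,
  because a path stopped there contributes 0. This is why imposing the barrier \<open>a\<close>
  after the cell of the last zero costs nothing, and why the eigenvalue decay of the killed motion
  is available without its transition density. The return to 0 after time 1 is expanded in the same
  sines: 1 - x / a is the sum of 2 / (n pi) * sin (n pi x / a). That series converges only
  conditionally, so it is Abel summed; the decay factors exp (- c^2 (t - s) / 2) then let the Abel
  parameter tend to 1. Origin of the constant: the weight (v - u) powr (- 3 / 2) / sqrt (2 pi u) on
  0 < u < 1 < v has total mass sqrt (2 pi), the term \<open>n = 1\<close> carries the coefficient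
  pi^2 / (2 \<epsilon>^3), and a factor 2 comes from the two signs of \<open>W 1\<close>, the
  negative one being treated by the motion \<open>- W\<close>.\<close>

lemma integral_std_normal_cos: "(\<integral>x. std_normal_density x * cos (c * x) \<partial>lborel) = exp (- (c\<^sup>2) / 2)"
  and integral_std_normal_sin: "(\<integral>x. std_normal_density x * sin (c * x) \<partial>lborel) = 0"
proof -
  have dens: "(\<integral>x. f x \<partial>std_normal_distribution) = (\<integral>x. std_normal_density x * f x \<partial>lborel)"
    if "f \<in> borel_measurable borel" for f :: "real \<Rightarrow> real"
    using that by (subst integral_density) auto
  interpret N: prob_space std_normal_distribution
    by (rule prob_space_normal_density) simp
  have int: "integrable std_normal_distribution (\<lambda>x. iexp (c * x))"
    by (rule N.integrable_const_bound[where B=1]) auto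
  have char: "(CLINT x|std_normal_distribution. iexp (c * x)) = complex_of_real (exp (- (c\<^sup>2) / 2))"
    using char_std_normal_distribution by (simp add: char_def fun_eq_iff)
  have "(\<integral>x. cos (c * x) \<partial>std_normal_distribution) = Re (CLINT x|std_normal_distribution. iexp (c * x))"
    by (subst integral_Re[OF int, symmetric]) (simp add: Re_exp)
  then show "(\<integral>x. std_normal_density x * cos (c * x) \<partial>lborel) = exp (- (c\<^sup>2) / 2)"
    unfolding char by (simp add: dens)
  have "(\<integral>x. sin (c * x) \<partial>std_normal_distribution) = Im (CLINT x|std_normal_distribution. iexp (c * x))"
    by (subst integral_Im[OF int, symmetric]) (simp add: Im_exp)
  then show "(\<integral>x. std_normal_density x * sin (c * x) \<partial>lborel) = 0"
    unfolding char by (simp add: dens)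
qed

context prob_space
begin

lemma expectation_normal:
  assumes X: "distributed M lborel X (normal_density 0 \<sigma>)" and "0 < \<sigma>"
    and [measurable]: "g \<in> borel_measurable borel"
  shows "expectation (\<lambda>w. g (X w)) = (\<integral>x. std_normal_density x * g (\<sigma> * x) \<partial>lborel)"
proof -
  have "distributed M lborel (\<lambda>w. (X w - 0) / \<sigma>) std_normal_density"
    using X \<open>0 < \<sigma>\<close> by (subst (asm) normal_standard_normal_convert) auto
  from distributed_integral[OF this, of "\<lambda>x. g (\<sigma> * x)"] \<open>0 < \<sigma>\<close> show ?thesis
    by simp
qed

lemma expectation_normal_cos:
  assumes "distributed M lborel X (normal_density 0 \<sigma>)" "0 < \<sigma>"
  shows "expectation (\<lambda>w. cos (c * X w)) = exp (- ((c * \<sigma>)\<^sup>2 / 2))"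
  using integral_std_normal_cos[of "c * \<sigma>"] expectation_normal[OF assms, of "\<lambda>x. cos (c * x)"]
  by (simp add: mult.assoc)

lemma expectation_normal_sin:
  assumes "distributed M lborel X (normal_density 0 \<sigma>)" "0 < \<sigma>"
  shows "expectation (\<lambda>w. sin (c * X w)) = 0"
  using integral_std_normal_sin[of "c * \<sigma>"] expectation_normal[OF assms, of "\<lambda>x. sin (c * x)"]
  by (simp add: mult.assoc)

end

context standard_brownian_motion
begin

lemma random_variable_W [measurable]:
  assumes "0 \<le> t" shows "random_variable borel (W t)"
proof (cases "t = 0")
  case True
  have "random_variable borel (\<lambda>w. 0::real)" by simp
  then show ?thesis
    by (rule measurable_cong[THEN iffD1, rotated]) (simp add: True start_zero)
next
  case False
  then have "random_variable borel (\<lambda>w. W t w - W 0 w)"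
    using gaussian_increments[of 0 t] assms distributed_measurable by fastforce
  then show ?thesis
    by (rule measurable_cong[THEN iffD1, rotated]) (simp add: start_zero)
qed

lemma distributed_W:
  assumes "0 < t" shows "distributed M lborel (W t) (normal_density 0 (sqrt t))"
  using gaussian_increments[of 0 t] assms
  by (auto simp: distributed_def start_zero cong: distr_cong measurable_cong)

section \<open>Natural filtration and independence of increments\<close>

definition past :: "real \<Rightarrow> 'a measure" where
  "past u = sigma (space M) {W r -` B \<inter> space M |r B. 0 \<le> r \<and> r \<le> u \<and> B \<in> sets borel}"

lemma space_past [simp]: "space (past u) = space M"
  by (simp add: past_def space_measure_of_conv)

lemma sets_past: "sets (past u) = sigma_sets (space M) {W r -` B \<inter> space M |r B. 0 \<le> r \<and> r \<le> u \<and> B \<in> sets borel}"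
  by (auto simp: past_def intro!: sets_measure_of)

lemma sets_past_mono: "u \<le> v \<Longrightarrow> sets (past u) \<subseteq> sets (past v)"
  unfolding sets_past by (rule sigma_sets_mono') force

lemma sets_past_events: "sets (past u) \<subseteq> events"
  unfolding sets_past by (rule sets.sigma_sets_subset) (auto intro: measurable_sets)

lemma measurable_past: "f \<in> measurable (past u) N \<Longrightarrow> f \<in> measurable M N"
  using sets_past_events by (auto simp: measurable_def)

lemma W_past: "0 \<le> r \<Longrightarrow> r \<le> u \<Longrightarrow> W r \<in> borel_measurable (past u)"
  by (rule measurableI) (auto simp: sets_past)

text \<open>Independence is assumed only for finitely many consecutive increments. Values of
  \<open>W\<close> at finitely many times are partial sums of such increments, so the cylinder sets
  \<open>G\<close> are independent of \<open>D\<close>. Both families are stable under intersection,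
  which carries the independence over to the generated sigma-algebras.\<close>

lemma indep_past_increment:
  assumes "0 \<le> u" "u < v"
  shows "indep_set (sets (past u)) (sigma_sets (space M) {(\<lambda>w. W v w - W u w) -` B \<inter> space M |B. B \<in> sets borel})"
proof -
  define cyl where "cyl J B = {w\<in>space M. \<forall>r\<in>J. W r w \<in> B r}" for J :: "real set" and B :: "real \<Rightarrow> real set"
  define G where "G = {cyl J B |J B. finite J \<and> J \<subseteq> {0..u} \<and> (\<forall>r. B r \<in> sets borel)}"
  define D where "D = {(\<lambda>w. W v w - W u w) -` B \<inter> space M |B. B \<in> sets borel}"
  have GE: "G \<subseteq> events"
  proof
    fix X assume "X \<in> G"
    then obtain J B where *: "finite J" "J \<subseteq> {0..u}" "\<forall>r. B r \<in> sets borel" "X = cyl J B"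
      by (auto simp: G_def)
    have "{w\<in>space M. \<forall>r\<in>J. W r w \<in> B r} \<in> events"
      using * by (intro sets.sets_Collect_finite_All measurable_sets_Collect[of "W _" M borel]) auto
    then show "X \<in> events" using * by (simp add: cyl_def)
  qed
  have Gint: "Int_stable G"
  proof (rule Int_stableI)
    fix X Y assume "X \<in> G" "Y \<in> G"
    then obtain J B J' B' where *: "finite J" "J \<subseteq> {0..u}" "\<forall>r. B r \<in> sets borel" "X = cyl J B"
      "finite J'" "J' \<subseteq> {0..u}" "\<forall>r. B' r \<in> sets borel" "Y = cyl J' B'"
      by (auto simp: G_def)
    have "X \<inter> Y = cyl (J \<union> J') (\<lambda>r. (if r \<in> J then B r else UNIV) \<inter> (if r \<in> J' then B' r else UNIV))"
      unfolding *(4,8) cyl_def by (auto split: if_splits)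
    moreover have "\<dots> \<in> G" using *
      unfolding G_def
      by (intro CollectI exI[of _ "J \<union> J'"] exI[of _ "\<lambda>r. (if r \<in> J then B r else UNIV) \<inter> (if r \<in> J' then B' r else UNIV)"]) auto
    ultimately show "X \<inter> Y \<in> G" by simp
  qed
  have Dint: "Int_stable D"
  proof (rule Int_stableI)
    fix X Y assume "X \<in> D" "Y \<in> D"
    then obtain B B' where "B \<in> sets borel" "X = (\<lambda>w. W v w - W u w) -` B \<inter> space M"
      "B' \<in> sets borel" "Y = (\<lambda>w. W v w - W u w) -` B' \<inter> space M"
      by (auto simp: D_def)
    then show "X \<inter> Y \<in> D"
      unfolding D_def by (intro CollectI exI[of _ "B \<inter> B'"]) auto
  qed
  have "indep_set G D"
  proof (rule indep_setI)
    show "G \<subseteq> events" by fact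
    show "D \<subseteq> events" using assms by (auto simp: D_def)
    fix X Y assume "X \<in> G" "Y \<in> D"
    then obtain J B C where *: "finite J" "J \<subseteq> {0..u}" "\<forall>r. B r \<in> sets borel" "X = cyl J B"
      and C: "C \<in> sets borel" "Y = (\<lambda>w. W v w - W u w) -` C \<inter> space M"
      by (auto simp: G_def D_def)
    \<comment> \<open>Inserting 0 and \<open>u\<close> makes the sampled times start where
      \<open>W\<close> is 0 and end at \<open>u\<close>. The time with index \<open>Suc n\<close> is
      \<open>v\<close>, so increment number \<open>n\<close> is exactly \<open>W v - W u\<close> and
      the earlier ones determine the cylinder.\<close>
    define l where "l = sorted_list_of_set (insert 0 (insert u J))"
    define n where "n = length l - 1"
    define t where "t i = (if i \<le> n then l ! i else v + real (i - n - 1))" for i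
    have fin: "finite (insert 0 (insert u J))" using * by simp
    have set_l: "set l = insert 0 (insert u J)" unfolding l_def using fin by (rule set_sorted_list_of_set)
    have srt: "sorted l" "distinct l" unfolding l_def by auto
    have len: "length l = Suc n"
      unfolding n_def using set_l by (cases l) auto
    have bnd: "0 \<le> l ! i" "l ! i \<le> u" if "i \<le> n" for i
      using that set_l * assms nth_mem[of i l] len by (auto simp: subset_eq)
    have t0: "t 0 = 0"
    proof -
      obtain i where "i < length l" "l ! i = 0" using set_l by (metis in_set_conv_nth insertI1)
      then have "l ! 0 \<le> 0" using sorted_nth_mono[OF srt(1), of 0 i] by simp
      then show ?thesis using bnd[of 0] by (simp add: t_def)
    qed
    have tn: "t n = u"
    proof -
      obtain i where "i < length l" "l ! i = u" using set_l by (metis in_set_conv_nth insertI1 insertI2)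
      then have "u \<le> l ! n" using sorted_nth_mono[OF srt(1), of i n] len by simp
      then show ?thesis using bnd[of n] by (simp add: t_def)
    qed
    have tSn: "t (Suc n) = v" by (simp add: t_def)
    have inc: "t i < t (Suc i)" if "i < Suc n" for i
    proof (cases "i < n")
      case True
      then have "l ! i < l ! Suc i"
        using srt len by (metis Suc_less_eq lessI less_SucI sorted_wrt_nth_less strict_sorted_iff)
      then show ?thesis using True by (simp add: t_def)
    next
      case False
      then have "i = n" using that by simp
      then show ?thesis using tn tSn assms by simp
    qed
    define X' where "X' i w = W (t (Suc i)) w - W (t i) w" for i w
    have ind: "indep_vars (\<lambda>_. borel) X' {..<Suc n}"
      unfolding X'_def by (rule independent_increments) (use t0 inc in auto)
    have iv: "indep_var (PiM {..<n} (\<lambda>_. borel)) (\<lambda>w. restrict (\<lambda>i. X' i w) {..<n})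
        (PiM {n} (\<lambda>_. borel)) (\<lambda>w. restrict (\<lambda>i. X' i w) {n})"
      by (rule indep_var_restrict[OF ind]) auto
    have tel: "(\<Sum>i<k. X' i w) = W (t k) w" if "w \<in> space M" for k w
      using sum_lessThan_telescope[of "\<lambda>i. W (t i) w" k] that by (simp add: X'_def t0 start_zero)
    \<comment> \<open>The cylinder as a condition on increments: \<open>W (t k)\<close> is the sum
      of the first \<open>k\<close> of them.\<close>
    define P where "P = {f \<in> space (PiM {..<n} (\<lambda>_. borel::real measure)). \<forall>k\<in>{..n}. t k \<in> J \<longrightarrow> (\<Sum>i<k. f i) \<in> B (t k)}"
    define Q where "Q = {f \<in> space (PiM {n} (\<lambda>_. borel::real measure)). f n \<in> C}"
    have P: "P \<in> sets (PiM {..<n} (\<lambda>_. borel))"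
      unfolding P_def
    proof (intro sets.sets_Collect_finite_All sets.sets_Collect_imp sets.sets_Collect_const)
      fix k assume k: "k \<in> {..n}"
      have "(\<lambda>f. \<Sum>i<k. f i) \<in> borel_measurable (PiM {..<n} (\<lambda>_. borel::real measure))"
        using k by (intro borel_measurable_sum measurable_component_singleton) auto
      then show "{x \<in> space (Pi\<^sub>M {..<n} (\<lambda>_. borel)). sum x {..<k} \<in> B (t k)} \<in> sets (Pi\<^sub>M {..<n} (\<lambda>_. borel))"
        by (rule measurable_sets_Collect) (use * in auto)
    qed auto
    have Q: "Q \<in> sets (PiM {n} (\<lambda>_. borel))"
      unfolding Q_def by (rule measurable_sets_Collect[OF measurable_component_singleton]) (use C in auto)
    have XP: "X = (\<lambda>w. restrict (\<lambda>i. X' i w) {..<n}) -` P \<inter> space M"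
    proof -
      have "(\<forall>r\<in>J. W r w \<in> B r) \<longleftrightarrow> (\<forall>k\<in>{..n}. t k \<in> J \<longrightarrow> W (t k) w \<in> B (t k))" for w
      proof safe
        fix r assume r: "\<forall>k\<in>{..n}. t k \<in> J \<longrightarrow> W (t k) w \<in> B (t k)" "r \<in> J"
        then have "r \<in> set l" by (simp add: set_l)
        then obtain k where "k \<le> n" "l ! k = r" using len by (metis in_set_conv_nth less_Suc_eq_le)
        then show "W r w \<in> B r" using r by (auto simp: t_def)
      qed auto
      moreover have "(\<Sum>i<k. restrict (\<lambda>i. X' i w) {..<n} i) = W (t k) w" if "k \<le> n" "w \<in> space M" for k w
        using that by (subst tel[symmetric]) (auto intro!: sum.cong)
      ultimately show ?thesis
        by (auto simp: * cyl_def P_def space_PiM)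
    qed
    have YQ: "Y = (\<lambda>w. restrict (\<lambda>i. X' i w) {n}) -` Q \<inter> space M"
      by (auto simp: C Q_def space_PiM X'_def tn tSn)
    note iS = iv[unfolded indep_var_eq, THEN conjunct2]
    show "prob (X \<inter> Y) = prob X * prob Y"
    proof (rule indep_setD[OF iS])
      show "X \<in> sigma_sets (space M) {(\<lambda>w. restrict (\<lambda>i. X' i w) {..<n}) -` A \<inter> space M |A. A \<in> sets (PiM {..<n} (\<lambda>_. borel))}"
        by (rule sigma_sets.Basic, rule CollectI, rule exI[of _ P], intro conjI XP P)
      show "Y \<in> sigma_sets (space M) {(\<lambda>w. restrict (\<lambda>i. X' i w) {n}) -` A \<inter> space M |A. A \<in> sets (PiM {n} (\<lambda>_. borel))}"
        by (rule sigma_sets.Basic, rule CollectI, rule exI[of _ Q], intro conjI YQ Q)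
    qed
  qed
  from indep_set_sigma_sets[OF this Gint Dint]
  have *: "indep_set (sigma_sets (space M) G) (sigma_sets (space M) D)" .
  have "sets (past u) \<subseteq> sigma_sets (space M) G"
    unfolding sets_past
  proof (rule sigma_sets_mono, safe)
    fix r B assume r: "0 \<le> r" "r \<le> u" "B \<in> sets (borel :: real measure)"
    have "W r -` B \<inter> space M = cyl {r} (\<lambda>_. B)" by (auto simp: cyl_def)
    also have "\<dots> \<in> G" unfolding G_def using r by (intro CollectI exI[of _ "{r}"] exI[of _ "\<lambda>_. B"]) auto
    finally show "W r -` B \<inter> space M \<in> sigma_sets (space M) G" by (rule sigma_sets.Basic)
  qed
  then show ?thesis
    using * unfolding indep_sets2_eq D_def[symmetric] by blast
qed

text \<open>Imaginary part of the exponential martingale exp (i (c W r + b) + c^2 r / 2), with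
  \<open>y\<close> in place of \<open>W r\<close>. The phase \<open>b\<close> allows a zero of the
  sine to be placed at a chosen barrier.\<close>

definition trig :: "real \<Rightarrow> real \<Rightarrow> real \<Rightarrow> real \<Rightarrow> real" where
  "trig c b r y = exp (c\<^sup>2 * r / 2) * sin (c * y + b)"

lemma trig_measurable [measurable]: "trig c b r \<in> borel_measurable borel"
  unfolding trig_def[abs_def] by measurable

lemma abs_trig_le: "\<bar>trig c b r y\<bar> \<le> exp (c\<^sup>2 * r / 2)"
  by (simp add: trig_def abs_mult)

lemma integrable_indicator_trig:
  assumes "A \<in> events" "0 \<le> r"
  shows "integrable M (\<lambda>w. indicator A w * trig c b r (W r w))"
  by (rule integrable_const_bound[where B="exp (c\<^sup>2 * r / 2)"])
     (use assms abs_trig_le[of c b r] in \<open>auto simp: indicator_def intro!: borel_measurable_times\<close>)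

text \<open>By the addition formula the sine of the increment contributes mean 0 and the cosine
  contributes exp (- c^2 (v - u) / 2), which the exponential factor compensates. Integrating over
  events of the past takes the place of conditional expectations.\<close>

lemma trig_martingale:
  assumes A: "A \<in> sets (past u)" and "0 \<le> u" "u \<le> v"
  shows "(\<integral>w. indicator A w * trig c b v (W v w) \<partial>M) = (\<integral>w. indicator A w * trig c b u (W u w) \<partial>M)"
proof (cases "u = v")
  case False
  then have "u < v" using assms by simp
  have [measurable]: "A \<in> events" using A sets_past_events by auto
  let ?D = "\<lambda>w. W v w - W u w"
  have Dm [measurable]: "random_variable borel ?D" "random_variable borel (W u)" "random_variable borel (W v)"
    using assms by auto
  have prod: "expectation (\<lambda>w. indicator A w * f (W u w) * g (?D w)) =
      expectation (\<lambda>w. indicator A w * f (W u w)) * expectation (\<lambda>w. g (?D w))"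
    if [measurable]: "f \<in> borel_measurable borel" "g \<in> borel_measurable borel"
      and bd: "\<And>x. \<bar>f x\<bar> \<le> 1" "\<And>x. \<bar>g x\<bar> \<le> 1" for f g :: "real \<Rightarrow> real"
  proof -
    have X: "(\<lambda>w. indicator A w * f (W u w)) \<in> borel_measurable (past u)"
      using A W_past[of u u] assms by measurable
    have "indep_var borel (\<lambda>w. indicator A w * f (W u w)) borel ?D"
      unfolding indep_var_eq
    proof (intro conjI)
      have "sigma_sets (space M) {(\<lambda>w. indicator A w * f (W u w)) -` B \<inter> space M |B. B \<in> sets borel} \<subseteq> sets (past u)"
        by (rule sets.sigma_sets_subset[of _ "past u", simplified]) (use measurable_sets[OF X] in auto)
      then show "indep_set (sigma_sets (space M) {(\<lambda>w. indicator A w * f (W u w)) -` B \<inter> space M |B. B \<in> sets borel})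
        (sigma_sets (space M) {?D -` B \<inter> space M |B. B \<in> sets borel})"
        using indep_past_increment[OF \<open>0 \<le> u\<close> \<open>u < v\<close>] unfolding indep_sets2_eq by blast
    qed (auto intro: measurable_past[OF X])
    from indep_var_compose[OF this, of "\<lambda>x. x" borel g borel]
    have "indep_var borel (\<lambda>w. indicator A w * f (W u w)) borel (\<lambda>w. g (?D w))"
      by (simp add: comp_def)
    then show ?thesis
    proof (rule indep_var_lebesgue_integral)
      show "integrable M (\<lambda>w. indicator A w * f (W u w))" "integrable M (\<lambda>w. g (?D w))"
        by (rule integrable_const_bound[where B=1]; use bd in \<open>auto simp: indicator_def\<close>)+
    qed
  qed
  have sq: "0 < sqrt (v - u)" "(c * sqrt (v - u))\<^sup>2 = c\<^sup>2 * (v - u)"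
    using \<open>u < v\<close> by (auto simp: power_mult_distrib)
  note dist = gaussian_increments[OF \<open>0 \<le> u\<close> \<open>u < v\<close>]
  have int: "integrable M (\<lambda>w. indicator A w * f (W u w) * g (?D w))"
    if [measurable]: "f \<in> borel_measurable borel" "g \<in> borel_measurable borel"
      and bd: "\<And>x. \<bar>f x\<bar> \<le> 1" "\<And>x. \<bar>g x\<bar> \<le> 1" for f g :: "real \<Rightarrow> real"
    by (rule integrable_const_bound[where B=1])
      (use bd in \<open>auto simp: indicator_def abs_mult intro!: mult_le_one\<close>)
  have "sin (c * W v w + b) = sin (c * W u w + b) * cos (c * ?D w) + cos (c * W u w + b) * sin (c * ?D w)" for w
    by (subst sin_add[symmetric]) (simp add: algebra_simps)
  then have "(\<integral>w. indicator A w * sin (c * W v w + b) \<partial>M) =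
     (\<integral>w. indicator A w * sin (c * W u w + b) * cos (c * ?D w) + indicator A w * cos (c * W u w + b) * sin (c * ?D w) \<partial>M)"
    by (simp add: algebra_simps)
  also have "\<dots> = (\<integral>w. indicator A w * sin (c * W u w + b) * cos (c * ?D w) \<partial>M) + (\<integral>w. indicator A w * cos (c * W u w + b) * sin (c * ?D w) \<partial>M)"
    by (intro Bochner_Integration.integral_add int) auto
  also have "\<dots> = (\<integral>w. indicator A w * sin (c * W u w + b) \<partial>M) * exp (- (c\<^sup>2 * (v - u) / 2))"
    using prod[of "\<lambda>x. sin (c * x + b)" "\<lambda>x. cos (c * x)"] prod[of "\<lambda>x. cos (c * x + b)" "\<lambda>x. sin (c * x)"]
      expectation_normal_cos[OF dist sq(1), of c] expectation_normal_sin[OF dist sq(1), of c]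
    by (simp add: sq)
  finally have *: "(\<integral>w. indicator A w * sin (c * W v w + b) \<partial>M) = (\<integral>w. indicator A w * sin (c * W u w + b) \<partial>M) * exp (- (c\<^sup>2 * (v - u) / 2))" .
  have "(\<integral>w. indicator A w * trig c b v (W v w) \<partial>M) = exp (c\<^sup>2 * v / 2) * (\<integral>w. indicator A w * sin (c * W v w + b) \<partial>M)"
    unfolding trig_def by (subst integral_mult_right_zero[symmetric]) (simp add: mult_ac)
  also have "\<dots> = (exp (c\<^sup>2 * v / 2) * exp (- (c\<^sup>2 * (v - u) / 2))) * (\<integral>w. indicator A w * sin (c * W u w + b) \<partial>M)"
    by (simp add: *)
  also have "exp (c\<^sup>2 * v / 2) * exp (- (c\<^sup>2 * (v - u) / 2)) = exp (c\<^sup>2 * u / 2)"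
    by (simp add: exp_add[symmetric] diff_divide_distrib[symmetric] algebra_simps)
  also have "\<dots> * (\<integral>w. indicator A w * sin (c * W u w + b) \<partial>M) = (\<integral>w. indicator A w * trig c b u (W u w) \<partial>M)"
    unfolding trig_def by (subst integral_mult_right_zero[symmetric]) (simp add: mult_ac)
  finally show ?thesis .
qed simp

end

section \<open>Optional stopping of trigonometric martingales\<close>

text \<open>The inserted \<open>v\<close> caps the first exit time at \<open>v\<close> and keeps the
  infimum over a nonempty set.\<close>

definition exit_time :: "real set \<Rightarrow> real \<Rightarrow> real \<Rightarrow> (real \<Rightarrow> real) \<Rightarrow> real" where
  "exit_time I u v w = Inf (insert v {r \<in> {u..v}. w r \<notin> I})"

lemma
  assumes "u \<le> v" "continuous_on {u..v} w" "open I"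
  shows exit_time_mem: "exit_time I u v w \<in> {u..v}"
    and exit_time_inside: "\<And>r. u \<le> r \<Longrightarrow> r < exit_time I u v w \<Longrightarrow> w r \<in> I"
    and exit_time_outside: "exit_time I u v w < v \<Longrightarrow> w (exit_time I u v w) \<notin> I"
    and exit_time_frontier: "w u \<in> I \<Longrightarrow> exit_time I u v w < v \<or> w v \<notin> I \<Longrightarrow> w (exit_time I u v w) \<in> frontier I"
proof -
  define S where "S = insert v {r \<in> {u..v}. w r \<notin> I}"
  let ?T = "exit_time I u v w"
  have T: "?T = Inf S" by (simp add: exit_time_def S_def)
  have "closed ({u..v} \<inter> w -` (- I))"
    by (rule continuous_closed_preimage) (use assms in auto)
  moreover have "S = insert v ({u..v} \<inter> w -` (- I))" by (auto simp: S_def)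
  ultimately have "closed S" by (simp add: closed_insert)
  have bdd: "bdd_below S" using assms(1) by (auto simp: S_def intro!: bdd_belowI[of _ u])
  have "?T \<in> S" unfolding T using \<open>closed S\<close> bdd by (intro closed_contains_Inf) (auto simp: S_def)
  then show 1: "?T \<in> {u..v}" and 2: "?T < v \<Longrightarrow> w ?T \<notin> I" using assms(1) by (auto simp: S_def)
  show 3: "w r \<in> I" if "u \<le> r" "r < ?T" for r
  proof (rule ccontr)
    assume "w r \<notin> I"
    then have "r \<in> S" using that 1 by (auto simp: S_def)
    then have "?T \<le> r" unfolding T using bdd by (rule cInf_lower)
    with that show False by simp
  qed
  assume u: "w u \<in> I" and "?T < v \<or> w v \<notin> I"
  then have nI: "w ?T \<notin> I" using 1 2 by (cases "?T < v") auto
  \<comment> \<open>Before its exit the path lies in \<open>I\<close>, so its left limit at the exit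
    time lies in the closure of \<open>I\<close>. This needs a nondegenerate interval to the
    left.\<close>
  have "u < ?T" using nI u 1 by (cases "u = ?T") auto
  have "((\<lambda>r. w r) \<longlongrightarrow> w ?T) (at ?T within {u..?T})"
    using continuous_on_subset[OF assms(2), of "{u..?T}"] 1 \<open>u < ?T\<close> by (auto simp: continuous_on_def)
  then have "((\<lambda>r. w r) \<longlongrightarrow> w ?T) (at_left ?T)"
    by (rule tendsto_mono[rotated]) (use at_within_Icc_at_left[OF \<open>u < ?T\<close>] in simp)
  moreover have "\<forall>\<^sub>F r in at_left ?T. w r \<in> I"
    using eventually_at_left_real[OF \<open>u < ?T\<close>] by eventually_elim (use 3 in auto)
  ultimately have "w ?T \<in> closure I"
    by (intro Lim_in_closed_set[of "closure I" w "at_left ?T"]) (auto elim: eventually_mono closure_subset[THEN subsetD])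
  then show "w ?T \<in> frontier I"
    using nI \<open>open I\<close> by (simp add: frontier_def interior_open)
qed

section \<open>Approximation of times by grid points\<close>

lemma tendsto_grid:
  assumes "0 \<le> x"
  shows "(\<lambda>n. real (nat \<lfloor>x * real (Suc n)\<rfloor>) / real (Suc n)) \<longlonglongrightarrow> x"
proof -
  have "\<bar>real (nat \<lfloor>x * real (Suc n)\<rfloor>) / real (Suc n) - x\<bar> \<le> 1 / real (Suc n)" for n
  proof -
    have "real (nat \<lfloor>x * real (Suc n)\<rfloor>) = of_int \<lfloor>x * real (Suc n)\<rfloor>" using assms by simp
    then have "\<bar>real (nat \<lfloor>x * real (Suc n)\<rfloor>) - x * real (Suc n)\<bar> \<le> 1" by linarith
    then have "\<bar>real (nat \<lfloor>x * real (Suc n)\<rfloor>) - x * real (Suc n)\<bar> / real (Suc n) \<le> 1 / real (Suc n)"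
      by (rule divide_right_mono) simp
    moreover have "\<bar>real (nat \<lfloor>x * real (Suc n)\<rfloor>) / real (Suc n) - x\<bar> = \<bar>real (nat \<lfloor>x * real (Suc n)\<rfloor>) - x * real (Suc n)\<bar> / real (Suc n)"
    proof -
      have "real (nat \<lfloor>x * real (Suc n)\<rfloor>) / real (Suc n) - x = (real (nat \<lfloor>x * real (Suc n)\<rfloor>) - x * real (Suc n)) / real (Suc n)"
        by (simp add: diff_divide_distrib del: of_nat_Suc)
      then show ?thesis by (simp only: abs_divide abs_of_nat)
    qed
    ultimately show ?thesis by simp
  qed
  then have "(\<lambda>n. real (nat \<lfloor>x * real (Suc n)\<rfloor>) / real (Suc n) - x) \<longlonglongrightarrow> 0"
    by (intro Lim_null_comparison[OF _ LIMSEQ_Suc[OF lim_const_over_n[of 1]]]) auto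
  then show ?thesis by (simp add: LIM_zero_iff)
qed

lemma grid_index_le:
  assumes "0 \<le> x" "x \<le> 1"
  shows "nat \<lfloor>x * real (Suc n)\<rfloor> \<le> Suc n"
proof -
  have "x * real (Suc n) \<le> 1 * real (Suc n)" using assms by (intro mult_right_mono) auto
  then have "x * real (Suc n) \<le> of_int (int (Suc n))" by simp
  then have "\<lfloor>x * real (Suc n)\<rfloor> \<le> int (Suc n)" by linarith
  then show ?thesis by simp
qed

lemma grid_point_mem:
  fixes p q :: real
  assumes "p \<le> q" "k \<le> Suc n"
  shows "p + (q - p) * (real k / real (Suc n)) \<in> {p..q}"
proof -
  have "real k / real (Suc n) \<le> 1" using assms by simp
  then have "(q - p) * (real k / real (Suc n)) \<le> (q - p) * 1" using assms by (intro mult_left_mono) auto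
  then show ?thesis using assms by simp
qed

context standard_brownian_motion
begin

lemma continuous_on_W: "w \<in> space M \<Longrightarrow> 0 \<le> u \<Longrightarrow> continuous_on {u..v} (\<lambda>t. W t w)"
  by (rule continuous_on_subset[OF continuous_paths]) auto

text \<open>A continuous path meets the closed set exactly if its distance to the set has infimum 0
  over the compact interval, and continuity makes this infimum visible on a countable family of grid
  points. An uncountable union of events thus becomes countable.\<close>

lemma hits_past:
  assumes "closed C" "0 \<le> p" "p \<le> q"
  shows "{w\<in>space M. \<exists>r\<in>{p..q}. W r w \<in> C} \<in> sets (past q)"
\<comment> \<open>\<open>infdist\<close> to the empty set is 0 by convention, so the distance
  criterion would fail there.\<close>
proof (cases "C = {}")
  case False
  define t where "t n k = p + (q - p) * (real k / real (Suc n))" for n k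
  have t: "t n k \<in> {p..q}" if "k \<le> Suc n" for n k
    unfolding t_def using assms(3) that by (rule grid_point_mem)
  have "(\<exists>r\<in>{p..q}. W r w \<in> C) \<longleftrightarrow> (\<forall>m. \<exists>n. \<exists>k\<in>{..Suc n}. infdist (W (t n k) w) C < 1 / real (Suc m))"
    (is "?L \<longleftrightarrow> ?R") if w: "w \<in> space M" for w
  proof
    have cont: "continuous_on {p..q} (\<lambda>r. infdist (W r w) C)"
      using continuous_on_W[OF w \<open>0 \<le> p\<close>] by (intro continuous_intros)
    show ?R if ?L
    proof
      fix m
      from that obtain r where r: "r \<in> {p..q}" "W r w \<in> C" by auto
      define x where "x = (if p < q then (r - p) / (q - p) else 0)"
      have x: "0 \<le> x" "x \<le> 1" "r = p + (q - p) * x" using r assms by (auto simp: x_def field_simps)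
      define k where "k n = nat \<lfloor>x * real (Suc n)\<rfloor>" for n
      have k: "k n \<le> Suc n" for n unfolding k_def using x(1,2) by (rule grid_index_le)
      have "(\<lambda>n. t n (k n)) \<longlonglongrightarrow> r"
        unfolding t_def k_def x(3) by (intro tendsto_intros tendsto_grid x)
      then have "(\<lambda>n. infdist (W (t n (k n)) w) C) \<longlonglongrightarrow> infdist (W r w) C"
        by (rule continuous_on_tendsto_compose[OF cont]) (use r t k in auto)
      then have "\<forall>\<^sub>F n in sequentially. infdist (W (t n (k n)) w) C < 1 / real (Suc m)"
        by (rule order_tendstoD) (use r in simp)
      then show "\<exists>n. \<exists>k\<in>{..Suc n}. infdist (W (t n k) w) C < 1 / real (Suc m)"
        using k by (auto simp: eventually_sequentially)
    qed
    show ?L if ?R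
    proof -
      have "{p..q} \<noteq> {}" "compact {p..q}" using assms by auto
      from continuous_attains_inf[OF this(2,1) cont] obtain r where
        r: "r \<in> {p..q}" "\<And>y. y \<in> {p..q} \<Longrightarrow> infdist (W r w) C \<le> infdist (W y w) C" by auto
      have "infdist (W r w) C < 1 / real (Suc m)" for m
        using that r(2) t by (metis atMost_iff le_less_trans)
      then have "infdist (W r w) C \<le> 0"
        by (meson le_less_linear nat_approx_posE not_less_iff_gr_or_eq order_less_trans)
      then have "infdist (W r w) C = 0" using infdist_nonneg[of "W r w" C] by linarith
      then show ?L using r(1) False \<open>closed C\<close> by (auto simp: in_closed_iff_infdist_zero)
    qed
  qed
  then have "{w\<in>space M. \<exists>r\<in>{p..q}. W r w \<in> C} =
     {w\<in>space (past q). \<forall>m. \<exists>n. \<exists>k\<in>{..Suc n}. infdist (W (t n k) w) C < 1 / real (Suc m)}"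
    unfolding space_past by (intro Collect_cong conj_cong refl)
  also have "\<dots> \<in> sets (past q)"
  proof (intro sets.sets_Collect_countable_All sets.sets_Collect_countable_Ex sets.sets_Collect_finite_Ex finite_atMost)
    fix m n k assume "k \<in> {..Suc n}"
    then have "W (t n k) \<in> borel_measurable (past q)" using t[of k n] assms by (intro W_past) auto
    then have "(\<lambda>w. infdist (W (t n k) w) C) \<in> borel_measurable (past q)"
      by (rule measurable_compose) (intro borel_measurable_continuous_onI continuous_intros)
    then show "{w \<in> space (past q). infdist (W (t n k) w) C < 1 / real (Suc m)} \<in> sets (past q)"
      by measurable
  qed
  finally show ?thesis .
qed auto

definition stays :: "real set \<Rightarrow> real \<Rightarrow> real \<Rightarrow> 'a set" where
  "stays I p q = {w\<in>space M. \<forall>r\<in>{p..q}. W r w \<in> I}"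

lemma stays_past:
  assumes "open I" "0 \<le> p" "p \<le> q"
  shows "stays I p q \<in> sets (past q)"
proof -
  have "stays I p q = space (past q) - {w\<in>space M. \<exists>r\<in>{p..q}. W r w \<in> - I}"
    by (auto simp: stays_def)
  then show ?thesis using hits_past[of "- I" p q] assms sets.compl_sets[of _ "past q"] by (auto simp: closed_Compl)
qed

lemma stays_events: "open I \<Longrightarrow> 0 \<le> p \<Longrightarrow> p \<le> q \<Longrightarrow> stays I p q \<in> events"
  using stays_past sets_past_events by blast

text \<open>\<open>Z n\<close> adds the martingale increments over those grid cells at whose left
  end the path has not yet left \<open>I\<close>. Each summand integrates to 0 by
  \<open>trig_martingale\<close>, and \<open>Z n\<close> is the value at the exit time rounded up to
  the grid. Path continuity and a uniform bound give the limit, and the measurability of the stopped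
  value comes from the same limit.\<close>

lemma
  assumes A: "A \<in> sets (past u)" and AI: "\<And>w. w \<in> A \<Longrightarrow> W u w \<in> I" and I: "open I" and uv: "0 \<le> u" "u \<le> v"
  defines "T \<equiv> \<lambda>w. exit_time I u v (\<lambda>t. W t w)"
  shows optional_stopping_measurable: "(\<lambda>w. indicator A w * trig c b (T w) (W (T w) w)) \<in> borel_measurable M"
    and optional_stopping: "(\<integral>w. indicator A w * trig c b (T w) (W (T w) w) \<partial>M) = (\<integral>w. indicator A w * trig c b u (W u w) \<partial>M)"
proof -
  define h where "h r w = trig c b r (W r w)" for r w
  define t where "t n k = u + (v - u) * (real k / real (Suc n))" for n k
  have t0: "t n 0 = u" for n by (simp add: t_def)
  have t: "t n k \<in> {u..v}" if "k \<le> Suc n" for n k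
    unfolding t_def using uv(2) that by (rule grid_point_mem)
  have tmono: "t n k \<le> t n (Suc k)" for n k
    using uv by (auto simp: t_def intro!: mult_left_mono divide_right_mono)
  define Z where "Z n w = indicator A w * h u w +
     (\<Sum>k<Suc n. indicator (A \<inter> stays I u (t n k)) w * h (t n (Suc k)) w - indicator (A \<inter> stays I u (t n k)) w * h (t n k) w)" for n w
  have [measurable]: "A \<in> events" using A sets_past_events by auto
  have As: "A \<inter> stays I u (t n k) \<in> sets (past (t n k))" if "k < Suc n" for n k
    using that t[of k n] uv A I sets_past_mono[of u "t n k"] by (intro sets.Int stays_past) auto
  have As': "A \<inter> stays I u (t n k) \<in> events" if "k < Suc n" for n k
    using As[OF that] sets_past_events by auto
  have int: "integrable M (\<lambda>w. indicator B w * h r w)" if "B \<in> events" "0 \<le> r" for B r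
    unfolding h_def using that by (rule integrable_indicator_trig)
  have EZ: "integrable M (Z n)" "(\<integral>w. Z n w \<partial>M) = (\<integral>w. indicator A w * h u w \<partial>M)" for n
  proof -
    have i1: "integrable M (\<lambda>w. indicator (A \<inter> stays I u (t n k)) w * h (t n k) w)"
      "integrable M (\<lambda>w. indicator (A \<inter> stays I u (t n k)) w * h (t n (Suc k)) w)" if "k < Suc n" for k
      using that t[of k n] t[of "Suc k" n] uv As'[OF that] by (auto intro!: int)
    have e: "(\<integral>w. indicator (A \<inter> stays I u (t n k)) w * h (t n (Suc k)) w - indicator (A \<inter> stays I u (t n k)) w * h (t n k) w \<partial>M) = 0"
      if "k < Suc n" for k
      using i1[OF that] trig_martingale[OF As[OF that], of "t n (Suc k)" c b] t[of k n] that uv tmono[of n k]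
      by (subst Bochner_Integration.integral_diff) (auto simp: h_def)
    have i0: "integrable M (\<lambda>w. indicator A w * h u w)" using uv by (intro int) auto
    show "integrable M (Z n)" unfolding Z_def
      by (intro Bochner_Integration.integrable_add i0 Bochner_Integration.integrable_sum Bochner_Integration.integrable_diff i1) auto
    show "(\<integral>w. Z n w \<partial>M) = (\<integral>w. indicator A w * h u w \<partial>M)" unfolding Z_def
      by (subst Bochner_Integration.integral_add, use i0 i1 in simp, use i1 in \<open>intro Bochner_Integration.integrable_sum Bochner_Integration.integrable_diff\<close>; (subst Bochner_Integration.integral_sum)?; use i1 e in auto)
  qed
  have key: "\<exists>m. m \<le> Suc n \<and> \<bar>t n m - T w\<bar> \<le> (v - u) / real (Suc n) \<and> Z n w = h (t n m) w" if w: "w \<in> A" for n w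
  proof (cases "u = v")
    case True
    then have "T w = u" using exit_time_mem[OF uv(2), of "\<lambda>t. W t w" I] w uv I sets.sets_into_space[OF \<open>A \<in> events\<close>]
      by (auto simp: T_def intro!: continuous_on_W)
    then show ?thesis using True w by (intro exI[of _ 0]) (simp add: t_def Z_def)
  next
    case False
    then have uv': "u < v" using uv by simp
    have wM: "w \<in> space M" using w sets.sets_into_space[OF \<open>A \<in> events\<close>] by auto
    note ex = uv(2) continuous_on_W[OF wM uv(1)] I
    have T: "T w \<in> {u..v}" "\<And>r. u \<le> r \<Longrightarrow> r < T w \<Longrightarrow> W r w \<in> I" "T w < v \<Longrightarrow> W (T w) w \<notin> I"
      unfolding T_def using exit_time_mem[OF ex] exit_time_inside[OF ex] exit_time_outside[OF ex] by auto
    define y where "y = real (Suc n) * (T w - u) / (v - u)"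
    \<comment> \<open>\<open>m\<close> is the index of the exit time rounded up to the grid: cells
      with index below \<open>m\<close> are those whose left end lies strictly before the
      exit.\<close>
    define m where "m = nat \<lceil>y\<rceil>"
    have y0: "0 \<le> y" using T uv' by (simp add: y_def)
    have rm: "real m = of_int \<lceil>y\<rceil>" using y0 by (simp add: m_def)
    have m: "y \<le> real m" "real m < y + 1" unfolding rm by linarith+
    have lt: "t n k < T w \<longleftrightarrow> real k < y" for k
      using uv' by (simp add: t_def y_def field_simps)
    have "real (Suc n) * (T w - u) \<le> real (Suc n) * (v - u)" using T by (intro mult_left_mono) auto
    then have "y \<le> real (Suc n)" using uv' by (simp add: y_def pos_divide_le_eq)
    then have mn: "m \<le> Suc n" unfolding m_def by (simp add: nat_le_iff ceiling_le_iff)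
    have st: "w \<in> stays I u (t n k) \<longleftrightarrow> k < m" if k: "k < Suc n" for k
    proof -
      have km: "k < m \<longleftrightarrow> t n k < T w" unfolding lt m_def using y0 by linarith
      have "w \<in> stays I u (t n k)" if "t n k < T w"
        using that T(2) wM by (auto simp: stays_def)
      moreover have "w \<notin> stays I u (t n k)" if "\<not> t n k < T w"
      proof -
        \<comment> \<open>\<open>k < Suc n\<close> puts the grid point before \<open>v\<close>; an
          exit time not later than it is therefore below the cap and a genuine exit.\<close>
        have "real k / real (Suc n) < real (Suc n) / real (Suc n)" using k by (intro divide_strict_right_mono) auto
        then have "t n k < t n (Suc n)" using uv' unfolding t_def by (intro add_strict_left_mono mult_strict_left_mono) auto
        also have "t n (Suc n) = v" by (simp add: t_def)
        finally have "T w < v" using that by simp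
        from T(3)[OF this] that T(1) show ?thesis by (auto simp: stays_def)
      qed
      ultimately show ?thesis using km by blast
    qed
    have "Z n w = h u w + (\<Sum>k<Suc n. if k < m then h (t n (Suc k)) w - h (t n k) w else 0)"
      unfolding Z_def using w st by (auto simp: indicator_def intro!: sum.cong simp del: sum.lessThan_Suc)
    also have "(\<Sum>k<Suc n. if k < m then h (t n (Suc k)) w - h (t n k) w else 0) = (\<Sum>k<m. h (t n (Suc k)) w - h (t n k) w)"
      using mn by (intro sum.mono_neutral_cong_right) auto
    also have "\<dots> = h (t n m) w - h u w"
      using sum_lessThan_telescope[of "\<lambda>k. h (t n k) w" m] by (simp add: t0)
    finally have "Z n w = h (t n m) w" by simp
    moreover have "\<bar>t n m - T w\<bar> \<le> (v - u) / real (Suc n)"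
    proof -
      have "(v - u) / real (Suc n) * y = T w - u" using uv' by (simp add: y_def del: of_nat_Suc)
      then have "t n m - T w = (v - u) / real (Suc n) * (real m - y)" by (simp add: t_def right_diff_distrib)
      also have "\<bar>\<dots>\<bar> \<le> (v - u) / real (Suc n) * 1"
        unfolding abs_mult using m uv' by (intro mult_mono) auto
      finally show ?thesis by simp
    qed
    ultimately show ?thesis using mn by blast
  qed
  have lim: "(\<lambda>n. Z n w) \<longlonglongrightarrow> indicator A w * h (T w) w" if wM: "w \<in> space M" for w
  proof (cases "w \<in> A")
    case True
    obtain m where m: "\<And>n. m n \<le> Suc n" "\<And>n. \<bar>t n (m n) - T w\<bar> \<le> (v - u) / real (Suc n)" "\<And>n. Z n w = h (t n (m n)) w"
      using key[OF True] by metis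
    have "(\<lambda>n. (v - u) / real (Suc n)) \<longlonglongrightarrow> 0"
      by (rule LIMSEQ_Suc[OF lim_const_over_n])
    then have "(\<lambda>n. t n (m n) - T w) \<longlonglongrightarrow> 0"
      by (rule Lim_null_comparison[rotated]) (use m in auto)
    then have tT: "(\<lambda>n. t n (m n)) \<longlonglongrightarrow> T w" by (simp add: LIM_zero_iff)
    have cont: "continuous_on {u..v} (\<lambda>r. h r w)"
      unfolding h_def trig_def using continuous_on_W[OF wM uv(1)] by (intro continuous_intros) auto
    have "(\<lambda>n. h (t n (m n)) w) \<longlonglongrightarrow> h (T w) w"
      by (rule continuous_on_tendsto_compose[OF cont tT])
        (use exit_time_mem[OF uv(2) continuous_on_W[OF wM uv(1)] I] t m(1) in \<open>auto simp: T_def\<close>)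
    then show ?thesis using m(3) True by simp
  next
    case False
    then show ?thesis by (simp add: Z_def)
  qed
  have bound: "\<bar>Z n w\<bar> \<le> exp (c\<^sup>2 * v / 2)" for n w
  proof (cases "w \<in> A")
    case True
    from key[OF this, of n] obtain m where "m \<le> Suc n" "Z n w = h (t n m) w" by auto
    then have "\<bar>Z n w\<bar> \<le> exp (c\<^sup>2 * t n m / 2)" "t n m \<le> v" using abs_trig_le t[of m n] by (auto simp: h_def)
    moreover have "exp (c\<^sup>2 * t n m / 2) \<le> exp (c\<^sup>2 * v / 2)" using \<open>t n m \<le> v\<close> by (simp add: mult_left_mono)
    ultimately show ?thesis by linarith
  qed (simp add: Z_def)
  have meas: "(\<lambda>w. indicator A w * h (T w) w) \<in> borel_measurable M"
    by (rule borel_measurable_LIMSEQ_real[OF lim]) (use EZ in auto)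
  then show "(\<lambda>w. indicator A w * trig c b (T w) (W (T w) w)) \<in> borel_measurable M"
    by (simp add: h_def)
  have "(\<lambda>n. \<integral>w. Z n w \<partial>M) \<longlonglongrightarrow> (\<integral>w. indicator A w * h (T w) w \<partial>M)"
    by (rule integral_dominated_convergence[where w="\<lambda>_. exp (c\<^sup>2 * v / 2)"])
      (use meas EZ lim bound in auto)
  then have "(\<lambda>n. \<integral>w. indicator A w * h u w \<partial>M) \<longlonglongrightarrow> (\<integral>w. indicator A w * h (T w) w \<partial>M)"
    by (simp add: EZ)
  then show "(\<integral>w. indicator A w * trig c b (T w) (W (T w) w) \<partial>M) = (\<integral>w. indicator A w * trig c b u (W u w) \<partial>M)"
    by (simp add: LIMSEQ_const_iff h_def)
qed

text \<open>Optional stopping with phase 0: a path that has left \<open>I\<close> is stopped on the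
  frontier, where the sine is 0, so only paths staying in \<open>I\<close> contribute at time
  \<open>v\<close>. Hence sin (c y) behaves like an eigenfunction of the motion killed on leaving
  \<open>I\<close>.\<close>

lemma stays_integral_sin:
  assumes A: "A \<in> sets (past u)" and AI: "\<And>w. w \<in> A \<Longrightarrow> W u w \<in> I" and I: "open I" and uv: "0 \<le> u" "u \<le> v"
    and zero: "\<And>y. y \<in> frontier I \<Longrightarrow> sin (c * y) = 0"
  shows "(\<integral>w. indicator (A \<inter> stays I u v) w * sin (c * W v w) \<partial>M) = exp (- (c\<^sup>2 * (v - u) / 2)) * (\<integral>w. indicator A w * sin (c * W u w) \<partial>M)"
proof -
  define T where "T w = exit_time I u v (\<lambda>t. W t w)" for w
  have AM: "A \<subseteq> space M" using A sets_past_events sets.sets_into_space by blast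
  have "indicator A w * trig c 0 (T w) (W (T w) w) = indicator (A \<inter> stays I u v) w * trig c 0 v (W v w)" for w
  proof (cases "w \<in> A")
    case True
    then have wM: "w \<in> space M" using AM by auto
    note ex = uv(2) continuous_on_W[OF wM uv(1)] I
    show ?thesis
    proof (cases "w \<in> stays I u v")
      case st: True
      then have "T w = v" using exit_time_mem[OF ex] exit_time_outside[OF ex] unfolding T_def stays_def
        by (smt (verit) atLeastAtMost_iff mem_Collect_eq)
      then show ?thesis using True st by simp
    next
      case False
      then have "T w < v \<or> W v w \<notin> I" using exit_time_mem[OF ex] exit_time_inside[OF ex] wM unfolding T_def stays_def
        by (smt (verit) atLeastAtMost_iff mem_Collect_eq)
      then have "W (T w) w \<in> frontier I" using exit_time_frontier[OF ex AI[OF True]] by (simp add: T_def)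
      then show ?thesis using False zero by (simp add: trig_def)
    qed
  qed simp
  then have "(\<integral>w. indicator (A \<inter> stays I u v) w * trig c 0 v (W v w) \<partial>M) = (\<integral>w. indicator A w * trig c 0 u (W u w) \<partial>M)"
    using optional_stopping[OF A AI I uv, of c 0] by (simp add: T_def)
  moreover have "(\<integral>w. indicator B w * trig c 0 r (W r w) \<partial>M) = exp (c\<^sup>2 * r / 2) * (\<integral>w. indicator B w * sin (c * W r w) \<partial>M)" for B r
    unfolding trig_def by (subst integral_mult_right_zero[symmetric]) (simp add: mult_ac)
  ultimately have "exp (c\<^sup>2 * v / 2) * (\<integral>w. indicator (A \<inter> stays I u v) w * sin (c * W v w) \<partial>M) = exp (c\<^sup>2 * u / 2) * (\<integral>w. indicator A w * sin (c * W u w) \<partial>M)"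
    by simp
  then have "(\<integral>w. indicator (A \<inter> stays I u v) w * sin (c * W v w) \<partial>M) = exp (c\<^sup>2 * u / 2) / exp (c\<^sup>2 * v / 2) * (\<integral>w. indicator A w * sin (c * W u w) \<partial>M)"
    by (simp add: field_simps)
  also have "exp (c\<^sup>2 * u / 2) / exp (c\<^sup>2 * v / 2) = exp (- (c\<^sup>2 * (v - u) / 2))"
    by (simp add: exp_diff[symmetric] field_simps)
  finally show ?thesis .
qed

end

section \<open>The last zero before time 1\<close>

lemma continuous_nonzero_positive:
  fixes w :: "real \<Rightarrow> real"
  assumes "continuous_on {p..q} w" "\<And>r. p \<le> r \<Longrightarrow> r \<le> q \<Longrightarrow> w r \<noteq> 0"
    and "x \<in> {p..q}" "0 < w x" "r \<in> {p..q}"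
  shows "0 < w r"
proof (rule ccontr)
  assume "\<not> 0 < w r"
  then have neg: "w r < 0" using assms(2)[of r] assms(5) by auto
  have "\<exists>y\<in>{p..q}. w y = 0"
  proof (cases "r \<le> x")
    case True
    then obtain y where "r \<le> y" "y \<le> x" "w y = 0"
      using IVT'[of w r 0 x] neg assms continuous_on_subset[OF assms(1), of "{r..x}"] by auto
    then show ?thesis using assms by auto
  next
    case False
    then obtain y where "x \<le> y" "y \<le> r" "w y = 0"
      using IVT2'[of w r 0 x] neg assms continuous_on_subset[OF assms(1), of "{x..r}"] by auto
    then show ?thesis using assms by auto
  qed
  then show False using assms(2) by auto
qed

lemma
  assumes w: "continuous_on {0..1} w" and w0: "w 0 = (0::real)"
  shows last_zero_mem: "last_zero w \<in> {0..1}"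
    and last_zero_zero: "w (last_zero w) = 0"
    and last_zero_less_iff: "\<And>s. 0 \<le> s \<Longrightarrow> s \<le> 1 \<Longrightarrow> last_zero w < s \<longleftrightarrow> (\<forall>r\<in>{s..1}. w r \<noteq> 0)"
    and last_zero_positive: "\<And>r. 0 < w 1 \<Longrightarrow> last_zero w < r \<Longrightarrow> r \<le> 1 \<Longrightarrow> 0 < w r"
    and last_zero_less_1: "0 < w 1 \<Longrightarrow> last_zero w < 1"
proof -
  define S where "S = {t. 0 \<le> t \<and> t \<le> 1 \<and> w t = 0}"
  let ?g = "last_zero w"
  have g: "?g = Sup S" by (simp add: last_zero_def S_def)
  have "closed ({0..1} \<inter> w -` {0})"
    by (rule continuous_closed_preimage) (use w in auto)
  moreover have "{0..1} \<inter> w -` {0} = S" by (auto simp: S_def)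
  ultimately have "closed S" by simp
  have bdd: "bdd_above S" by (auto simp: S_def intro!: bdd_aboveI[of _ 1])
  have "0 \<in> S" using w0 by (simp add: S_def)
  then have "?g \<in> S" unfolding g using \<open>closed S\<close> bdd by (intro closed_contains_Sup) auto
  then show 1: "?g \<in> {0..1}" and 2: "w ?g = 0" by (auto simp: S_def)
  have 3: "w r \<noteq> 0" if "?g < r" "r \<le> 1" for r
  proof
    assume "w r = 0"
    then have "r \<in> S" using that 1 by (auto simp: S_def)
    then have "r \<le> ?g" unfolding g using bdd by (rule cSup_upper)
    with that show False by simp
  qed
  show "?g < s \<longleftrightarrow> (\<forall>r\<in>{s..1}. w r \<noteq> 0)" if "0 \<le> s" "s \<le> 1" for s
    using 1 2 3 that by (metis atLeastAtMost_iff leI less_le_trans)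
  show 4: "?g < 1" if "0 < w 1" using 1 2 that by (cases "?g = 1") auto
  show "0 < w r" if "0 < w 1" "?g < r" "r \<le> 1" for r
    by (rule continuous_nonzero_positive[of r 1 w 1])
      (use that 1 3 in \<open>auto intro!: continuous_on_subset[OF w]\<close>)
qed

lemma
  assumes w: "continuous_on {1..} w" and ex: "\<exists>s\<ge>1. w s = (0::real)"
  shows next_zero_ge: "1 \<le> next_zero w"
    and next_zero_zero: "w (next_zero w) = 0"
    and next_zero_before: "\<And>r. 1 \<le> r \<Longrightarrow> r < next_zero w \<Longrightarrow> w r \<noteq> 0"
    and next_zero_greater_iff: "\<And>t. 1 \<le> t \<Longrightarrow> t < next_zero w \<longleftrightarrow> (\<forall>r\<in>{1..t}. w r \<noteq> 0)"
    and next_zero_positive: "\<And>r. 0 < w 1 \<Longrightarrow> 1 \<le> r \<Longrightarrow> r < next_zero w \<Longrightarrow> 0 < w r"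
    and next_zero_greater_1: "0 < w 1 \<Longrightarrow> 1 < next_zero w"
proof -
  define S where "S = {t. 1 \<le> t \<and> w t = 0}"
  let ?d = "next_zero w"
  have d: "?d = Inf S" by (simp add: next_zero_def S_def)
  have "closed ({1..} \<inter> w -` {0})"
    by (rule continuous_closed_preimage) (use w in auto)
  moreover have "{1..} \<inter> w -` {0} = S" by (auto simp: S_def)
  ultimately have "closed S" by simp
  have bdd: "bdd_below S" by (auto simp: S_def intro!: bdd_belowI[of _ 1])
  have "S \<noteq> {}" using ex by (auto simp: S_def)
  then have "?d \<in> S" unfolding d using \<open>closed S\<close> bdd by (intro closed_contains_Inf) auto
  then show 1: "1 \<le> ?d" and 2: "w ?d = 0" by (auto simp: S_def)
  show 3: "w r \<noteq> 0" if "1 \<le> r" "r < ?d" for r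
  proof
    assume "w r = 0"
    then have "r \<in> S" using that 1 by (auto simp: S_def)
    then have "?d \<le> r" unfolding d using bdd by (rule cInf_lower)
    with that show False by simp
  qed
  show "t < ?d \<longleftrightarrow> (\<forall>r\<in>{1..t}. w r \<noteq> 0)" if "1 \<le> t" for t
    using 1 2 3 that by (metis atLeastAtMost_iff leI le_less_trans)
  show "1 < ?d" if "0 < w 1" using 1 2 that by (cases "?d = 1") auto
  show "0 < w r" if "0 < w 1" "1 \<le> r" "r < ?d" for r
    by (rule continuous_nonzero_positive[of 1 r w 1])
      (use that 1 3 in \<open>auto intro!: continuous_on_subset[OF w]\<close>)
qed

context standard_brownian_motion
begin

lemma continuous_on_W_Icc01: "w \<in> space M \<Longrightarrow> continuous_on {0..1} (\<lambda>t. W t w)"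
  by (rule continuous_on_W) auto

lemma continuous_on_W_ge1: "w \<in> space M \<Longrightarrow> continuous_on {1..} (\<lambda>t. W t w)"
  by (rule continuous_on_subset[OF continuous_paths]) auto

abbreviation left_zero :: "'a \<Rightarrow> real" where
  "left_zero w \<equiv> last_zero (\<lambda>t. W t w)"

definition left_low :: "real \<Rightarrow> real \<Rightarrow> 'a set" where
  "left_low a s = {w\<in>space M. 0 < W 1 w \<and> left_zero w < s \<and> (\<forall>r\<in>{left_zero w..1}. W r w < a)}"

lemma stays_pos_iff:
  assumes "w \<in> space M" "0 \<le> s" "s \<le> 1"
  shows "w \<in> stays {0<..} s 1 \<longleftrightarrow> 0 < W 1 w \<and> left_zero w < s"
proof -
  note lz = continuous_on_W_Icc01[OF assms(1)] start_zero[OF assms(1)]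
  show ?thesis
  proof
    assume "w \<in> stays {0<..} s 1"
    then have pos: "\<And>r. r \<in> {s..1} \<Longrightarrow> 0 < W r w" by (simp add: stays_def)
    then have "\<forall>r\<in>{s..1}. W r w \<noteq> 0" by fastforce
    then show "0 < W 1 w \<and> left_zero w < s"
      using last_zero_less_iff[OF lz assms(2,3)] pos[of 1] assms by auto
  next
    assume "0 < W 1 w \<and> left_zero w < s"
    then show "w \<in> stays {0<..} s 1"
      using last_zero_positive[OF lz] assms by (auto simp: stays_def)
  qed
qed

text \<open>The barrier \<open>a\<close> does not show in the value. For each cell, \<open>C\<close>
  asks only for positivity after it and \<open>D\<close> also for staying below \<open>a\<close>,
  and both have the same sine integral by \<open>stays_integral_sin\<close>. Refining the grid turns
  the union of the \<open>C\<close> into positivity on \<open>[s, 1]\<close> and the union of the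
  \<open>D\<close> into \<open>left_low a s\<close>.\<close>

lemma
  assumes a: "0 < a" and s: "0 < s" "s \<le> 1" and c: "sin (c * a) = 0"
  shows left_low_past: "left_low a s \<in> sets (past 1)"
    and left_low_integral_sin: "(\<integral>w. indicator (left_low a s) w * sin (c * W 1 w) \<partial>M) =
      exp (- (c\<^sup>2 * (1 - s) / 2)) * (\<integral>w. indicator {0<..} (W s w) * sin (c * W s w) \<partial>M)"
proof -
  let ?E = "\<lambda>X. \<integral>w. indicator X w * sin (c * W 1 w) \<partial>M"
  define t where "t N i = s * (real i / real (Suc N))" for N i
  have t: "0 \<le> t N i" "t N i \<le> s" if "i \<le> Suc N" for N i
  proof -
    have "real i / real (Suc N) \<le> 1" using that by simp
    then have "s * (real i / real (Suc N)) \<le> s * 1" using s by (intro mult_left_mono) auto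
    then show "t N i \<le> s" by (simp add: t_def)
    show "0 \<le> t N i" using s by (simp add: t_def)
  qed
  have t1: "t N i \<le> 1" if "i \<le> Suc N" for N i using t[OF that] s by simp
  have tmono: "t N i \<le> t N j" if "i \<le> j" for N i j
    using that s by (auto simp: t_def intro!: mult_left_mono divide_right_mono)
  \<comment> \<open>A zero in the closed cell together with positivity from its right end on means
    that the last zero lies in the half-open cell. The value at the right end is kept below
    \<open>a\<close> so that both killed motions start inside their interval.\<close>
  define B where "B N i = {w\<in>space M. \<exists>r\<in>{t N i..t N (Suc i)}. W r w \<in> {0}} \<inter> {w\<in>space M. W (t N (Suc i)) w \<in> {0<..<a}}" for N i
  have B: "B N i \<in> sets (past (t N (Suc i)))" if "i \<le> N" for N i
  proof -
    have "{w\<in>space (past (t N (Suc i))). W (t N (Suc i)) w \<in> {0<..<a}} \<in> sets (past (t N (Suc i)))"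
      by (rule measurable_sets_Collect[OF W_past]) (use t[of "Suc i" N] that in auto)
    then show ?thesis unfolding B_def
      using hits_past[of "{0}" "t N i" "t N (Suc i)"] t[of i N] tmono[of i "Suc i" N] that by auto
  qed
  have Bmem: "w \<in> B N i \<Longrightarrow> W (t N (Suc i)) w \<in> {0<..<a}" for w N i
    by (simp add: B_def)
  define C where "C N i = B N i \<inter> stays {0<..} (t N (Suc i)) 1" for N i
  define D where "D N i = B N i \<inter> stays {0<..<a} (t N (Suc i)) 1" for N i
  have C: "C N i \<in> sets (past 1)" and D: "D N i \<in> sets (past 1)" if "i \<le> N" for N i
    using B[OF that] sets_past_mono[of "t N (Suc i)" 1] t[of "Suc i" N] t1[of "Suc i" N] that
    unfolding C_def D_def by (auto intro!: sets.Int stays_past)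
  have CD: "?E (C N i) = ?E (D N i)"
    if i: "i \<le> N" for N i
  proof -
    note 1 = B[OF i] _ _ t(1)[of "Suc i" N] t1[of "Suc i" N]
    have "?E (C N i) = exp (- (c\<^sup>2 * (1 - t N (Suc i)) / 2)) * (\<integral>w. indicator (B N i) w * sin (c * W (t N (Suc i)) w) \<partial>M)"
      unfolding C_def by (rule stays_integral_sin[OF 1]) (use Bmem[of _ N i] i in \<open>auto\<close>)
    moreover have "?E (D N i) = exp (- (c\<^sup>2 * (1 - t N (Suc i)) / 2)) * (\<integral>w. indicator (B N i) w * sin (c * W (t N (Suc i)) w) \<partial>M)"
      unfolding D_def by (rule stays_integral_sin[OF 1]) (use Bmem[of _ N i] i a c in \<open>auto simp: frontier_def\<close>)
    ultimately show ?thesis by simp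
  qed
  have Cmem: "w \<in> C N i \<longleftrightarrow> w \<in> space M \<and> 0 < W 1 w \<and> t N i \<le> left_zero w \<and> left_zero w < t N (Suc i) \<and> W (t N (Suc i)) w < a"
    if i: "i \<le> N" for N i w
  proof (cases "w \<in> space M")
    case True
    note lz = continuous_on_W_Icc01[OF True] start_zero[OF True]
    note st = stays_pos_iff[OF True t(1)[of "Suc i" N] t1[of "Suc i" N]]
    have ti: "0 \<le> t N i" "t N i \<le> 1" using t[of i N] t1[of i N] i by auto
    have "(\<exists>r\<in>{t N i..t N (Suc i)}. W r w = 0) \<longleftrightarrow> t N i \<le> left_zero w" if g: "left_zero w < t N (Suc i)"
    proof
      assume "\<exists>r\<in>{t N i..t N (Suc i)}. W r w = 0"
      then have "\<not> (\<forall>r\<in>{t N i..1}. W r w \<noteq> 0)" using t1[of "Suc i" N] i by force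
      then show "t N i \<le> left_zero w" using last_zero_less_iff[OF lz ti] by auto
    next
      assume "t N i \<le> left_zero w"
      then show "\<exists>r\<in>{t N i..t N (Suc i)}. W r w = 0"
        using g last_zero_zero[OF lz] by (intro bexI[of _ "left_zero w"]) auto
    qed
    moreover have "0 < W (t N (Suc i)) w" if "0 < W 1 w" "left_zero w < t N (Suc i)"
      using last_zero_positive[OF lz that] t1[of "Suc i" N] i by auto
    ultimately show ?thesis using True st i by (auto simp: C_def B_def)
  next
    case False
    then show ?thesis by (simp add: C_def B_def)
  qed
  have Dmem: "w \<in> D N i \<longleftrightarrow> w \<in> C N i \<and> (\<forall>r\<in>{t N (Suc i)..1}. W r w < a)" for N i w
    by (auto simp: C_def D_def stays_def)
  have disj: "i = j" if "w \<in> C N i" "w \<in> C N j" "i \<le> N" "j \<le> N" for w N i j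
    using that Cmem[of i N w] Cmem[of j N w] tmono[of "Suc i" j N] tmono[of "Suc j" i N]
    by (cases i j rule: linorder_cases) auto
  have "disjoint_family_on (C N) {..N}" "disjoint_family_on (D N) {..N}" for N
    using disj Dmem unfolding disjoint_family_on_def by (metis atMost_iff disjoint_iff)+
  note ind = indicator_UN_disjoint[OF finite_atMost this(1)] indicator_UN_disjoint[OF finite_atMost this(2)]
  have Cev: "C N i \<in> events" and Dev: "D N i \<in> events" if "i \<le> N" for N i
    using C[OF that] D[OF that] sets_past_events by auto
  have int: "integrable M (\<lambda>w. indicator X w * sin (c * W 1 w))" if "X \<in> events" for X
    by (rule integrable_const_bound[where B=1]) (use that in \<open>auto simp: indicator_def intro!: borel_measurable_times\<close>)
  have eq: "?E (\<Union>i\<le>N. C N i) = ?E (\<Union>i\<le>N. D N i)" for N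
    unfolding ind sum_distrib_right
    by (subst (1 2) Bochner_Integration.integral_sum) (auto simp: CD intro!: int Cev Dev)
  have cell: "\<exists>i\<le>N. t N i \<le> g \<and> g < t N (Suc i)" if "0 \<le> g" "g < s" for g N
  proof -
    define i where "i = nat \<lfloor>g / s * real (Suc N)\<rfloor>"
    have y: "0 \<le> g / s * real (Suc N)" "g / s * real (Suc N) < real (Suc N)"
      using that s by (auto simp: pos_divide_less_eq simp del: of_nat_Suc)
    have ri: "real i = of_int \<lfloor>g / s * real (Suc N)\<rfloor>" using y(1) by (simp add: i_def)
    have i: "real i \<le> g / s * real (Suc N)" "g / s * real (Suc N) < real (Suc i)"
      using ri by linarith+
    have "i \<le> N" using i y by linarith
    moreover have "t N i \<le> g" "g < t N (Suc i)"
      using i s by (auto simp: t_def pos_divide_le_eq pos_less_divide_eq field_simps simp del: of_nat_Suc)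
    ultimately show ?thesis by blast
  qed
  have tdiff: "t N (Suc i) = t N i + s / real (Suc N)" for N i
    by (simp add: t_def add_divide_distrib distrib_left)
  \<comment> \<open>Membership is eventually constant in \<open>N\<close> for each path; dominated
    convergence then passes from the events to the integrals.\<close>
  have conv: "(\<forall>\<^sub>F N in sequentially. w \<in> (\<Union>i\<le>N. C N i) \<longleftrightarrow> w \<in> stays {0<..} s 1) \<and>
      (\<forall>\<^sub>F N in sequentially. w \<in> (\<Union>i\<le>N. D N i) \<longleftrightarrow> w \<in> left_low a s)" for w
  proof (cases "w \<in> stays {0<..} s 1")
    case False
    have "w \<notin> C N i" if "i \<le> N" for N i
      using False Cmem[OF that, of w] stays_pos_iff[of w s] t[of "Suc i" N] s that by auto
    moreover have "w \<notin> left_low a s" using False stays_pos_iff[of w s] s by (auto simp: left_low_def)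
    ultimately show ?thesis using False by (auto simp: Dmem)
  next
    case True
    then have wM: "w \<in> space M" by (simp add: stays_def)
    note lz = continuous_on_W_Icc01[OF wM] start_zero[OF wM]
    define g where "g = left_zero w"
    have g: "0 \<le> g" "g < s" "0 < W 1 w" "W g w = 0"
      using True stays_pos_iff[OF wM, of s] s last_zero_mem[OF lz] last_zero_zero[OF lz] by (auto simp: g_def)
    \<comment> \<open>The path is 0 at its last zero and hence below \<open>a\<close> nearby. On a
      fine grid the right end of the cell containing the last zero falls into this
      neighbourhood.\<close>
    have "((\<lambda>r. W r w) \<longlongrightarrow> W g w) (at g within {0..1})"
      using lz(1) g(1,2) s by (auto simp: continuous_on_def)
    then have "\<forall>\<^sub>F r in at g within {0..1}. W r w < a"
      by (rule order_tendstoD) (use g a in simp)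
    then obtain e where e: "e > 0" "\<And>r. r \<in> {0..1} \<Longrightarrow> r \<noteq> g \<Longrightarrow> dist r g < e \<Longrightarrow> W r w < a"
      unfolding eventually_at by blast
    have small: "\<forall>\<^sub>F N in sequentially. s / real (Suc N) < x" if "x > 0" for x
      using that by (rule order_tendstoD(2)[OF LIMSEQ_Suc[OF lim_const_over_n]])
    have D0: "w \<in> (\<Union>i\<le>N. D N i)" if "s / real (Suc N) < e" "w \<in> left_low a s" for N
    proof -
      obtain i where i: "i \<le> N" "t N i \<le> g" "g < t N (Suc i)" using cell[OF g(1,2)] by blast
      show ?thesis using i that(2) t1[of "Suc i" N]
        by (auto simp: Dmem Cmem left_low_def g_def[symmetric] intro!: bexI[of _ i])
    qed
    have 1: "w \<in> (\<Union>i\<le>N. C N i)" if "s / real (Suc N) < e" for N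
    proof -
      obtain i where i: "i \<le> N" "t N i \<le> g" "g < t N (Suc i)" using cell[OF g(1,2)] by blast
      have "W (t N (Suc i)) w < a"
        by (rule e(2)) (use i that t[of "Suc i" N] t1[of "Suc i" N] tdiff[of N i] in \<open>auto simp: dist_real_def\<close>)
      then show ?thesis using i g wM by (auto simp: Cmem g_def[symmetric])
    qed
    have C: "\<forall>\<^sub>F N in sequentially. w \<in> (\<Union>i\<le>N. C N i)"
      using small[OF e(1)] by eventually_elim (rule 1)
    have D: "\<forall>\<^sub>F N in sequentially. w \<in> (\<Union>i\<le>N. D N i) \<longleftrightarrow> w \<in> left_low a s"
    proof (cases "w \<in> left_low a s")
      case True
      show ?thesis using small[OF e(1)] by eventually_elim (use D0 True in blast)
    next
      case False
      then obtain r where r: "g \<le> r" "r \<le> 1" "a \<le> W r w"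
        using g wM by (auto simp: left_low_def g_def[symmetric] not_less)
      then have "g < r" using g a by (cases "g = r") auto
      \<comment> \<open>A time \<open>r\<close> at which the path is at least \<open>a\<close> lies
        strictly after the last zero, hence beyond the end of its cell once the mesh is below
        \<open>r - g\<close>.\<close>
      have "w \<notin> D N i" if N: "s / real (Suc N) < r - g" and i: "i \<le> N" for N i
      proof
        assume D: "w \<in> D N i"
        then have "t N i \<le> g" using i by (simp add: Dmem Cmem g_def)
        then have "r \<in> {t N (Suc i)..1}" using N r tdiff[of N i] by auto
        then have "W r w < a" using D unfolding Dmem by blast
        then show False using r by simp
      qed
      then show ?thesis using small[of "r - g"] \<open>g < r\<close> False by (auto elim!: eventually_mono)
    qed
    show ?thesis using C D True by simp
  qed
  \<comment> \<open>As a limit inferior of grid events, the event belongs to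
    \<open>past 1\<close>.\<close>
  have lowAE: "left_low a s = {w\<in>space (past 1). \<exists>N0. \<forall>N. N0 \<le> N \<longrightarrow> w \<in> (\<Union>i\<le>N. D N i)}"
  proof (intro set_eqI iffI)
    fix w assume "w \<in> left_low a s"
    then show "w \<in> {w\<in>space (past 1). \<exists>N0. \<forall>N. N0 \<le> N \<longrightarrow> w \<in> (\<Union>i\<le>N. D N i)}"
      using conv[THEN conjunct2, of w] unfolding eventually_sequentially by (auto simp: left_low_def)
  next
    fix w assume *: "w \<in> {w\<in>space (past 1). \<exists>N0. \<forall>N. N0 \<le> N \<longrightarrow> w \<in> (\<Union>i\<le>N. D N i)}"
    then have "\<forall>\<^sub>F N in sequentially. w \<in> (\<Union>i\<le>N. D N i)" unfolding eventually_sequentially by blast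
    with conv[THEN conjunct2, of w] have "\<forall>\<^sub>F N in sequentially. w \<in> left_low a s"
      by eventually_elim blast
    then show "w \<in> left_low a s" by simp
  qed
  have [measurable]: "(\<Union>i\<le>N. D N i) \<in> sets (past 1)" for N
    using D by auto
  show past: "left_low a s \<in> sets (past 1)" unfolding lowAE
    by measurable
  have ev [measurable]: "left_low a s \<in> events" using past sets_past_events by auto
  have st [measurable]: "stays {0<..} s 1 \<in> events" using s by (intro stays_events) auto
  have lim: "(\<lambda>N. ?E (X N)) \<longlonglongrightarrow> ?E Y"
    if [measurable]: "\<And>N. X N \<in> events" "Y \<in> events" and ev: "\<And>w. \<forall>\<^sub>F N in sequentially. w \<in> X N \<longleftrightarrow> w \<in> Y" for X Y
  proof (rule integral_dominated_convergence[where w="\<lambda>_. 1"])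
    show "AE w in M. (\<lambda>N. indicator (X N) w * sin (c * W 1 w)) \<longlonglongrightarrow> indicator Y w * sin (c * W 1 w)"
    proof (rule AE_I2)
      fix w show "(\<lambda>N. indicator (X N) w * sin (c * W 1 w)) \<longlonglongrightarrow> indicator Y w * sin (c * W 1 w)"
        by (rule tendsto_eventually) (use ev[of w] in \<open>auto elim!: eventually_mono simp: indicator_def\<close>)
    qed
  qed (auto simp: indicator_def)
  have l1: "(\<lambda>N. ?E (\<Union>i\<le>N. C N i)) \<longlonglongrightarrow> ?E (stays {0<..} s 1)"
    by (rule lim) (use Cev conv st in auto)
  have l2: "(\<lambda>N. ?E (\<Union>i\<le>N. C N i)) \<longlonglongrightarrow> ?E (left_low a s)"
    unfolding eq by (rule lim) (use Dev conv ev in auto)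
  have "?E (left_low a s) = ?E (stays {0<..} s 1)"
    using l1 l2 by (rule LIMSEQ_unique[symmetric])
  also have "stays {0<..} s 1 = {w\<in>space M. W s w \<in> {0<..}} \<inter> stays {0<..} s 1"
    using s by (auto simp: stays_def)
  \<comment> \<open>On the half-line every \<open>c\<close> is admissible, since 0 is the only
    frontier point.\<close>
  also have "?E \<dots> =
      exp (- (c\<^sup>2 * (1 - s) / 2)) * (\<integral>w. indicator {w\<in>space M. W s w \<in> {0<..}} w * sin (c * W s w) \<partial>M)"
  proof (rule stays_integral_sin)
    show "{w\<in>space M. W s w \<in> {0<..}} \<in> sets (past s)"
      using measurable_sets_Collect[OF W_past[of s s], of "\<lambda>x. x \<in> {0<..}"] s by auto
  qed (use s in \<open>auto\<close>)
  also have "(\<integral>w. indicator {w\<in>space M. W s w \<in> {0<..}} w * sin (c * W s w) \<partial>M) = (\<integral>w. indicator {0<..} (W s w) * sin (c * W s w) \<partial>M)"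
    by (intro Bochner_Integration.integral_cong) (auto simp: indicator_def)
  finally show "?E (left_low a s) =
      exp (- (c\<^sup>2 * (1 - s) / 2)) * (\<integral>w. indicator {0<..} (W s w) * sin (c * W s w) \<partial>M)" .
qed

end

section \<open>The first zero after time 1\<close>

lemma tendsto_sin_ratio:
  fixes a x :: real
  assumes "0 < a"
  shows "(\<lambda>k. sin (x / (a * real (Suc k))) / sin (1 / real (Suc k))) \<longlonglongrightarrow> x / a"
proof -
  have sin0: "((\<lambda>h. sin (c * h) / h) \<longlongrightarrow> c) (at 0)" for c :: real
  proof -
    have "((\<lambda>h. sin (c * h)) has_field_derivative c) (at 0)"
      by (auto intro!: derivative_eq_intros)
    then show ?thesis by (simp add: has_field_derivative_iff)
  qed
  have "filterlim (\<lambda>k. 1 / real (Suc k)) (at 0) sequentially"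
    using LIMSEQ_Suc[OF lim_const_over_n[of "1::real"]] by (simp add: filterlim_at)
  note lim = filterlim_compose[OF sin0 this]
  have "(\<lambda>k. (sin (x / a * (1 / real (Suc k))) / (1 / real (Suc k))) / (sin (1 * (1 / real (Suc k))) / (1 / real (Suc k)))) \<longlonglongrightarrow> (x / a) / 1"
    by (rule tendsto_divide[OF lim lim]) simp
  then show ?thesis by (simp add: mult.commute)
qed

context standard_brownian_motion
begin

text \<open>Optional stopping for \<open>1 - W t / a\<close>, obtained from the bounded martingales
  \<open>F k\<close>, which vanish at level \<open>a\<close>. When the cap \<open>v\<close> is
  large, the stopped value is 1 for paths absorbed at 0 and 0 for paths absorbed at
  \<open>a\<close>, so the identity becomes the gambler's ruin formula.\<close>

lemma
  assumes A: "A \<in> sets (past u)" and AI: "\<And>w. w \<in> A \<Longrightarrow> W u w \<in> {0<..<a}" and uv: "0 \<le> u" "u \<le> v" and a: "0 < a"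
  defines "T \<equiv> \<lambda>w. exit_time {0<..<a} u v (\<lambda>t. W t w)"
  shows exit_position_range: "\<And>w. w \<in> A \<Longrightarrow> W (T w) w \<in> {0..a}"
    and exit_position_measurable: "(\<lambda>w. indicator A w * (1 - W (T w) w / a)) \<in> borel_measurable M"
    and exit_position_integral: "(\<integral>w. indicator A w * (1 - W (T w) w / a) \<partial>M) = (\<integral>w. indicator A w * (1 - W u w / a) \<partial>M)"
proof -
  have AM: "A \<subseteq> space M" using A sets_past_events sets.sets_into_space by blast
  have [measurable]: "A \<in> events" using A sets_past_events by auto
  have ex: "u \<le> T w" "T w \<le> v" "W (T w) w \<in> {0..a}" if "w \<in> A" for w
  proof -
    have wM: "w \<in> space M" using that AM by auto
    note ex = uv(2) continuous_on_W[OF wM uv(1)] open_greaterThanLessThan[of 0 a]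
    show 1: "u \<le> T w" "T w \<le> v" using exit_time_mem[OF ex] by (auto simp: T_def)
    have "W (T w) w \<in> frontier {0<..<a}" if "T w < v \<or> W v w \<notin> {0<..<a}"
      using exit_time_frontier[OF ex AI[OF \<open>w \<in> A\<close>]] that by (simp add: T_def)
    moreover have "W (T w) w \<in> {0<..<a}" if "\<not> (T w < v \<or> W v w \<notin> {0<..<a})"
      using that 1 by (cases "T w = v") auto
    ultimately show "W (T w) w \<in> {0..a}"
      using a by (cases "T w < v \<or> W v w \<notin> {0<..<a}") (auto simp: frontier_def)
  qed
  show "\<And>w. w \<in> A \<Longrightarrow> W (T w) w \<in> {0..a}" by (rule ex(3))
  \<comment> \<open>With this frequency the sine has an argument between 0 and 1 < pi / 2 on
    \<open>[0, a]\<close>, where it increases. The quotient in \<open>F k\<close> therefore lies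
    between 0 and 1, which yields a bound uniform in \<open>k\<close>.\<close>
  define \<theta> where "\<theta> k = 1 / (a * real (Suc k))" for k
  define F where "F k r y = trig (- \<theta> k) (\<theta> k * a) r y / sin (\<theta> k * a)" for k r y
  have F: "F k r y = exp ((\<theta> k)\<^sup>2 * r / 2) * (sin ((a - y) / (a * real (Suc k))) / sin (1 / real (Suc k)))" for k r y
  proof -
    have "- \<theta> k * y + \<theta> k * a = (a - y) / (a * real (Suc k))" by (simp add: \<theta>_def diff_divide_distrib)
    moreover have "\<theta> k * a = 1 / real (Suc k)" using a by (simp add: \<theta>_def)
    ultimately show ?thesis unfolding F_def trig_def by (simp only: power2_minus times_divide_eq_right)
  qed
  have lim: "(\<lambda>k. F k r y) \<longlonglongrightarrow> 1 - y / a" for r y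
  proof -
    have "\<theta> \<longlonglongrightarrow> 0"
      using LIMSEQ_Suc[OF lim_const_over_n[of "1 / a"]] by (simp add: \<theta>_def[abs_def])
    then have "(\<lambda>k. exp ((\<theta> k)\<^sup>2 * r / 2)) \<longlonglongrightarrow> exp (0\<^sup>2 * r / 2)"
      by (intro tendsto_intros) auto
    from tendsto_mult[OF this tendsto_sin_ratio[OF a, of "a - y"]]
    show ?thesis unfolding F using a by (simp add: diff_divide_distrib)
  qed
  have bound: "\<bar>F k r y\<bar> \<le> exp ((1 / a)\<^sup>2 * v / 2)" if "r \<in> {u..v}" "y \<in> {0..a}" for k r y
  proof -
    define x where "x = (a - y) / (a * real (Suc k))"
    have x: "0 \<le> x" "x \<le> 1 / real (Suc k)"
      using that a by (auto simp: x_def divide_simps simp del: of_nat_Suc)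
    have k1: "1 / real (Suc k) \<le> 1" by simp
    have "1 \<le> pi / 2" using pi_ge_two by simp
    then have "sin x \<le> sin (1 / real (Suc k))"
      using x k1 by (intro sin_monotone_2pi_le) linarith+
    moreover have "0 \<le> sin x" using x k1 pi_ge_two by (intro sin_ge_zero) linarith+
    moreover have "0 < sin (1 / real (Suc k))" using k1 pi_ge_two by (intro sin_gt_zero) (simp, linarith)
    ultimately have "0 \<le> sin x / sin (1 / real (Suc k))" "sin x / sin (1 / real (Suc k)) \<le> 1" by auto
    moreover have "exp ((\<theta> k)\<^sup>2 * r / 2) \<le> exp ((1 / a)\<^sup>2 * v / 2)"
    proof -
      have "\<theta> k \<le> 1 / a" "0 \<le> \<theta> k" using a by (auto simp: \<theta>_def divide_simps)
      then have "(\<theta> k)\<^sup>2 * r \<le> (1 / a)\<^sup>2 * v" using that uv by (intro mult_mono power_mono) auto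
      then show ?thesis by simp
    qed
    ultimately have "exp ((\<theta> k)\<^sup>2 * r / 2) * (sin x / sin (1 / real (Suc k))) \<le> exp ((1 / a)\<^sup>2 * v / 2) * 1"
      by (intro mult_mono) auto
    then show ?thesis unfolding F x_def[symmetric] using \<open>0 \<le> sin x / sin (1 / real (Suc k))\<close> by (subst abs_of_nonneg, intro mult_nonneg_nonneg) auto
  qed
  have meas: "(\<lambda>w. indicator A w * F k (T w) (W (T w) w)) \<in> borel_measurable M" for k
    using borel_measurable_divide[OF optional_stopping_measurable[OF A AI open_greaterThanLessThan uv, of "- \<theta> k" "\<theta> k * a"], of "\<lambda>_. sin (\<theta> k * a)"]
    by (simp add: F_def T_def)
  show m: "(\<lambda>w. indicator A w * (1 - W (T w) w / a)) \<in> borel_measurable M"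
  proof (rule borel_measurable_LIMSEQ_real)
    show "(\<lambda>k. indicator A w * F k (T w) (W (T w) w)) \<longlonglongrightarrow> indicator A w * (1 - W (T w) w / a)" for w
      by (intro tendsto_intros lim)
  qed (rule meas)
  have [measurable]: "W u \<in> borel_measurable M" using uv by simp
  have meas2: "(\<lambda>w. indicator A w * F k u (W u w)) \<in> borel_measurable M" for k
    unfolding F_def by measurable
  have EF: "(\<integral>w. indicator A w * F k (T w) (W (T w) w) \<partial>M) = (\<integral>w. indicator A w * F k u (W u w) \<partial>M)" for k
    using optional_stopping[OF A AI open_greaterThanLessThan uv, of "- \<theta> k" "\<theta> k * a"]
    by (simp add: F_def T_def)
  have "(\<lambda>k. \<integral>w. indicator A w * F k (T w) (W (T w) w) \<partial>M) \<longlonglongrightarrow> (\<integral>w. indicator A w * (1 - W (T w) w / a) \<partial>M)"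
    by (rule integral_dominated_convergence[where w="\<lambda>_. exp ((1 / a)\<^sup>2 * v / 2)"])
      (use m meas lim bound ex in \<open>auto simp: indicator_def\<close>)
  moreover have "(\<lambda>k. \<integral>w. indicator A w * F k u (W u w) \<partial>M) \<longlonglongrightarrow> (\<integral>w. indicator A w * (1 - W u w / a) \<partial>M)"
  proof (rule integral_dominated_convergence[where w="\<lambda>_. exp ((1 / a)\<^sup>2 * v / 2)"])
    show "(\<lambda>w. indicator A w * (1 - W u w / a)) \<in> borel_measurable M" by measurable
    show "AE w in M. (\<lambda>k. indicator A w * F k u (W u w)) \<longlonglongrightarrow> indicator A w * (1 - W u w / a)"
      by (intro AE_I2 tendsto_intros lim)
    show "AE w in M. norm (indicator A w * F k u (W u w)) \<le> exp ((1 / a)\<^sup>2 * v / 2)" for k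
    proof (rule AE_I2)
      fix w show "norm (indicator A w * F k u (W u w)) \<le> exp ((1 / a)\<^sup>2 * v / 2)"
        using bound[of u "W u w" k] AI[of w] uv by (cases "w \<in> A") simp_all
    qed
  qed (use meas2 in auto)
  ultimately show "(\<integral>w. indicator A w * (1 - W (T w) w / a) \<partial>M) = (\<integral>w. indicator A w * (1 - W u w / a) \<partial>M)"
    unfolding EF by (rule LIMSEQ_unique)
qed

text \<open>Rounding the random time down to a grid leaves countably many values, and continuity of
  the paths gives the limit.\<close>

lemma W_random_time [measurable (raw)]:
  assumes [measurable]: "r \<in> borel_measurable M" and r: "\<And>w. w \<in> space M \<Longrightarrow> 0 \<le> r w"
  shows "(\<lambda>w. W (r w) w) \<in> borel_measurable M"
proof (rule borel_measurable_LIMSEQ_real)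
  define q where "q n w = nat \<lfloor>r w * real (Suc n)\<rfloor>" for n w
  show "(\<lambda>n. W (real (q n w) / real (Suc n)) w) \<longlonglongrightarrow> W (r w) w" if "w \<in> space M" for w
    using tendsto_grid[OF r[OF that]] r[OF that] unfolding q_def
    by (intro continuous_on_tendsto_compose[OF continuous_paths[OF that]]) auto
  have [measurable]: "q n \<in> measurable M (count_space UNIV)" for n unfolding q_def by measurable
  show "(\<lambda>w. W (real (q n w) / real (Suc n)) w) \<in> borel_measurable M" for n
    by (rule measurable_compose_countable[where f="\<lambda>i w. W (real i / real (Suc n)) w"]) auto
qed

section \<open>Measurability of the excursion interval around time 1 and of its height\<close>

definition returns :: "'a set" where
  "returns = {w\<in>space M. \<exists>s\<ge>1. W s w = 0}"

lemma returns_events [measurable]: "returns \<in> events"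
proof -
  have "returns = (\<Union>n::nat. {w\<in>space M. \<exists>r\<in>{1..1 + real n}. W r w \<in> {0}})"
  proof safe
    fix w assume "w \<in> returns"
    then obtain s where s: "1 \<le> s" "W s w = 0" "w \<in> space M" by (auto simp: returns_def)
    obtain n :: nat where "s - 1 \<le> real n" using real_arch_simple by blast
    then show "w \<in> (\<Union>n::nat. {w\<in>space M. \<exists>r\<in>{1..1 + real n}. W r w \<in> {0}})"
      using s by (auto intro!: exI[of _ n] bexI[of _ s])
  qed (auto simp: returns_def)
  also have "\<dots> \<in> events"
  proof -
    have "{w\<in>space M. \<exists>r\<in>{1..1 + real n}. W r w \<in> {0}} \<in> events" for n
      using hits_past[of "{0}" 1 "1 + real n"] sets_past_events[of "1 + real n"] by auto
    then show ?thesis by blast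
  qed
  finally show ?thesis .
qed

text \<open>The default 1 keeps the excursion interval well formed and the function measurable when
  there is no zero from time 1 on.\<close>

definition right_zero :: "'a \<Rightarrow> real" where
  "right_zero w = (if w \<in> returns then next_zero (\<lambda>t. W t w) else 1)"

lemma left_zero_measurable [measurable]: "left_zero \<in> borel_measurable M"
proof (rule borel_measurableI_less)
  fix s :: real
  consider "s \<le> 0" | "0 < s" "s \<le> 1" | "1 < s" by linarith
  then show "{w \<in> space M. left_zero w < s} \<in> events"
  proof cases
    case 1
    then have E: "{w \<in> space M. left_zero w < s} = {}"
      using last_zero_mem[OF continuous_on_W_Icc01 start_zero] by fastforce
    show ?thesis unfolding E by simp
  next
    case 2
    have "left_zero w < s \<longleftrightarrow> w \<in> stays (- {0}) s 1" if "w \<in> space M" for w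
      using last_zero_less_iff[OF continuous_on_W_Icc01 start_zero, OF that that, of s] 2 that by (simp add: stays_def)
    then have "{w \<in> space M. left_zero w < s} = stays (- {0}) s 1" by (auto simp: stays_def)
    then show ?thesis using stays_events[of "- {0}" s 1] 2 open_Compl[of "{0::real}"] by auto
  next
    case 3
    then have E: "{w \<in> space M. left_zero w < s} = space M"
      using last_zero_mem[OF continuous_on_W_Icc01 start_zero] by fastforce
    show ?thesis unfolding E by simp
  qed
qed

lemma left_zero_range: "w \<in> space M \<Longrightarrow> 0 \<le> left_zero w \<and> left_zero w \<le> 1"
  using last_zero_mem[OF continuous_on_W_Icc01 start_zero] by auto

lemma right_zero_ge: "1 \<le> right_zero w"
  using next_zero_ge[OF continuous_on_W_ge1, of w] by (auto simp: right_zero_def returns_def)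

lemma right_zero_measurable [measurable]: "right_zero \<in> borel_measurable M"
proof (rule borel_measurableI_greater)
  fix t :: real
  show "{w \<in> space M. t < right_zero w} \<in> events"
  proof (cases "t < 1")
    case True
    then have E: "{w \<in> space M. t < right_zero w} = space M" using right_zero_ge by (auto intro: less_le_trans)
    show ?thesis unfolding E by simp
  next
    case False
    then have "t < right_zero w \<longleftrightarrow> w \<in> returns \<and> w \<in> stays (- {0}) 1 t" if "w \<in> space M" for w
      using next_zero_greater_iff[OF continuous_on_W_ge1[OF that], of t] that
      by (auto simp: right_zero_def returns_def stays_def)
    then have "{w \<in> space M. t < right_zero w} = returns \<inter> stays (- {0}) 1 t" by (auto simp: returns_def)
    then show ?thesis using stays_events[of "- {0}" 1 t] False open_Compl[of "{0::real}"] by auto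
  qed
qed

text \<open>The parametrisation by \<open>[0, 1]\<close> is that of
  \<open>brownian_excursion\<close>, so on \<open>returns\<close> this is \<open>path_max\<close> of
  the excursion before normalization.\<close>

definition height :: "'a \<Rightarrow> real" where
  "height w = (SUP u\<in>{0..1}. \<bar>W (left_zero w + u * (right_zero w - left_zero w)) w\<bar>)"

lemma excursion_continuous:
  assumes "w \<in> space M"
  shows "continuous_on {0..1} (\<lambda>u. \<bar>W (left_zero w + u * (right_zero w - left_zero w)) w\<bar>)"
proof -
  have "continuous_on {0..1} (\<lambda>u. W (left_zero w + u * (right_zero w - left_zero w)) w)"
    using left_zero_range[OF assms] right_zero_ge[of w]
    by (intro continuous_on_compose2[OF continuous_paths[OF assms]] continuous_intros) auto
  then show ?thesis by (intro continuous_intros)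
qed

lemma height_attained:
  assumes "w \<in> space M"
  obtains u where "u \<in> {0..1}" "height w = \<bar>W (left_zero w + u * (right_zero w - left_zero w)) w\<bar>"
    "\<And>x. x \<in> {0..1} \<Longrightarrow> \<bar>W (left_zero w + x * (right_zero w - left_zero w)) w\<bar> \<le> height w"
proof -
  obtain u where u: "u \<in> {0..1}" "\<And>x. x \<in> {0..1} \<Longrightarrow> \<bar>W (left_zero w + x * (right_zero w - left_zero w)) w\<bar> \<le> \<bar>W (left_zero w + u * (right_zero w - left_zero w)) w\<bar>"
    using continuous_attains_sup[OF _ _ excursion_continuous[OF assms]] by auto
  then have "height w = \<bar>W (left_zero w + u * (right_zero w - left_zero w)) w\<bar>"
    unfolding height_def by (intro cSup_eq_maximum) auto
  then show thesis using that[of u] u by auto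
qed

text \<open>The supremum is attained, so a strict bound on it amounts to a strict bound at every
  time of the interval.\<close>

lemma height_less_iff:
  assumes "w \<in> space M"
  shows "height w < a \<longleftrightarrow> (\<forall>r\<in>{left_zero w..right_zero w}. \<bar>W r w\<bar> < a)"
proof -
  obtain u where u: "u \<in> {0..1}" "height w = \<bar>W (left_zero w + u * (right_zero w - left_zero w)) w\<bar>"
    "\<And>x. x \<in> {0..1} \<Longrightarrow> \<bar>W (left_zero w + x * (right_zero w - left_zero w)) w\<bar> \<le> height w"
    using height_attained[OF assms] by blast
  define g d where "g = left_zero w" and "d = right_zero w"
  have gd: "g \<le> d" using left_zero_range[OF assms] right_zero_ge[of w] by (simp add: g_def d_def)
  show ?thesis
  proof
    assume h: "height w < a"
    show "\<forall>r\<in>{left_zero w..right_zero w}. \<bar>W r w\<bar> < a"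
    proof
      fix r assume r: "r \<in> {left_zero w..right_zero w}"
      define x where "x = (if g < d then (r - g) / (d - g) else 0)"
      have "x \<in> {0..1}" "g + x * (d - g) = r" using r gd by (auto simp: x_def g_def d_def divide_simps)
      with u(3)[of x] h show "\<bar>W r w\<bar> < a" by (simp add: g_def d_def)
    qed
  next
    assume *: "\<forall>r\<in>{left_zero w..right_zero w}. \<bar>W r w\<bar> < a"
    have "u * (d - g) \<le> 1 * (d - g)" using u(1) gd by (intro mult_right_mono) auto
    then have "g + u * (d - g) \<in> {g..d}" using u(1) gd by auto
    then show "height w < a" unfolding u(2) using * by (simp add: g_def d_def)
  qed
qed

lemma height_measurable [measurable]: "height \<in> borel_measurable M"
proof (rule borel_measurableI_le)
  fix a :: real
  let ?f = "\<lambda>u w. \<bar>W (left_zero w + u * (right_zero w - left_zero w)) w\<bar>"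
  have "height w \<le> a \<longleftrightarrow> (\<forall>n. \<forall>k\<in>{..Suc n}. ?f (real k / real (Suc n)) w \<le> a)" if w: "w \<in> space M" for w
  proof -
    obtain u where u: "u \<in> {0..1}" "height w = ?f u w" "\<And>x. x \<in> {0..1} \<Longrightarrow> ?f x w \<le> height w"
      using height_attained[OF w] by blast
    show ?thesis
    proof safe
      fix n k assume "height w \<le> a" "k \<le> Suc n"
      then show "?f (real k / real (Suc n)) w \<le> a" using u(3)[of "real k / real (Suc n)"] by (simp add: divide_simps)
    next
      assume *: "\<forall>n. \<forall>k\<in>{..Suc n}. ?f (real k / real (Suc n)) w \<le> a"
      define k where "k n = nat \<lfloor>u * real (Suc n)\<rfloor>" for n
      have k: "k n \<le> Suc n" for n unfolding k_def using u(1) by (intro grid_index_le) auto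
      have "(\<lambda>n. real (k n) / real (Suc n)) \<longlonglongrightarrow> u" unfolding k_def using u(1) by (intro tendsto_grid) auto
      then have "(\<lambda>n. ?f (real (k n) / real (Suc n)) w) \<longlonglongrightarrow> ?f u w"
        by (rule continuous_on_tendsto_compose[OF excursion_continuous[OF w] _ u(1)]) (use k in \<open>auto simp: divide_simps simp del: of_nat_Suc\<close>)
      then show "height w \<le> a" unfolding u(2)
        by (rule LIMSEQ_le_const2) (use * k in auto)
    qed
  qed
  then have "{w\<in>space M. height w \<le> a} = {w\<in>space M. \<forall>n. \<forall>k\<in>{..Suc n}. ?f (real k / real (Suc n)) w \<le> a}" by auto
  also have "\<dots> \<in> events"
  proof -
    have "(\<lambda>w. W (left_zero w + x * (right_zero w - left_zero w)) w) \<in> borel_measurable M" if "0 \<le> x" for x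
    proof (rule W_random_time)
      fix w assume "w \<in> space M"
      then have "0 \<le> left_zero w" "0 \<le> right_zero w - left_zero w"
        using left_zero_range[of w] right_zero_ge[of w] by auto
      then show "0 \<le> left_zero w + x * (right_zero w - left_zero w)"
        using that by (intro add_nonneg_nonneg mult_nonneg_nonneg)
    qed measurable
    from this[of "real k / real (Suc n)" for k n] have "(\<lambda>w. ?f (real k / real (Suc n)) w) \<in> borel_measurable M" for k n
      by (intro borel_measurable_abs) simp
    then show ?thesis
      by (intro sets.sets_Collect_countable_All sets.sets_Collect_finite_All borel_measurable_le borel_measurable_const finite_atMost)
  qed
  finally show "{w \<in> space M. height w \<le> a} \<in> events" .
qed

end

section \<open>Joint tail of the zeros and the height\<close>

text \<open>Abel means of the series of sin (n \<theta>) / n, whose sum is (pi - \<theta>) / 2, read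
  off from the logarithm of 1 - r exp (i \<theta>). That number has positive real part, which bounds
  its argument by pi / 2 uniformly in \<open>r\<close>. With \<theta> = pi x / a and the factor 2 /
  pi, the limit is 1 - x / a.\<close>

lemma
  assumes \<theta>: "0 < \<theta>" "\<theta> < pi"
  shows sine_series_sums: "\<And>r. 0 \<le> r \<Longrightarrow> r < 1 \<Longrightarrow>
      (\<lambda>n. r ^ Suc n * sin (real (Suc n) * \<theta>) / real (Suc n)) sums (- Im (Ln (1 - complex_of_real r * cis \<theta>)))"
    and sine_series_bound: "\<And>r. 0 \<le> r \<Longrightarrow> r < 1 \<Longrightarrow> \<bar>Im (Ln (1 - complex_of_real r * cis \<theta>))\<bar> \<le> pi / 2"
    and sine_series_tendsto: "\<And>r F. (r \<longlongrightarrow> 1) F \<Longrightarrow>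
      ((\<lambda>k. - Im (Ln (1 - complex_of_real (r k) * cis \<theta>))) \<longlongrightarrow> (pi - \<theta>) / 2) F"
proof -
  show "(\<lambda>n. r ^ Suc n * sin (real (Suc n) * \<theta>) / real (Suc n)) sums (- Im (Ln (1 - complex_of_real r * cis \<theta>)))"
    if r: "0 \<le> r" "r < 1" for r
  proof -
    have "cmod (- (complex_of_real r * cis \<theta>)) < 1" using r by (simp add: norm_mult)
    from Ln_series'[OF this]
    have "(\<lambda>n. - ((complex_of_real r * cis \<theta>) ^ n) / of_nat n) sums Ln (1 - complex_of_real r * cis \<theta>)"
      by simp
    then have "(\<lambda>n. Im (- ((complex_of_real r * cis \<theta>) ^ n) / of_nat n)) sums Im (Ln (1 - complex_of_real r * cis \<theta>))"
      by (rule sums_Im)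
    moreover have "Im (- ((complex_of_real r * cis \<theta>) ^ n) / of_nat n) = - (r ^ n * sin (real n * \<theta>) / real n)" for n
      by (simp add: power_mult_distrib Complex.DeMoivre Im_divide_of_nat flip: of_real_power)
    ultimately have "(\<lambda>n. - (r ^ n * sin (real n * \<theta>) / real n)) sums Im (Ln (1 - complex_of_real r * cis \<theta>))"
      by (simp only:)
    from sums_minus[OF this] have "(\<lambda>n. r ^ n * sin (real n * \<theta>) / real n) sums (- Im (Ln (1 - complex_of_real r * cis \<theta>)))"
      by simp
    then show ?thesis by (subst sums_Suc_iff) simp
  qed
  show "\<bar>Im (Ln (1 - complex_of_real r * cis \<theta>))\<bar> \<le> pi / 2" if r: "0 \<le> r" "r < 1" for r
  proof -
    have "r * cos \<theta> \<le> r * 1" using r by (intro mult_left_mono) auto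
    then have re: "0 < Re (1 - complex_of_real r * cis \<theta>)" using r by simp
    then have "1 - complex_of_real r * cis \<theta> \<noteq> 0" by (metis less_irrefl zero_complex.sel(1))
    from Re_Ln_pos_lt[OF this, THEN iffD2, OF re] show ?thesis by (rule less_imp_le)
  qed
  show "((\<lambda>k. - Im (Ln (1 - complex_of_real (r k) * cis \<theta>))) \<longlongrightarrow> (pi - \<theta>) / 2) F" if r: "(r \<longlongrightarrow> 1) F" for r F
  proof -
    have s: "0 < sin (\<theta> / 2)" using \<theta> by (intro sin_gt_zero) auto
    \<comment> \<open>Polar form: \<open>1 - cis \<theta>\<close> has modulus 2 sin (\<theta> / 2)
      and argument (\<theta> - pi) / 2, which lies in the principal range.\<close>
    have "exp (Complex (ln (2 * sin (\<theta> / 2))) ((\<theta> - pi) / 2)) = 1 - cis \<theta>"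
    proof (rule complex_eqI)
      have c: "cos ((\<theta> - pi) / 2) = sin (\<theta> / 2)" "sin ((\<theta> - pi) / 2) = - cos (\<theta> / 2)"
        by (simp_all add: diff_divide_distrib cos_diff sin_diff)
      have "cos \<theta> = 1 - 2 * sin (\<theta> / 2) * sin (\<theta> / 2)" "sin \<theta> = 2 * sin (\<theta> / 2) * cos (\<theta> / 2)"
        using cos_double_sin[of "\<theta> / 2"] sin_double[of "\<theta> / 2"] by (simp_all add: power2_eq_square)
      then show "Re (exp (Complex (ln (2 * sin (\<theta> / 2))) ((\<theta> - pi) / 2))) = Re (1 - cis \<theta>)"
        "Im (exp (Complex (ln (2 * sin (\<theta> / 2))) ((\<theta> - pi) / 2))) = Im (1 - cis \<theta>)"
        using s by (simp_all add: Re_exp Im_exp c)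
    qed
    then have L: "Ln (1 - cis \<theta>) = Complex (ln (2 * sin (\<theta> / 2))) ((\<theta> - pi) / 2)"
      by (rule Ln_unique) (use \<theta> in auto)
    have "cos \<theta> < 1" using \<theta> cos_monotone_0_pi[of 0 \<theta>] by simp
    then have nn: "1 - cis \<theta> \<notin> \<real>\<^sub>\<le>\<^sub>0" by (auto simp: complex_nonpos_Reals_iff)
    have "((\<lambda>k. 1 - complex_of_real (r k) * cis \<theta>) \<longlongrightarrow> 1 - complex_of_real 1 * cis \<theta>) F"
      by (intro tendsto_intros r)
    then have "((\<lambda>k. 1 - complex_of_real (r k) * cis \<theta>) \<longlongrightarrow> 1 - cis \<theta>) F" by simp
    from tendsto_minus[OF tendsto_Im[OF tendsto_Ln[OF this nn]]]
    have "((\<lambda>k. - Im (Ln (1 - complex_of_real (r k) * cis \<theta>))) \<longlongrightarrow> - Im (Ln (1 - cis \<theta>))) F" .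
    then show ?thesis by (simp add: L diff_divide_distrib)
  qed
qed

context standard_brownian_motion
begin

section \<open>Return to zero before reaching the barrier\<close>

lemma prob_W_interval_le:
  assumes "0 < v" "0 < a"
  shows "prob {w\<in>space M. W v w \<in> {0<..<a}} \<le> a / sqrt (2 * pi * v)"
proof -
  have "emeasure M (W v -` {0<..<a} \<inter> space M) = (\<integral>\<^sup>+x. ennreal (normal_density 0 (sqrt v) x) * indicator {0<..<a} x \<partial>lborel)"
    by (rule distributed_emeasure[OF distributed_W[OF assms(1)]]) simp
  also have "\<dots> \<le> (\<integral>\<^sup>+x. ennreal (1 / sqrt (2 * pi * v)) * indicator {0<..<a} x \<partial>lborel)"
    using assms by (intro nn_integral_mono mult_right_mono ennreal_leI)
      (auto simp: normal_density_def divide_simps)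
  also have "\<dots> = ennreal (a / sqrt (2 * pi * v))"
    using assms by (subst nn_integral_cmult) (auto simp: ennreal_mult'[symmetric])
  finally have "emeasure M (W v -` {0<..<a} \<inter> space M) \<le> ennreal (a / sqrt (2 * pi * v))" .
  moreover have "W v -` {0<..<a} \<inter> space M = {w\<in>space M. W v w \<in> {0<..<a}}" by auto
  ultimately show ?thesis
    using assms by (simp add: emeasure_eq_measure)
qed

text \<open>The normal density of \<open>W v\<close> is at most 1 / sqrt (2 pi v), so the
  probability of lying in a fixed bounded interval tends to 0 along the times
  \<open>t + k\<close>.\<close>

lemma AE_leaves_interval:
  assumes "0 < a" "0 \<le> t"
  shows "AE w in M. \<exists>r\<ge>t. W r w \<notin> {0<..<a}"
proof -
  define S where "S = {w\<in>space M. \<forall>k::nat. W (t + real k) w \<in> {0<..<a}}"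
  have S [measurable]: "S \<in> events" unfolding S_def
    using assms by (intro sets.sets_Collect_countable_All measurable_sets_Collect[OF random_variable_W]) auto
  \<comment> \<open>\<open>Suc k\<close> keeps the sampling time positive even for
    \<open>t = 0\<close>.\<close>
  have "prob S \<le> a / sqrt (2 * pi * (t + real (Suc k)))" for k
  proof -
    have "prob S \<le> prob {w\<in>space M. W (t + real (Suc k)) w \<in> {0<..<a}}"
      unfolding S_def using assms by (intro finite_measure_mono measurable_sets_Collect[OF random_variable_W]) (auto simp del: of_nat_Suc)
    also have "\<dots> \<le> a / sqrt (2 * pi * (t + real (Suc k)))" using assms by (intro prob_W_interval_le) auto
    finally show ?thesis .
  qed
  moreover have "(\<lambda>k. a / sqrt (2 * pi * (t + real (Suc k)))) \<longlonglongrightarrow> 0"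
    by (rule real_tendsto_divide_at_top[OF tendsto_const], rule filterlim_compose[OF sqrt_at_top],
        rule filterlim_tendsto_pos_mult_at_top[OF tendsto_const _ filterlim_tendsto_add_at_top[OF tendsto_const
        filterlim_compose[OF filterlim_real_sequentially filterlim_Suc]]]) auto
  ultimately have "prob S \<le> 0" by (intro LIMSEQ_le_const) auto
  then have "prob S = 0" by (simp add: antisym)
  then have "emeasure M S = 0" by (simp add: emeasure_eq_measure)
  then show ?thesis
    by (rule AE_I[rotated 1]) (use assms in \<open>auto simp: S_def\<close>)
qed

definition joint :: "real \<Rightarrow> real \<Rightarrow> real \<Rightarrow> 'a set" where
  "joint a s t = {w\<in>returns. 0 < W 1 w \<and> left_zero w < s \<and> t < right_zero w \<and> height w < a}"

lemma joint_events [measurable]: "joint a s t \<in> events"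
proof -
  have [measurable]: "W 1 \<in> borel_measurable M" by simp
  have "joint a s t = returns \<inter> {w\<in>space M. 0 < W 1 w \<and> left_zero w < s \<and> t < right_zero w \<and> height w < a}"
    by (auto simp: joint_def returns_def)
  also have "\<dots> \<in> events" by measurable
  finally show ?thesis .
qed

text \<open>After time \<open>t\<close> the path still has to hit 0 before \<open>a\<close>, which
  has conditional probability \<open>1 - W t / a\<close>. Instead of conditioning, the exit is
  capped at \<open>t + k\<close>: the integral of \<open>Y k\<close> does not depend on
  \<open>k\<close>, and almost surely \<open>Y k\<close> is eventually the indicator of
  \<open>joint a s t\<close>.\<close>

lemma prob_joint_eq_integral:
  assumes a: "0 < a" and s: "0 < s" "s \<le> 1" and t: "1 \<le> t"
  shows "prob (joint a s t) = (\<integral>w. indicator (left_low a s \<inter> stays {0<..<a} 1 t) w * (1 - W t w / a) \<partial>M)"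
proof -
  define A where "A = left_low a s \<inter> stays {0<..<a} 1 t"
  have "sin (pi / a * a) = 0" using a by simp
  from left_low_past[OF a s this] have A: "A \<in> sets (past t)"
    using stays_past[of "{0<..<a}" 1 t] sets_past_mono[OF t] t by (auto simp: A_def)
  then have [measurable]: "A \<in> events" using sets_past_events by auto
  have AI: "W t w \<in> {0<..<a}" if "w \<in> A" for w using that t by (auto simp: A_def stays_def)
  define T where "T k w = exit_time {0<..<a} t (t + real k) (\<lambda>t. W t w)" for k :: nat and w
  define Y where "Y k w = indicator A w * (1 - W (T k w) w / a)" for k w
  have Ym: "Y k \<in> borel_measurable M" for k
    using exit_position_measurable[OF A AI _ _ a, of "t + real k"] t by (simp add: Y_def[abs_def] T_def)
  have EY: "(\<integral>w. Y k w \<partial>M) = (\<integral>w. indicator A w * (1 - W t w / a) \<partial>M)" for k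
    using exit_position_integral[OF A AI _ _ a, of "t + real k"] t by (simp add: Y_def[abs_def] T_def)
  have Yb: "\<bar>Y k w\<bar> \<le> 1" for k w
    using exit_position_range[OF A AI _ _ a, of "t + real k" w] t a
    by (auto simp: Y_def T_def indicator_def abs_le_iff divide_simps)
  have lim: "(\<lambda>k. Y k w) \<longlonglongrightarrow> indicator (joint a s t) w" if leave: "\<exists>r\<ge>t. W r w \<notin> {0<..<a}" and wM: "w \<in> space M" for w
  proof -
    note lz = continuous_on_W_Icc01[OF wM] start_zero[OF wM]
    have rz: "right_zero w = next_zero (\<lambda>t. W t w)" "\<exists>s\<ge>1. W s w = 0" if "w \<in> returns"
      using that by (auto simp: right_zero_def returns_def)
    note nzc = continuous_on_W_ge1[OF wM]
    show ?thesis
    proof (cases "w \<in> A")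
      case False
      have "w \<notin> joint a s t"
      proof
        assume J: "w \<in> joint a s t"
        then have ret: "w \<in> returns" and h: "\<And>r. r \<in> {left_zero w..right_zero w} \<Longrightarrow> \<bar>W r w\<bar> < a" and l: "0 < W 1 w" "left_zero w < s" "t < right_zero w"
          using height_less_iff[OF wM, of a] by (auto simp: joint_def)
        have "w \<in> left_low a s" using h l wM t unfolding left_low_def by (auto dest!: h simp: abs_less_iff)
        moreover have "w \<in> stays {0<..<a} 1 t"
          using next_zero_positive[OF nzc rz(2)[OF ret] l(1)] l s h wM rz(1)[OF ret] unfolding stays_def
          by (force simp: abs_less_iff)
        ultimately show False using False by (simp add: A_def)
      qed
      then show ?thesis using False by (simp add: Y_def)
    next
      case True
      then have low: "w \<in> left_low a s" and st: "\<And>r. 1 \<le> r \<Longrightarrow> r \<le> t \<Longrightarrow> W r w \<in> {0<..<a}"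
        by (auto simp: A_def stays_def)
      have W1: "0 < W 1 w" "left_zero w < s" using low by (auto simp: left_low_def)
      obtain r0 where r0: "t \<le> r0" "W r0 w \<notin> {0<..<a}" using leave by blast
      \<comment> \<open>Once the cap is not before \<open>r0\<close>, the path stands at 0 or at
        \<open>a\<close> at its exit. In the first case the excursion ends with its height below
        \<open>a\<close>; in the second it reaches \<open>a\<close> before its end.\<close>
      have "Y k w = indicator (joint a s t) w" if k: "r0 - t \<le> real k" for k
      proof -
        have "t \<le> t + real k" "0 \<le> t" using t by auto
        note ex = this(1) continuous_on_W[OF wM this(2)] open_greaterThanLessThan[of 0 a]
        have Tr0: "T k w \<le> r0"
          using exit_time_inside[OF ex r0(1)] r0(2) unfolding T_def by (metis not_le)
        have Tm: "t \<le> T k w" "T k w \<le> t + real k" using exit_time_mem[OF ex] by (auto simp: T_def)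
        have "T k w < t + real k \<or> W (t + real k) w \<notin> {0<..<a}"
          using Tr0 k r0(2) Tm by (cases "r0 = t + real k") auto
        then have "W (T k w) w \<in> frontier {0<..<a}"
          using exit_time_frontier[OF ex AI[OF True]] by (simp add: T_def)
        then have W01: "W (T k w) w = 0 \<or> W (T k w) w = a" using a by (auto simp: frontier_def)
        have ins: "W r w \<in> {0<..<a}" if "1 \<le> r" "r < T k w" for r
          using st[of r] exit_time_inside[OF ex, of r] that unfolding T_def by (cases "r \<le> t") auto
        show ?thesis
        proof (cases "W (T k w) w = 0")
          case W0: True
          have ret: "w \<in> returns" using W0 Tm t wM by (auto simp: returns_def intro!: exI[of _ "T k w"])
          have le: "right_zero w \<le> T k w"
            using next_zero_before[OF nzc rz(2)[OF ret], of "T k w"] W0 Tm t unfolding rz(1)[OF ret] by force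
          have "t < right_zero w"
            unfolding rz(1)[OF ret] next_zero_greater_iff[OF nzc rz(2)[OF ret] t] using st by force
          moreover have "\<bar>W r w\<bar> < a" if r: "r \<in> {left_zero w..right_zero w}" for r
          proof (cases "r \<le> 1")
            case True
            have "0 \<le> W r w" using last_zero_positive[OF lz W1(1), of r] last_zero_zero[OF lz] True r
              by (cases "r = left_zero w") auto
            moreover have "W r w < a" using low True r by (auto simp: left_low_def)
            ultimately show ?thesis by simp
          next
            case False
            then show ?thesis using ins[of r] r le W0 a by (cases "r = T k w") auto
          qed
          ultimately have "w \<in> joint a s t" using ret W1 height_less_iff[OF wM, of a] by (auto simp: joint_def)
          then show ?thesis using W0 True by (simp add: Y_def)
        next
          case False
          then have Wa: "W (T k w) w = a" using W01 by simp
          have "w \<notin> joint a s t"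
          proof
            assume J: "w \<in> joint a s t"
            then have ret: "w \<in> returns" by (simp add: joint_def)
            have "T k w \<le> right_zero w"
            proof (rule ccontr)
              assume "\<not> T k w \<le> right_zero w"
              then have "W (right_zero w) w \<in> {0<..<a}" using right_zero_ge[of w] by (intro ins) auto
              then show False using next_zero_zero[OF nzc rz(2)[OF ret]] rz(1)[OF ret] by simp
            qed
            moreover have "left_zero w \<le> T k w" using left_zero_range[OF wM] Tm t by linarith
            ultimately have "\<bar>W (T k w) w\<bar> < a" using J height_less_iff[OF wM, of a] by (auto simp: joint_def)
            then show False using Wa by simp
          qed
          then show ?thesis using Wa a by (simp add: Y_def)
        qed
      qed
      moreover obtain K :: nat where "r0 - t \<le> real K" using real_arch_simple by blast
      ultimately have "\<forall>\<^sub>F k in sequentially. Y k w = indicator (joint a s t) w"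
        unfolding eventually_sequentially by (intro exI[of _ K]) force
      then show ?thesis by (rule tendsto_eventually)
    qed
  qed
  have "(\<lambda>k. \<integral>w. Y k w \<partial>M) \<longlonglongrightarrow> (\<integral>w. indicator (joint a s t) w \<partial>M)"
  proof (rule integral_dominated_convergence[where w="\<lambda>_. 1"])
    show "AE w in M. (\<lambda>k. Y k w) \<longlonglongrightarrow> indicator (joint a s t) w"
      using AE_leaves_interval[OF a order_trans[OF zero_le_one t]] AE_space by eventually_elim (rule lim)
  qed (use Ym Yb in auto)
  then have "(\<integral>w. indicator (joint a s t) w \<partial>M) = (\<integral>w. indicator A w * (1 - W t w / a) \<partial>M)"
    by (simp add: EY LIMSEQ_const_iff)
  then show ?thesis by (simp add: A_def)
qed

text \<open>On \<open>A\<close> the factor \<open>1 - W t / a\<close> is expanded in the sines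
  vanishing at 0 and \<open>a\<close>. Each coefficient decays by exp (- c^2 (t - 1) / 2) over
  \<open>[1, t]\<close> and by exp (- c^2 (1 - s) / 2) over \<open>[s, 1]\<close>. Sum and integral
  are exchanged for Abel parameters below 1, and \<open>s < t\<close> makes the coefficients
  absolutely summable, so that the parameter can tend to 1.\<close>

lemma prob_joint_series:
  assumes a: "0 < a" and s: "0 < s" "s \<le> 1" and t: "1 \<le> t" "s < t"
  defines "c \<equiv> \<lambda>n. real (Suc n) * pi / a"
  shows "(\<lambda>n. 2 / (real (Suc n) * pi) * (exp (- ((c n)\<^sup>2 * (t - s) / 2)) *
      (\<integral>w. indicator {0<..} (W s w) * sin (c n * W s w) \<partial>M))) sums prob (joint a s t)"
proof -
  define A where "A = left_low a s \<inter> stays {0<..<a} 1 t"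
  have sin0: "sin (c n * a) = 0" for n
    using a sin_npi[of "Suc n"] by (simp add: c_def del: sin_npi of_nat_Suc)
  have low: "left_low a s \<in> sets (past 1)" using left_low_past[OF a s sin0[of 0]] .
  have "A \<in> sets (past t)" using low stays_past[of "{0<..<a}" 1 t] sets_past_mono[OF t(1)] t by (auto simp: A_def)
  then have [measurable]: "A \<in> events" using sets_past_events by auto
  have [measurable]: "W t \<in> borel_measurable M" "W s \<in> borel_measurable M" using t s by auto
  have AI: "W t w \<in> {0<..<a}" if "w \<in> A" for w using that t by (auto simp: A_def stays_def)
  define e where "e n = (\<integral>w. indicator {0<..} (W s w) * sin (c n * W s w) \<partial>M)" for n
  have e: "\<bar>e n\<bar> \<le> 1" for n
  proof -
    have "\<bar>e n\<bar> \<le> (\<integral>w. \<bar>indicator {0<..} (W s w) * sin (c n * W s w)\<bar> \<partial>M)"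
      unfolding e_def by (rule integral_abs_bound)
    also have "\<dots> \<le> (\<integral>w. 1 \<partial>M)"
      by (intro integral_mono integrable_const_bound[where B=1]) (auto simp: indicator_def)
    finally show ?thesis by (simp add: prob_space)
  qed
  define E where "E n = exp (- ((c n)\<^sup>2 * (t - s) / 2)) * e n" for n
  have IA: "(\<integral>w. indicator A w * sin (c n * W t w) \<partial>M) = E n" for n
  proof -
    have "(\<integral>w. indicator A w * sin (c n * W t w) \<partial>M) = exp (- ((c n)\<^sup>2 * (t - 1) / 2)) * (\<integral>w. indicator (left_low a s) w * sin (c n * W 1 w) \<partial>M)"
      unfolding A_def
    proof (rule stays_integral_sin[OF low])
      show "W 1 w \<in> {0<..<a}" if "w \<in> left_low a s" for w
        using that left_zero_range[of w] by (auto simp: left_low_def)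
      show "sin (c n * y) = 0" if "y \<in> frontier {0<..<a}" for y
        using that a sin0 by (auto simp: frontier_def)
    qed (use t in auto)
    also have "\<dots> = (exp (- ((c n)\<^sup>2 * (t - 1) / 2)) * exp (- ((c n)\<^sup>2 * (1 - s) / 2))) * e n"
      unfolding left_low_integral_sin[OF a s sin0] e_def by simp
    also have "exp (- ((c n)\<^sup>2 * (t - 1) / 2)) * exp (- ((c n)\<^sup>2 * (1 - s) / 2)) = exp (- ((c n)\<^sup>2 * (t - s) / 2))"
      unfolding exp_add[symmetric] by (simp add: field_simps)
    finally show ?thesis by (simp add: E_def)
  qed
  \<comment> \<open>Abel parameters in \<open>(0, 1)\<close> tending to 1.\<close>
  define r where "r k = 1 - 1 / real (Suc (Suc k))" for k
  have r: "0 \<le> r k" "r k < 1" for k by (auto simp: r_def divide_simps)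
  have rlim: "r \<longlonglongrightarrow> 1" 
    using tendsto_diff[OF tendsto_const[of 1] LIMSEQ_Suc[OF LIMSEQ_Suc[OF lim_const_over_n[of 1]]]]
    unfolding r_def by simp
  define f where "f k i w = indicator A w * (2 / pi * (r k ^ Suc i * sin (real (Suc i) * (pi * W t w / a)) / real (Suc i)))" for k i w
  define S where "S k w = indicator A w * (2 / pi * (- Im (Ln (1 - complex_of_real (r k) * cis (pi * W t w / a)))))" for k w
  have ang: "0 < pi * W t w / a" "pi * W t w / a < pi" if "w \<in> A" for w
    using AI[OF that] a by (auto simp: field_simps)
  have fS: "(\<lambda>i. f k i w) sums S k w" for k w
  proof (cases "w \<in> A")
    case True
    from sums_mult[OF sine_series_sums[OF ang[OF True] r], of "2 / pi"] show ?thesis using True by (simp add: f_def S_def)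
  qed (simp add: f_def S_def)
  have fb: "\<bar>f k i w\<bar> \<le> r k ^ Suc i" for k i w
  proof -
    have "\<bar>r k ^ Suc i * sin (real (Suc i) * (pi * W t w / a)) / real (Suc i)\<bar> \<le> r k ^ Suc i"
    proof -
      have "\<bar>r k ^ Suc i * sin (real (Suc i) * (pi * W t w / a)) / real (Suc i)\<bar> = r k ^ Suc i * (\<bar>sin (real (Suc i) * (pi * W t w / a))\<bar> / real (Suc i))"
        using r[of k] by (simp add: abs_mult power_abs)
      also have "\<dots> \<le> r k ^ Suc i * 1"
        using r[of k] by (intro mult_left_mono) (auto simp: divide_le_eq intro: order_trans[OF abs_sin_le_one])
      finally show ?thesis by simp
    qed
    then have "\<bar>2 / pi * (r k ^ Suc i * sin (real (Suc i) * (pi * W t w / a)) / real (Suc i))\<bar> \<le> 1 * r k ^ Suc i"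
      unfolding abs_mult using pi_ge_two by (intro mult_mono) (auto simp: divide_le_eq)
    then show ?thesis using r[of k] unfolding f_def by (auto simp: indicator_def)
  qed
  have sr: "summable (\<lambda>i. r k ^ Suc i)" for k
    using summable_geometric[of "r k"] r[of k] by (subst summable_Suc_iff) auto
  have fm [measurable]: "f k i \<in> borel_measurable M" for k i unfolding f_def by measurable
  have fint: "integrable M (f k i)" for k i
    by (rule integrable_const_bound[where B="r k ^ Suc i"]) (use fb in auto)
  have fE: "(\<integral>w. f k i w \<partial>M) = r k ^ Suc i * (2 / (real (Suc i) * pi) * E i)" for k i
  proof -
    have "f k i w = (r k ^ Suc i * (2 / (real (Suc i) * pi))) * (indicator A w * sin (c i * W t w))" for w
      by (simp add: f_def c_def mult_ac)
    then show ?thesis by (simp add: IA)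
  qed
  have SE: "(\<lambda>i. r k ^ Suc i * (2 / (real (Suc i) * pi) * E i)) sums (\<integral>w. S k w \<partial>M)" for k
  proof -
    have "(\<lambda>i. \<integral>w. f k i w \<partial>M) sums (\<integral>w. (\<Sum>i. f k i w) \<partial>M)"
    proof (rule sums_integral[OF fint])
      show "AE w in M. summable (\<lambda>i. norm (f k i w))"
        by (intro AE_I2 summable_comparison_test'[OF sr[of k]]) (use fb in auto)
      show "summable (\<lambda>i. \<integral>w. norm (f k i w) \<partial>M)"
      proof (rule summable_comparison_test'[OF sr[of k]])
        fix i :: nat
        have "(\<integral>w. norm (f k i w) \<partial>M) \<le> (\<integral>w. r k ^ Suc i \<partial>M)"
          using fint fb by (intro integral_mono) auto
        then show "norm (\<integral>w. norm (f k i w) \<partial>M) \<le> r k ^ Suc i" by (simp add: prob_space)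
      qed
    qed
    then show ?thesis using sums_unique[OF fS] by (simp add: fE cong: Bochner_Integration.integral_cong)
  qed
  have Sm: "S k \<in> borel_measurable M" for k
    by (rule borel_measurable_LIMSEQ_real[where u="\<lambda>n w. \<Sum>i<n. f k i w"])
      (use fS in \<open>auto simp: sums_def\<close>)
  have Sb: "\<bar>S k w\<bar> \<le> 1" for k w
  proof (cases "w \<in> A")
    case True
    from sine_series_bound[OF ang[OF True] r, of k] have "2 / pi * \<bar>Im (Ln (1 - complex_of_real (r k) * cis (pi * W t w / a)))\<bar> \<le> 2 / pi * (pi / 2)"
      by (rule mult_left_mono) simp
    then show ?thesis using True by (simp add: S_def abs_mult)
  qed (simp add: S_def)
  have Sl: "(\<lambda>k. S k w) \<longlonglongrightarrow> indicator A w * (1 - W t w / a)" for w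
  proof (cases "w \<in> A")
    case True
    have "(\<lambda>k. 2 / pi * (- Im (Ln (1 - complex_of_real (r k) * cis (pi * W t w / a))))) \<longlonglongrightarrow> 2 / pi * ((pi - pi * W t w / a) / 2)"
      by (intro tendsto_mult tendsto_const sine_series_tendsto[OF ang[OF True] rlim])
    also have "2 / pi * ((pi - pi * W t w / a) / 2) = 1 - W t w / a" by (simp add: field_simps)
    finally show ?thesis using True by (simp add: S_def)
  qed (simp add: S_def)
  have "(\<lambda>k. \<integral>w. S k w \<partial>M) \<longlonglongrightarrow> (\<integral>w. indicator A w * (1 - W t w / a) \<partial>M)"
    by (rule integral_dominated_convergence[where w="\<lambda>_. 1"]) (use Sm Sb Sl in auto)
  then have lim1: "(\<lambda>k. \<Sum>i. r k ^ Suc i * (2 / (real (Suc i) * pi) * E i)) \<longlonglongrightarrow> prob (joint a s t)"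
    using sums_unique[OF SE] prob_joint_eq_integral[OF a s t(1)] by (simp add: A_def)
  \<comment> \<open>As the square of \<open>Suc n\<close> is at least \<open>n\<close>, the decay
    factors are dominated by the powers of \<open>q\<close>, whatever the Abel parameter. This is
    the majorant for Tannery's theorem.\<close>
  define q where "q = exp (- ((c 0)\<^sup>2 * (t - s) / 2))"
  have q: "0 < q" "q < 1" using t a by (auto simp: q_def c_def)
  have cb: "exp (- ((c n)\<^sup>2 * (t - s) / 2)) \<le> q ^ n" for n
  proof -
    have "real n * (c 0)\<^sup>2 \<le> (c n)\<^sup>2"
    proof -
      have "c n = real (Suc n) * c 0" by (simp add: c_def)
      then have "(c n)\<^sup>2 = (real (Suc n))\<^sup>2 * (c 0)\<^sup>2" by (simp add: power_mult_distrib)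
      moreover have "real n \<le> (real (Suc n))\<^sup>2" by (simp add: power2_eq_square algebra_simps)
      ultimately show ?thesis by (simp add: mult_right_mono)
    qed
    then have "real n * (c 0)\<^sup>2 * ((t - s) / 2) \<le> (c n)\<^sup>2 * ((t - s) / 2)" using t by (intro mult_right_mono) auto
    then have "- ((c n)\<^sup>2 * (t - s) / 2) \<le> real n * (- ((c 0)\<^sup>2 * (t - s) / 2))" by (simp add: algebra_simps)
    then show ?thesis unfolding q_def exp_of_nat_mult[symmetric] by simp
  qed
  define x where "x n = 2 / (real (Suc n) * pi) * E n" for n
  have xb: "\<bar>x n\<bar> \<le> q ^ n" for n
  proof -
    have "\<bar>E n\<bar> \<le> q ^ n * 1" unfolding E_def abs_mult using cb[of n] e[of n] q by (intro mult_mono) auto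
    moreover have "\<bar>2 / (real (Suc n) * pi)\<bar> \<le> 1"
    proof -
      have "2 * 1 \<le> pi * real (Suc n)" using pi_ge_two by (intro mult_mono) auto
      then show ?thesis by (simp add: divide_le_eq mult.commute del: of_nat_Suc)
    qed
    ultimately have "\<bar>2 / (real (Suc n) * pi)\<bar> * \<bar>E n\<bar> \<le> 1 * q ^ n" by (intro mult_mono) auto
    then show ?thesis by (simp add: x_def abs_mult)
  qed
  have qs: "summable (\<lambda>n. q ^ n)" using q by (intro summable_geometric) auto
  have "(\<lambda>k. \<Sum>i. r k ^ Suc i * x i) \<longlonglongrightarrow> (\<Sum>i. x i)"
  proof (rule tannerys_theorem[THEN conjunct2, THEN conjunct2])
    show "(\<lambda>n. r n ^ Suc k * x k) \<longlonglongrightarrow> x k" for k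
      using tendsto_mult[OF tendsto_power[OF rlim, of "Suc k"] tendsto_const[of "x k"]] by simp
    show "\<forall>\<^sub>F (k, n) in sequentially \<times>\<^sub>F sequentially. norm (r n ^ Suc k * x k) \<le> q ^ k"
    proof (intro always_eventually allI, safe)
      fix k n
      have "\<bar>r n ^ Suc k\<bar> * \<bar>x k\<bar> \<le> 1 * q ^ k"
        using r[of n] xb[of k] power_le_one[of "r n" "Suc k"] by (intro mult_mono) (auto simp: power_abs)
      then show "norm (r n ^ Suc k * x k) \<le> q ^ k" by (simp add: abs_mult)
    qed
  qed (use qs in auto)
  then have "(\<Sum>i. x i) = prob (joint a s t)" using lim1 unfolding x_def by (intro LIMSEQ_unique)
  moreover have "summable x" by (rule summable_comparison_test'[OF qs]) (use xb in auto)
  ultimately have "x sums prob (joint a s t)" by (simp add: sums_iff)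
  then show ?thesis by (simp add: x_def[abs_def] E_def e_def)
qed

end

section \<open>The joint density\<close>

text \<open>The expectation of sin (x Z) on the event Z > 0 for a standard normal Z. In terms of
  Dawson's function D it equals D (x / sqrt 2) / sqrt pi.\<close>

definition gauss_sine :: "real \<Rightarrow> real" where
  "gauss_sine x = (\<integral>z. indicator {0<..} z * (std_normal_density z * sin (x * z)) \<partial>lborel)"

lemma std_normal_density_DERIV:
  "(std_normal_density has_real_derivative (- z * std_normal_density z)) (at z)"
proof -
  have "((\<lambda>z. k * exp (- z\<^sup>2 / 2)) has_real_derivative (- z * (k * exp (- z\<^sup>2 / 2)))) (at z)" for k :: real
    by (auto intro!: derivative_eq_intros)
  then show ?thesis unfolding std_normal_density_def[abs_def] .
qed

lemma std_normal_density_at_top: "(std_normal_density \<longlongrightarrow> 0) at_top"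
proof -
  have "((\<lambda>z::real. exp (- (1 / 2 * z\<^sup>2))) \<longlongrightarrow> 0) at_top"
    by (intro filterlim_compose[OF exp_at_bot] filterlim_compose[OF filterlim_uminus_at_bot_at_top]
      filterlim_tendsto_pos_mult_at_top[OF tendsto_const] filterlim_pow_at_top filterlim_ident) auto
  from tendsto_mult_right_zero[OF this, of "1 / sqrt (2 * pi)"] show ?thesis
    unfolding std_normal_density_def[abs_def] by simp
qed

lemma abs_sin_diff_le: "\<bar>sin a - sin b\<bar> \<le> \<bar>a - b\<bar>" for a b :: real
proof -
  have "\<bar>sin a - sin b\<bar> = 2 * \<bar>sin ((a - b) / 2)\<bar> * \<bar>cos ((a + b) / 2)\<bar>"
    by (simp add: sin_diff_sin abs_mult)
  also have "\<dots> \<le> 2 * \<bar>(a - b) / 2\<bar> * 1"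
    by (intro mult_mono abs_sin_x_le_abs_x) auto
  finally show ?thesis by simp
qed

text \<open>Dawson's differential equation. Differentiation under the integral, dominated by the
  first absolute moment, gives \<open>C\<close>. The primitive \<open>?F\<close> then relates
  \<open>C\<close> to \<open>gauss_sine x\<close>, and its value at 0 produces the constant 1 / sqrt
  (2 pi).\<close>

lemma gauss_sine_DERIV:
  "(gauss_sine has_real_derivative (1 / sqrt (2 * pi) - x * gauss_sine x)) (at x)"
proof -
  let ?n = std_normal_density
  define I where "I z = (indicator {0<..} z :: real)" for z :: real
  have [measurable]: "I \<in> borel_measurable borel" unfolding I_def by measurable
  have I: "0 \<le> I z" "I z \<le> 1" for z by (auto simp: I_def indicator_def)
  have abs_int: "integrable lborel (\<lambda>z. ?n z * \<bar>z\<bar>)"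
    using integrable_std_normal_moment_abs[of 1] by simp
  have int: "integrable lborel (\<lambda>z. I z * (?n z * g z))"
    if [measurable]: "g \<in> borel_measurable borel" and "\<And>z. \<bar>g z\<bar> \<le> \<bar>z\<bar>" for g
  proof (rule Bochner_Integration.integrable_bound[OF abs_int])
    show "AE z in lborel. norm (I z * (?n z * g z)) \<le> norm (?n z * \<bar>z\<bar>)"
    proof (rule AE_I2)
      fix z
      have "\<bar>I z\<bar> * (?n z * \<bar>g z\<bar>) \<le> 1 * (?n z * \<bar>z\<bar>)"
        using I[of z] that(2)[of z] by (intro mult_mono mult_left_mono) auto
      then show "norm (I z * (?n z * g z)) \<le> norm (?n z * \<bar>z\<bar>)" by (simp add: abs_mult)
    qed
  qed measurable
  have ints: "integrable lborel (\<lambda>z. I z * (?n z * sin (y * z)))" for y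
  proof (rule Bochner_Integration.integrable_bound[OF integrable_normal_density[of 1 0]])
    show "AE z in lborel. norm (I z * (?n z * sin (y * z))) \<le> norm (?n z)"
    proof (rule AE_I2)
      fix z
      have "\<bar>I z\<bar> * (?n z * \<bar>sin (y * z)\<bar>) \<le> 1 * (?n z * 1)"
        using I[of z] by (intro mult_mono mult_left_mono) auto
      then show "norm (I z * (?n z * sin (y * z))) \<le> norm (?n z)" by (simp add: abs_mult)
    qed
  qed simp_all
  have intc: "integrable lborel (\<lambda>z. I z * (?n z * (z * cos (x * z))))"
    by (rule int) (auto simp: abs_mult intro: mult_left_le)
  define C where "C = (\<integral>z. I z * (?n z * (z * cos (x * z))) \<partial>lborel)"
  have "(gauss_sine has_real_derivative C) (at x)"
    unfolding has_field_derivative_iff tendsto_at_iff_sequentially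
  proof (intro allI impI)
    fix X :: "nat \<Rightarrow> real" assume X: "\<forall>i. X i \<in> UNIV - {x}" "X \<longlonglongrightarrow> x"
    let ?q = "\<lambda>i z. I z * (?n z * ((sin (X i * z) - sin (x * z)) / (X i - x)))"
    have "(\<lambda>i. \<integral>z. ?q i z \<partial>lborel) \<longlonglongrightarrow> C" unfolding C_def
    proof (rule integral_dominated_convergence[OF _ _ abs_int])
      show "AE z in lborel. (\<lambda>i. ?q i z) \<longlonglongrightarrow> I z * (?n z * (z * cos (x * z)))"
      proof (rule AE_I2)
        fix z
        have "((\<lambda>y. sin (y * z)) has_real_derivative z * cos (x * z)) (at x)"
          by (auto intro!: derivative_eq_intros)
        then have "(\<lambda>i. (sin (X i * z) - sin (x * z)) / (X i - x)) \<longlonglongrightarrow> z * cos (x * z)"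
          using X unfolding has_field_derivative_iff tendsto_at_iff_sequentially by (auto simp: comp_def)
        then show "(\<lambda>i. ?q i z) \<longlonglongrightarrow> I z * (?n z * (z * cos (x * z)))"
          by (intro tendsto_mult tendsto_const)
      qed
      show "AE z in lborel. norm (?q i z) \<le> ?n z * \<bar>z\<bar>" for i
      proof (rule AE_I2)
        fix z
        have "\<bar>sin (X i * z) - sin (x * z)\<bar> \<le> \<bar>X i - x\<bar> * \<bar>z\<bar>"
          using abs_sin_diff_le[of "X i * z" "x * z"] by (simp add: abs_mult[symmetric] left_diff_distrib)
        then have "\<bar>(sin (X i * z) - sin (x * z)) / (X i - x)\<bar> \<le> \<bar>z\<bar>"
          using X(1) by (auto simp: divide_le_eq mult.commute)
        then have "\<bar>I z\<bar> * (?n z * \<bar>(sin (X i * z) - sin (x * z)) / (X i - x)\<bar>) \<le> 1 * (?n z * \<bar>z\<bar>)"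
          using I[of z] by (intro mult_mono mult_left_mono) auto
        then show "norm (?q i z) \<le> ?n z * \<bar>z\<bar>" by (simp add: abs_mult)
      qed
    qed measurable
    moreover have "(\<integral>z. ?q i z \<partial>lborel) = (gauss_sine (X i) - gauss_sine x) / (X i - x)" for i
    proof -
      have "?q i z = (I z * (?n z * sin (X i * z)) - I z * (?n z * sin (x * z))) / (X i - x)" for z
        by (simp add: right_diff_distrib)
      then have "(\<integral>z. ?q i z \<partial>lborel) = (\<integral>z. (I z * (?n z * sin (X i * z)) - I z * (?n z * sin (x * z))) / (X i - x) \<partial>lborel)"
        by (simp only:)
      also have "\<dots> = (gauss_sine (X i) - gauss_sine x) / (X i - x)"
        using Bochner_Integration.integral_diff[OF ints[of "X i"] ints[of x]]
        by (simp only: integral_divide_zero gauss_sine_def I_def)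
      finally show ?thesis .
    qed
    ultimately show "((\<lambda>y. (gauss_sine y - gauss_sine x) / (y - x)) \<circ> X) \<longlonglongrightarrow> C"
      by (simp only: comp_def)
  qed
  moreover
  have "C + x * gauss_sine x = 1 / sqrt (2 * pi)"
  proof -
    let ?f = "\<lambda>z. ?n z * (z * cos (x * z)) + x * (?n z * sin (x * z))"
    let ?F = "\<lambda>z. - (cos (x * z) * ?n z)"
    have intf: "integrable lborel (\<lambda>z. I z * ?f z)"
      using Bochner_Integration.integrable_add[OF intc integrable_mult_right[OF ints[of x], of x]]
      by (simp add: algebra_simps)
    have "(LBINT z=0..\<infinity>. ?f z) = 0 - (- 1 / sqrt (2 * pi))"
    proof (rule interval_integral_FTC_integrable[where F="?F"])
      show "(?F has_vector_derivative ?f z) (at z)" for z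
        unfolding has_real_derivative_iff_has_vector_derivative[symmetric]
        by (rule derivative_eq_intros std_normal_density_DERIV refl | simp add: algebra_simps)+
      show "isCont ?f z" for z
        by (intro continuous_intros DERIV_isCont[OF std_normal_density_DERIV])
      show "set_integrable lborel (einterval 0 \<infinity>) ?f"
        using intf by (simp add: set_integrable_def I_def zero_ereal_def)
      have "isCont ?F 0"
        by (intro continuous_intros DERIV_isCont[OF std_normal_density_DERIV])
      then have "continuous (at_right 0) ?F" by (rule continuous_at_imp_continuous_at_within)
      then show "((?F \<circ> real_of_ereal) \<longlongrightarrow> - 1 / sqrt (2 * pi)) (at_right 0)"
        unfolding zero_ereal_def ereal_tendsto_simps by (simp add: continuous_within std_normal_density_def)
      have "((\<lambda>z. cos (x * z) * ?n z) \<longlongrightarrow> 0) at_top"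
        by (rule Lim_null_comparison[OF _ std_normal_density_at_top])
          (auto intro!: always_eventually simp: abs_mult mult_left_le_one_le)
      from tendsto_minus[OF this] show "((?F \<circ> real_of_ereal) \<longlongrightarrow> 0) (at_left \<infinity>)"
        unfolding ereal_tendsto_simps by simp
    qed simp
    also have "(LBINT z=0..\<infinity>. ?f z) = (\<integral>z. I z * ?f z \<partial>lborel)"
      by (simp add: interval_lebesgue_integral_def set_lebesgue_integral_def I_def zero_ereal_def)
    also have "\<dots> = (\<integral>z. I z * (?n z * (z * cos (x * z))) + x * (I z * (?n z * sin (x * z))) \<partial>lborel)"
      by (simp add: algebra_simps)
    also have "\<dots> = C + x * gauss_sine x"
      using intc ints[of x] by (subst Bochner_Integration.integral_add) (auto simp: C_def gauss_sine_def I_def)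
    finally show ?thesis by simp
  qed
  then have "C = 1 / sqrt (2 * pi) - x * gauss_sine x" by (simp only: eq_diff_eq)
  ultimately show ?thesis by (simp only:)
qed

text \<open>Only one-sided limits of the primitive enter at the end points, because the integrands
  to come blow up there.\<close>

lemma nn_integral_FTC_Ioo:
  fixes f F :: "real \<Rightarrow> real"
  assumes ab: "a < b" and D: "\<And>x. a < x \<Longrightarrow> x < b \<Longrightarrow> (F has_real_derivative f x) (at x)"
    and f: "\<And>x. a < x \<Longrightarrow> x < b \<Longrightarrow> isCont f x" "\<And>x. a < x \<Longrightarrow> x < b \<Longrightarrow> 0 \<le> f x"
    and lim: "(F \<longlongrightarrow> A) (at_right a)" "(F \<longlongrightarrow> B) (at_left b)"
  shows "(\<integral>\<^sup>+x. indicator {a<..<b} x * ennreal (f x) \<partial>lborel) = ennreal (B - A)" and "A \<le> B"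
proof -
  have AE: "AE x in lborel. ereal a < ereal x \<longrightarrow> ereal x < ereal b \<longrightarrow> 0 \<le> f x"
    using f(2) by (intro AE_I2) simp
  have lim': "((F \<circ> real_of_ereal) \<longlongrightarrow> A) (at_right (ereal a))" "((F \<circ> real_of_ereal) \<longlongrightarrow> B) (at_left (ereal b))"
    unfolding ereal_tendsto_simps by (rule lim)+
  note FTC = interval_integral_FTC_nonneg[OF _ _ _ AE lim']
  have int: "integrable lborel (\<lambda>x. indicator {a<..<b} x * f x)" and eq: "(\<integral>x. indicator {a<..<b} x * f x \<partial>lborel) = B - A"
    using FTC ab D f(1) by (auto simp: set_integrable_def interval_lebesgue_integral_def set_lebesgue_integral_def)
  have nn: "0 \<le> indicator {a<..<b} x * f x" for x using f(2) by (simp add: indicator_def)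
  have "indicator {a<..<b} x * ennreal (f x) = ennreal (indicator {a<..<b} x * f x)" for x
    by (simp add: indicator_def)
  then show "(\<integral>\<^sup>+x. indicator {a<..<b} x * ennreal (f x) \<partial>lborel) = ennreal (B - A)"
    using nn_integral_eq_integral[OF int] nn eq by simp
  have "0 \<le> B - A" unfolding eq[symmetric] using nn by (intro Bochner_Integration.integral_nonneg) auto
  then show "A \<le> B" by simp
qed

text \<open>By the differential equation the \<open>gauss_sine\<close> terms cancel in the
  derivative of exp (c^2 u / 2) * gauss_sine (c sqrt u). Each coefficient of the joint tail is
  thereby an integral of an explicit positive function, and the sign is what permits termwise sums
  in \<open>ennreal\<close>.\<close>

lemma gauss_sine_nn_integral:
  assumes c: "0 < c" and s: "0 < s"
  shows "(\<integral>\<^sup>+u. indicator {0<..<s} u * ennreal (c / 2 * exp (c\<^sup>2 * u / 2) / sqrt (2 * pi * u)) \<partial>lborel) =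
    ennreal (exp (c\<^sup>2 * s / 2) * gauss_sine (c * sqrt s))"
    and gauss_sine_nonneg: "0 \<le> gauss_sine (c * sqrt s)"
proof -
  let ?f = "\<lambda>u. c / 2 * exp (c\<^sup>2 * u / 2) / sqrt (2 * pi * u)"
  define G where "G u = exp (c\<^sup>2 * u / 2) * gauss_sine (c * sqrt u)" for u
  have 0: "gauss_sine 0 = 0" by (simp add: gauss_sine_def)
  have cont: "isCont gauss_sine x" for x by (rule DERIV_isCont[OF gauss_sine_DERIV])
  have Gc: "continuous (at u within A) G" for u A
    unfolding G_def by (intro continuous_intros isCont_o2[OF _ cont] continuous_at_imp_continuous_at_within[of u _ A]) simp_all
  have GD: "(G has_real_derivative ?f u) (at u)" if u: "0 < u" for u
  proof -
    have e: "((\<lambda>u. exp (c\<^sup>2 * u / 2)) has_real_derivative exp (c\<^sup>2 * u / 2) * (c\<^sup>2 / 2)) (at u)"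
      by (auto intro!: derivative_eq_intros)
    have g: "((\<lambda>u. gauss_sine (c * sqrt u)) has_real_derivative
        (1 / sqrt (2 * pi) - c * sqrt u * gauss_sine (c * sqrt u)) * (c * (inverse (sqrt u) / 2))) (at u)"
      by (rule DERIV_chain2[OF gauss_sine_DERIV]) (use u in \<open>auto intro!: derivative_eq_intros\<close>)
    have "exp (c\<^sup>2 * u / 2) * (c\<^sup>2 / 2) * gauss_sine (c * sqrt u) +
      (1 / sqrt (2 * pi) - c * sqrt u * gauss_sine (c * sqrt u)) * (c * (inverse (sqrt u) / 2)) * exp (c\<^sup>2 * u / 2) = ?f u"
      using u by (simp add: real_sqrt_mult field_simps power2_eq_square)
    then show ?thesis unfolding G_def using DERIV_mult[OF e g] by simp
  qed
  have lim: "(G \<longlongrightarrow> 0) (at_right 0)" "(G \<longlongrightarrow> G s) (at_left s)"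
    using Gc[of 0 "{0<..}"] Gc[of s "{..<s}"] by (auto simp: continuous_within G_def 0)
  have cont_f: "isCont ?f u" if "0 < u" for u
    using that by (intro continuous_intros) auto
  have "0 \<le> ?f u" if "0 < u" for u using that c by simp
  note FTC = nn_integral_FTC_Ioo[OF s GD cont_f this lim]
  show "(\<integral>\<^sup>+u. indicator {0<..<s} u * ennreal (?f u) \<partial>lborel) = ennreal (exp (c\<^sup>2 * s / 2) * gauss_sine (c * sqrt s))"
    using FTC(1) by (simp add: G_def)
  show "0 \<le> gauss_sine (c * sqrt s)" using FTC(2) by (simp add: G_def zero_le_mult_iff)
qed

text \<open>Minus the mixed derivative in \<open>s\<close> and \<open>t\<close> of the joint tail
  series, taken term by term. In \<open>ennreal\<close> the sum raises no question of
  convergence.\<close>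

definition exc_density :: "real \<Rightarrow> real \<times> real \<Rightarrow> ennreal" where
  "exc_density a = (\<lambda>(u, v). indicator {0<..<1} u * indicator {1<..} v *
     (\<Sum>n. ennreal ((real (Suc n) * pi / a)\<^sup>2 / (2 * a) * exp (- ((real (Suc n) * pi / a)\<^sup>2 * (v - u) / 2)) / sqrt (2 * pi * u))))"

lemma exc_density_measurable [measurable]: "exc_density a \<in> borel_measurable (lborel \<Otimes>\<^sub>M lborel)"
  unfolding exc_density_def by measurable

lemma nn_integral_exp_tail:
  assumes "0 < l"
  shows "(\<integral>\<^sup>+v. indicator {t<..} v * ennreal (l * exp (- (l * v))) \<partial>lborel) = ennreal (exp (- (l * t)))"
proof -
  have "(\<integral>\<^sup>+v. indicator {t<..} v * ennreal (l * exp (- (l * v))) \<partial>lborel) = (\<integral>\<^sup>+v. ennreal (l * exp (- (l * v))) * indicator {t..} v \<partial>lborel)"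
    by (rule nn_integral_cong_AE) (use AE_lborel_singleton[of t] in eventually_elim, auto simp: indicator_def)
  also have "\<dots> = ennreal (0 - (- exp (- (l * t))))"
  proof (rule nn_integral_FTC_atLeast)
    show "((\<lambda>v. - exp (- (l * v))) has_real_derivative l * exp (- (l * v))) (at v)" for v
      by (auto intro!: derivative_eq_intros)
    have "((\<lambda>v. exp (- (l * v))) \<longlongrightarrow> 0) at_top"
      by (intro filterlim_compose[OF exp_at_bot] filterlim_compose[OF filterlim_uminus_at_bot_at_top]
        filterlim_tendsto_pos_mult_at_top[OF tendsto_const assms filterlim_ident])
    from tendsto_minus[OF this] show "((\<lambda>v. - exp (- (l * v))) \<longlongrightarrow> 0) at_top" by simp
  qed (use assms in auto)
  finally show ?thesis by simp
qed

text \<open>Each term is a product of a function of \<open>u\<close>, which integrates to a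
  \<open>gauss_sine\<close> value, and an exponential in \<open>v\<close>. By Tonelli the result is
  the series of \<open>prob_joint_series\<close>.\<close>

lemma exc_density_quadrant:
  assumes a: "0 < a" and s: "0 < s" "s \<le> 1" and t: "1 \<le> t"
  shows "(\<integral>\<^sup>+x. exc_density a x * indicator ({..<s} \<times> {t<..}) x \<partial>(lborel \<Otimes>\<^sub>M lborel)) =
    (\<Sum>n. ennreal (2 / (real (Suc n) * pi) * (exp (- ((real (Suc n) * pi / a)\<^sup>2 * (t - s) / 2)) * gauss_sine (real (Suc n) * pi / a * sqrt s))))"
proof -
  let ?c = "\<lambda>n. real (Suc n) * pi / a"
  let ?l = "\<lambda>n. (?c n)\<^sup>2 / 2"
  let ?A = "\<lambda>n u. indicator {0<..<s} u * ennreal (?c n / 2 * exp ((?c n)\<^sup>2 * u / 2) / sqrt (2 * pi * u))"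
  let ?B = "\<lambda>n v. indicator {t<..} v * ennreal (?l n * exp (- (?l n * v)))"
  let ?k = "\<lambda>n. ennreal (2 / (real (Suc n) * pi))"
  have cpos: "0 < ?c n" for n using a by simp
  have ex: "exp (- (x * (v - u) / 2)) = exp (x * u / 2) * exp (- (x / 2 * v))" for x u v :: real
    unfolding exp_add[symmetric] by (simp add: field_simps)
  have "(\<integral>\<^sup>+x. exc_density a x * indicator ({..<s} \<times> {t<..}) x \<partial>(lborel \<Otimes>\<^sub>M lborel)) =
    (\<integral>\<^sup>+(u, v). (\<Sum>n. ?k n * (?A n u * ?B n v)) \<partial>(lborel \<Otimes>\<^sub>M lborel))"
  proof (intro nn_integral_cong, clarify)
    fix u v :: real
    show "exc_density a (u, v) * indicator ({..<s} \<times> {t<..}) (u, v) = (\<Sum>n. ?k n * (?A n u * ?B n v))"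
    proof (cases "u \<in> {0<..<s} \<and> v \<in> {t<..}")
      case True
      then have u: "0 < u" "u < 1" "u < s" "1 < v" "t < v" using s t by auto
      have "ennreal ((?c n)\<^sup>2 / (2 * a) * exp (- ((?c n)\<^sup>2 * (v - u) / 2)) / sqrt (2 * pi * u)) = ?k n * (?A n u * ?B n v)" for n
      proof -
        have "exp (- ((?c n)\<^sup>2 * (v - u) / 2)) = exp ((?c n)\<^sup>2 * u / 2) * exp (- (?l n * v))"
          by (rule ex)
        \<comment> \<open>The three factors are the coefficient of the sine series,
          \<open>?c n / 2\<close> from the derivative in \<open>s\<close> and \<open>?l n\<close>
          from the derivative in \<open>t\<close>.\<close>
        moreover have "(?c n)\<^sup>2 / (2 * a) = 2 / (real (Suc n) * pi) * (?c n / 2) * ?l n"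
          using a by (simp add: field_simps power2_eq_square del: of_nat_Suc)
        ultimately have "(?c n)\<^sup>2 / (2 * a) * exp (- ((?c n)\<^sup>2 * (v - u) / 2)) / sqrt (2 * pi * u) =
          2 / (real (Suc n) * pi) * ((?c n / 2 * exp ((?c n)\<^sup>2 * u / 2) / sqrt (2 * pi * u)) * (?l n * exp (- (?l n * v))))"
          by simp
        moreover have "?A n u = ennreal (?c n / 2 * exp ((?c n)\<^sup>2 * u / 2) / sqrt (2 * pi * u))" "?B n v = ennreal (?l n * exp (- (?l n * v)))"
          using True by simp_all
        moreover have "0 \<le> ?c n / 2 * exp ((?c n)\<^sup>2 * u / 2) / sqrt (2 * pi * u)" "0 \<le> 2 / (real (Suc n) * pi)"
          using cpos[of n] u a by simp_all
        ultimately show ?thesis by (simp only: ennreal_mult')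
      qed
      then show ?thesis using u by (simp add: exc_density_def)
    next
      case False
      then show ?thesis by (auto simp: exc_density_def)
    qed
  qed
  also have "\<dots> = (\<Sum>n. \<integral>\<^sup>+(u, v). ?k n * (?A n u * ?B n v) \<partial>(lborel \<Otimes>\<^sub>M lborel))"
    unfolding split_beta' by (rule nn_integral_suminf) measurable
  also have "\<dots> = (\<Sum>n. ennreal (2 / (real (Suc n) * pi) * (exp (- ((?c n)\<^sup>2 * (t - s) / 2)) * gauss_sine (?c n * sqrt s))))"
  proof (intro suminf_cong)
    fix n
    have "(\<integral>\<^sup>+(u, v). ?k n * (?A n u * ?B n v) \<partial>(lborel \<Otimes>\<^sub>M lborel)) = (\<integral>\<^sup>+u. \<integral>\<^sup>+v. ?k n * (?A n u * ?B n v) \<partial>lborel \<partial>lborel)"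
      by (subst lborel.nn_integral_fst[symmetric]) (simp_all add: split_beta')
    also have "\<dots> = (\<integral>\<^sup>+u. ?k n * (?A n u * (\<integral>\<^sup>+v. ?B n v \<partial>lborel)) \<partial>lborel)"
      by (simp add: nn_integral_cmult)
    also have "\<dots> = ?k n * ((\<integral>\<^sup>+u. ?A n u \<partial>lborel) * (\<integral>\<^sup>+v. ?B n v \<partial>lborel))"
      by (subst nn_integral_cmult, measurable, subst nn_integral_multc) auto
    also have "(\<integral>\<^sup>+v. ?B n v \<partial>lborel) = ennreal (exp (- (?l n * t)))"
      by (rule nn_integral_exp_tail) (use cpos[of n] in auto)
    also have "(\<integral>\<^sup>+u. ?A n u \<partial>lborel) = ennreal (exp ((?c n)\<^sup>2 * s / 2) * gauss_sine (?c n * sqrt s))"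
      by (rule gauss_sine_nn_integral[OF cpos s(1)])
    also have "?k n * (ennreal (exp ((?c n)\<^sup>2 * s / 2) * gauss_sine (?c n * sqrt s)) * ennreal (exp (- (?l n * t)))) =
      ennreal (2 / (real (Suc n) * pi) * ((exp ((?c n)\<^sup>2 * s / 2) * exp (- (?l n * t))) * gauss_sine (?c n * sqrt s)))"
      using gauss_sine_nonneg[OF cpos s(1), of n] by (simp add: ennreal_mult'[symmetric] mult_ac)
    also have "exp ((?c n)\<^sup>2 * s / 2) * exp (- (?l n * t)) = exp (- ((?c n)\<^sup>2 * (t - s) / 2))"
      by (rule ex[symmetric])
    finally show "(\<integral>\<^sup>+(u, v). ?k n * (?A n u * ?B n v) \<partial>(lborel \<Otimes>\<^sub>M lborel)) =
      ennreal (2 / (real (Suc n) * pi) * (exp (- ((?c n)\<^sup>2 * (t - s) / 2)) * gauss_sine (?c n * sqrt s)))" .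
  qed
  finally show ?thesis .
qed

section \<open>Joint law of the zeros and the height\<close>

text \<open>Tails of the pair of zeros determine quadrants of exactly this orientation. They are
  stable under intersection and generate the Borel sets, as each coordinate half-plane is a
  countable union of them.\<close>

lemma quadrant_measure_eqI:
  fixes N1 N2 :: "(real \<times> real) measure"
  assumes sets1: "sets N1 = sets (borel \<Otimes>\<^sub>M borel)" and sets2: "sets N2 = sets (borel \<Otimes>\<^sub>M borel)"
    and fin: "\<And>A. emeasure N1 A \<noteq> \<infinity>"
    and eq: "\<And>s t. emeasure N1 ({..<s} \<times> {t<..}) = emeasure N2 ({..<s} \<times> {t<..})"
  shows "N1 = N2"
proof -
  define E where "E = {{..<s} \<times> {t<..} |(s::real) (t::real). True}"
  define S where "S = sigma (UNIV :: (real \<times> real) set) E"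
  have Q: "{..<s} \<times> {t<..} \<in> sets S" for s t
    unfolding S_def by (auto simp: E_def)
  have "fst \<in> measurable S borel"
  proof (rule borel_measurableI_less)
    fix s :: real
    have "{x \<in> space S. fst x < s} = (\<Union>n::nat. {..<s} \<times> {- real n<..})"
    proof (auto simp: S_def space_measure_of_conv)
      fix b :: real
      show "\<exists>n::nat. - real n < b" using reals_Archimedean2[of "- b"] by (auto simp: minus_less_iff)
    qed
    also have "\<dots> \<in> sets S" using Q by blast
    finally show "{x \<in> space S. fst x < s} \<in> sets S" .
  qed
  moreover have "snd \<in> measurable S borel"
  proof (rule borel_measurableI_greater)
    fix t :: real
    have "{x \<in> space S. t < snd x} = (\<Union>n::nat. {..<real n} \<times> {t<..})"
      by (auto simp: S_def space_measure_of_conv reals_Archimedean2)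
    also have "\<dots> \<in> sets S" using Q by blast
    finally show "{x \<in> space S. t < snd x} \<in> sets S" .
  qed
  ultimately have "(\<lambda>x. (fst x, snd x)) \<in> measurable S (borel \<Otimes>\<^sub>M borel)"
    by (rule measurable_Pair)
  then have id: "(\<lambda>x. x) \<in> measurable S (borel \<Otimes>\<^sub>M borel)" by simp
  have "sets (borel \<Otimes>\<^sub>M borel :: (real \<times> real) measure) \<subseteq> sets S"
  proof
    fix A assume "A \<in> sets (borel \<Otimes>\<^sub>M borel :: (real \<times> real) measure)"
    from measurable_sets[OF id this] show "A \<in> sets S" by (simp add: S_def space_measure_of_conv)
  qed
  moreover have "sets S \<subseteq> sets (borel \<Otimes>\<^sub>M borel :: (real \<times> real) measure)"
  proof -
    have "E \<subseteq> sets (borel \<Otimes>\<^sub>M borel :: (real \<times> real) measure)" by (auto simp: E_def)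
    from sets.sigma_sets_subset[OF this] show ?thesis by (simp add: S_def space_pair_measure)
  qed
  ultimately have sets: "sets (borel \<Otimes>\<^sub>M borel :: (real \<times> real) measure) = sigma_sets UNIV E"
    by (simp add: S_def)
  show ?thesis
  proof (rule measure_eqI_generator_eq[where \<Omega>=UNIV and E=E and A="\<lambda>i. {..<real i} \<times> {- real i<..}"])
    show "Int_stable E"
    proof (rule Int_stableI)
      fix a b assume "a \<in> E" "b \<in> E"
      then obtain s t s' t' where "a = {..<s} \<times> {t<..}" "b = {..<s'} \<times> {t'<..}" by (auto simp: E_def)
      then have "a \<inter> b = {..<min s s'} \<times> {max t t'<..}" by auto
      then show "a \<inter> b \<in> E" unfolding E_def by blast
    qed
    show "(\<Union>i. {..<real i} \<times> {- real i<..}) = UNIV"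
    proof (intro equalityI subset_UNIV subsetI)
      fix x :: "real \<times> real"
      obtain n where "max (fst x) (- snd x) < real n" using reals_Archimedean2 by blast
      then show "x \<in> (\<Union>i. {..<real i} \<times> {- real i<..})" by (cases x) (auto intro!: exI[of _ n])
    qed
    show "emeasure N1 ({..<real i} \<times> {- real i<..}) \<noteq> \<infinity>" for i by (rule fin)
  qed (use eq sets1 sets2 sets in \<open>auto simp: E_def\<close>)
qed

text \<open>What remains of \<open>exc_density a\<close> for
  \<open>a = \<epsilon> * sqrt (v - u)\<close> after a factor depending only on
  \<open>\<epsilon>\<close> is taken out. It is sqrt (2 pi) times the joint density of the zeros
  before and after time 1.\<close>

definition mass_density :: "real \<times> real \<Rightarrow> ennreal" where
  "mass_density = (\<lambda>(u, v). indicator {0<..<1} u * indicator {1<..} v * ennreal (1 / ((v - u) * sqrt (v - u)) / sqrt (2 * pi * u)))"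

lemma mass_density_measurable [measurable]: "mass_density \<in> borel_measurable (lborel \<Otimes>\<^sub>M lborel)"
  unfolding mass_density_def by measurable

lemma nn_integral_mass_density: "(\<integral>\<^sup>+x. mass_density x \<partial>(lborel \<Otimes>\<^sub>M lborel)) = ennreal (sqrt (2 * pi))"
proof -
  have inner: "(\<integral>\<^sup>+v. mass_density (u, v) \<partial>lborel) = indicator {0<..<1} u * ennreal (2 / sqrt (1 - u) / sqrt (2 * pi * u))" for u
  proof (cases "u \<in> {0<..<1}")
    case True
    let ?f = "\<lambda>v. 1 / ((v - u) * sqrt (v - u))"
    have "(\<integral>\<^sup>+v. mass_density (u, v) \<partial>lborel) = (\<integral>\<^sup>+v. ennreal (1 / sqrt (2 * pi * u)) * (ennreal (?f v) * indicator {1..} v) \<partial>lborel)"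
    proof (rule nn_integral_cong_AE, use AE_lborel_singleton[of "1::real"] in eventually_elim)
      fix v :: real assume "v \<noteq> 1"
      have "ennreal (?f v / sqrt (2 * pi * u)) = ennreal (1 / sqrt (2 * pi * u)) * ennreal (?f v)"
        using True by (subst ennreal_mult'[symmetric]) (auto simp: mult.commute)
      then show "mass_density (u, v) = ennreal (1 / sqrt (2 * pi * u)) * (ennreal (?f v) * indicator {1..} v)"
        using True \<open>v \<noteq> 1\<close> by (auto simp: mass_density_def indicator_def)
    qed
    also have "\<dots> = ennreal (1 / sqrt (2 * pi * u)) * (\<integral>\<^sup>+v. ennreal (?f v) * indicator {1..} v \<partial>lborel)"
      by (rule nn_integral_cmult) measurable
    also have "(\<integral>\<^sup>+v. ennreal (?f v) * indicator {1..} v \<partial>lborel) = ennreal (0 - (- 2 / sqrt (1 - u)))"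
    proof (rule nn_integral_FTC_atLeast)
      show "((\<lambda>v. - 2 / sqrt (v - u)) has_real_derivative ?f v) (at v)" if "1 \<le> v" for v
      proof -
        have "0 < v - u" using that True by auto
        then show ?thesis
          by (auto intro!: derivative_eq_intros simp: field_simps)
      qed
      show "0 \<le> ?f v" if "1 \<le> v" for v using that True by auto
      have "filterlim (\<lambda>v. sqrt (v - u)) at_top at_top"
        using filterlim_compose[OF sqrt_at_top filterlim_tendsto_add_at_top[OF tendsto_const[of "- u"] filterlim_ident]]
        by (simp add: add.commute)
      then show "((\<lambda>v. - 2 / sqrt (v - u)) \<longlongrightarrow> 0) at_top"
        by (rule real_tendsto_divide_at_top[OF tendsto_const])
    qed measurable
    also have "ennreal (1 / sqrt (2 * pi * u)) * ennreal (0 - (- 2 / sqrt (1 - u))) = ennreal (2 / sqrt (1 - u) / sqrt (2 * pi * u))"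
      using True by (subst ennreal_mult'[symmetric]) (auto simp: mult.commute)
    finally show ?thesis using True by simp
  qed (simp add: mass_density_def)
  have "(\<integral>\<^sup>+x. mass_density x \<partial>(lborel \<Otimes>\<^sub>M lborel)) = (\<integral>\<^sup>+u. indicator {0<..<1} u * ennreal (2 / sqrt (1 - u) / sqrt (2 * pi * u)) \<partial>lborel)"
    by (subst lborel.nn_integral_fst[symmetric]) (simp_all add: inner)
  also have "\<dots> = ennreal (sqrt (2 * pi))"
  proof -
    let ?f = "\<lambda>u. 2 / sqrt (1 - u) / sqrt (2 * pi * u)"
    \<comment> \<open>Arcsine law: with x = 2 u - 1 the product u (1 - u) becomes (1 - x^2) /
      4.\<close>
    let ?F = "\<lambda>u. 2 / sqrt (2 * pi) * arcsin (2 * u - 1)"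
    have D: "(?F has_real_derivative ?f u) (at u)" if u: "0 < u" "u < 1" for u
    proof -
      have "sqrt (1 - (2 * u - 1)\<^sup>2) = sqrt (4 * (u * (1 - u)))"
        by (rule arg_cong[where f=sqrt]) (simp add: power2_eq_square algebra_simps)
      also have "\<dots> = 2 * (sqrt u * sqrt (1 - u))" using u by (simp add: real_sqrt_mult)
      finally have *: "sqrt (1 - (2 * u - 1)\<^sup>2) = 2 * (sqrt u * sqrt (1 - u))" .
      have "((\<lambda>u. arcsin (2 * u - 1)) has_real_derivative inverse (sqrt (1 - (2 * u - 1)\<^sup>2)) * 2) (at u)"
        by (rule DERIV_chain2[OF DERIV_arcsin]) (use u in \<open>auto intro!: derivative_eq_intros\<close>)
      from DERIV_cmult[OF this, of "2 / sqrt (2 * pi)"] show ?thesis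
        unfolding * using u by (simp add: real_sqrt_mult field_simps)
    qed
    have c: "continuous_on {0..1} ?F"
      by (intro continuous_intros continuous_on_arcsin) auto
    have l: "(?F \<longlongrightarrow> ?F 0) (at_right 0)" "(?F \<longlongrightarrow> ?F 1) (at_left 1)"
      using continuous_on_Icc_at_rightD[OF c] continuous_on_Icc_at_leftD[OF c] by auto
    have cont_f: "isCont ?f u" if "0 < u" "u < 1" for u
      using that by (intro continuous_intros) auto
    have "0 \<le> ?f u" if "0 < u" "u < 1" for u using that by simp
    then have "(\<integral>\<^sup>+u. indicator {0<..<1} u * ennreal (?f u) \<partial>lborel) = ennreal (?F 1 - ?F 0)"
      by (intro nn_integral_FTC_Ioo(1)[OF zero_less_one D cont_f _ l])
    moreover have "?F 1 - ?F 0 = sqrt (2 * pi)"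
    proof -
      have "sqrt (2 * pi) * sqrt (2 * pi) = 2 * pi" by simp
      then have "2 * pi / sqrt (2 * pi) = sqrt (2 * pi)" by (simp add: field_simps)
      then show ?thesis by (simp add: field_simps)
    qed
    ultimately show ?thesis by (simp only:)
  qed
  finally show ?thesis .
qed

context standard_brownian_motion
begin

lemma expectation_gauss_sine:
  assumes "0 < s"
  shows "(\<integral>w. indicator {0<..} (W s w) * sin (c * W s w) \<partial>M) = gauss_sine (c * sqrt s)"
proof -
  have "(\<integral>w. indicator {0<..} (W s w) * sin (c * W s w) \<partial>M) =
      (\<integral>z. std_normal_density z * (indicator {0<..} (sqrt s * z) * sin (c * (sqrt s * z))) \<partial>lborel)"
    using expectation_normal[OF distributed_W[OF assms], of "\<lambda>x. indicator {0<..} x * sin (c * x)"] assms by simp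
  also have "\<dots> = gauss_sine (c * sqrt s)" unfolding gauss_sine_def
    using assms by (intro Bochner_Integration.integral_cong) (auto simp: indicator_def zero_less_mult_iff mult.assoc)
  finally show ?thesis .
qed

lemma emeasure_joint:
  assumes "0 < a" "0 < s" "s \<le> 1" "1 \<le> t" "s < t"
  shows "emeasure M (joint a s t) = (\<integral>\<^sup>+x. exc_density a x * indicator ({..<s} \<times> {t<..}) x \<partial>(lborel \<Otimes>\<^sub>M lborel))"
proof -
  let ?x = "\<lambda>n. 2 / (real (Suc n) * pi) * (exp (- ((real (Suc n) * pi / a)\<^sup>2 * (t - s) / 2)) * gauss_sine (real (Suc n) * pi / a * sqrt s))"
  have sums: "?x sums prob (joint a s t)"
    using prob_joint_series[OF assms] by (simp only: expectation_gauss_sine[OF assms(2)])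
  have "0 \<le> ?x n" for n using gauss_sine_nonneg[of "real (Suc n) * pi / a" s] assms by simp
  then have "(\<Sum>n. ennreal (?x n)) = ennreal (\<Sum>n. ?x n)"
    using sums by (intro suminf_ennreal2) (auto simp: sums_iff)
  also have "\<dots> = emeasure M (joint a s t)" using sums by (simp add: sums_iff emeasure_eq_measure)
  finally show ?thesis using exc_density_quadrant[OF assms(1-4)] by simp
qed

definition low_exc :: "real \<Rightarrow> 'a set" where
  "low_exc a = {w\<in>returns. 0 < W 1 w \<and> height w < a}"

lemma low_exc_events [measurable]: "low_exc a \<in> events"
proof -
  have [measurable]: "W 1 \<in> borel_measurable M" by simp
  have "low_exc a = returns \<inter> {w\<in>space M. 0 < W 1 w \<and> height w < a}"
    by (auto simp: low_exc_def returns_def)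
  also have "\<dots> \<in> events" by measurable
  finally show ?thesis .
qed

lemma zeros_around_1:
  assumes "w \<in> returns" "0 < W 1 w"
  shows "left_zero w < 1" "1 < right_zero w"
  using assms last_zero_less_1[OF continuous_on_W_Icc01 start_zero] next_zero_greater_1[OF continuous_on_W_ge1]
  by (auto simp: returns_def right_zero_def)

text \<open>The tails are known only for \<open>0 < s\<close>, \<open>s \<le> 1\<close>,
  \<open>1 \<le> t\<close> and \<open>s < t\<close>. Both measures are carried by u < 1 < v, so an
  arbitrary quadrant can be clipped to this region, and the case s = t = 1 is reached by an
  increasing union.\<close>

lemma emeasure_low_exc:
  assumes a: "0 < a" and B: "B \<in> sets (borel \<Otimes>\<^sub>M borel)"
  shows "emeasure M {w\<in>low_exc a. (left_zero w, right_zero w) \<in> B} = (\<integral>\<^sup>+x. exc_density a x * indicator B x \<partial>(lborel \<Otimes>\<^sub>M lborel))"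
proof -
  let ?L = "lborel \<Otimes>\<^sub>M lborel :: (real \<times> real) measure"
  define N1 where "N1 = distr (density M (indicator (low_exc a))) (borel \<Otimes>\<^sub>M borel) (\<lambda>w. (left_zero w, right_zero w))"
  define N2 where "N2 = density ?L (exc_density a)"
  have space: "low_exc a \<subseteq> space M" by (auto simp: low_exc_def returns_def)
  have N1: "emeasure N1 B = emeasure M {w\<in>low_exc a. (left_zero w, right_zero w) \<in> B}" if B: "B \<in> sets (borel \<Otimes>\<^sub>M borel)" for B
  proof -
    let ?X = "(\<lambda>w. (left_zero w, right_zero w)) -` B \<inter> space M"
    have m: "(\<lambda>w. (left_zero w, right_zero w)) \<in> measurable M (borel \<Otimes>\<^sub>M borel)" by measurable
    have X: "?X \<in> events" by (rule measurable_sets[OF m B])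
    have "emeasure N1 B = emeasure (density M (indicator (low_exc a))) ?X"
      unfolding N1_def using m B by (subst emeasure_distr) auto
    also have "\<dots> = (\<integral>\<^sup>+w. indicator (low_exc a) w * indicator ?X w \<partial>M)"
      using X by (subst emeasure_density) auto
    also have "\<dots> = (\<integral>\<^sup>+w. indicator (low_exc a \<inter> ?X) w \<partial>M)"
      by (simp add: indicator_inter_arith)
    also have "\<dots> = emeasure M (low_exc a \<inter> ?X)" using X by simp
    also have "low_exc a \<inter> ?X = {w\<in>low_exc a. (left_zero w, right_zero w) \<in> B}" using space by auto
    finally show ?thesis .
  qed
  have sL: "sets ?L = sets (borel \<Otimes>\<^sub>M borel)" by (intro sets_pair_measure_cong) auto
  have N2: "emeasure N2 B = (\<integral>\<^sup>+x. exc_density a x * indicator B x \<partial>?L)" if "B \<in> sets (borel \<Otimes>\<^sub>M borel)" for B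
    unfolding N2_def using that sL by (subst emeasure_density) auto
  have "N1 = N2"
  proof (rule quadrant_measure_eqI)
    show "sets N1 = sets (borel \<Otimes>\<^sub>M borel)" "sets N2 = sets (borel \<Otimes>\<^sub>M borel)"
      using sL by (simp_all add: N1_def N2_def)
    show "emeasure N1 A \<noteq> \<infinity>" for A
    proof (cases "A \<in> sets (borel \<Otimes>\<^sub>M borel)")
      case True
      then show ?thesis by (simp add: N1 emeasure_eq_measure)
    next
      case False
      then show ?thesis by (simp add: emeasure_notin_sets N1_def)
    qed
    fix s t :: real
    show "emeasure N1 ({..<s} \<times> {t<..}) = emeasure N2 ({..<s} \<times> {t<..})"
    proof (cases "0 < s")
      case False
      have E: "{w\<in>low_exc a. (left_zero w, right_zero w) \<in> {..<s} \<times> {t<..}} = {}"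
        using False left_zero_range space by force
      have Z: "exc_density a x * indicator ({..<s} \<times> {t<..}) x = 0" for x
        using False by (auto simp: exc_density_def indicator_def split: prod.split)
      have "emeasure N1 ({..<s} \<times> {t<..}) = emeasure M {}"
        unfolding E[symmetric] by (rule N1) simp
      moreover have "emeasure N2 ({..<s} \<times> {t<..}) = (\<integral>\<^sup>+x. 0 \<partial>?L)"
        using N2[of "{..<s} \<times> {t<..}"] unfolding Z by simp
      ultimately show ?thesis by simp
    next
      case True
      define t' where "t' = max 1 t"
      define r where "r k = 1 - 1 / real (Suc (Suc k))" for k
      \<comment> \<open>\<open>q k\<close> increases to \<open>min s 1\<close> and stays below 1, so
        \<open>q k < t'\<close> holds even for \<open>t' = 1\<close>, as
        \<open>emeasure_joint\<close> requires.\<close>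
      define q where "q k = min s 1 * r k" for k
      have r: "0 < r k" "r k < 1" for k by (auto simp: r_def divide_simps)
      have "mono r" unfolding r_def by (intro monoI diff_left_mono divide_left_mono) auto
      then have qm: "mono q" unfolding q_def mono_def using True by (auto intro!: mult_left_mono)
      have q: "0 < q k" "q k < 1" "q k < s" for k
      proof -
        have "min s 1 * r k < min s 1 * 1" using r[of k] True by (intro mult_strict_left_mono) auto
        then show "0 < q k" "q k < 1" "q k < s" using r[of k] True by (auto simp: q_def)
      qed
      have rlim: "r \<longlonglongrightarrow> 1"
        using tendsto_diff[OF tendsto_const[of 1] LIMSEQ_Suc[OF LIMSEQ_Suc[OF lim_const_over_n[of 1]]]]
        unfolding r_def by simp
      have qlim: "q \<longlonglongrightarrow> min s 1" unfolding q_def using tendsto_mult[OF tendsto_const rlim] by simp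
      define U where "U = (\<Union>k. {..<q k} \<times> {t'<..})"
      have Umem: "(u, v) \<in> U \<longleftrightarrow> (u, v) \<in> {..<s} \<times> {t<..}" if "u < 1" "1 < v" for u v
      proof
        assume "(u, v) \<in> U"
        then show "(u, v) \<in> {..<s} \<times> {t<..}" using q by (auto simp: U_def t'_def intro: less_trans)
      next
        assume "(u, v) \<in> {..<s} \<times> {t<..}"
        then have "u < min s 1" "t' < v" using that by (auto simp: t'_def)
        from order_tendstoD(1)[OF qlim this(1)] obtain k where "u < q k"
          by (auto simp: eventually_sequentially)
        then show "(u, v) \<in> U" using \<open>t' < v\<close> by (auto simp: U_def)
      qed
      have Us: "U \<in> sets (borel \<Otimes>\<^sub>M borel)" unfolding U_def by measurable
      have "emeasure N1 ({..<s} \<times> {t<..}) = emeasure N1 U"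
      proof -
        have "{w\<in>low_exc a. (left_zero w, right_zero w) \<in> {..<s} \<times> {t<..}} = {w\<in>low_exc a. (left_zero w, right_zero w) \<in> U}"
          using Umem zeros_around_1 unfolding low_exc_def by blast
        then show ?thesis using Us by (simp add: N1)
      qed
      also have "\<dots> = (SUP k. emeasure N1 ({..<q k} \<times> {t'<..}))"
      proof -
        have "incseq (\<lambda>k. {..<q k} \<times> {t'<..})"
          using qm by (auto simp: incseq_def mono_def intro: less_le_trans)
        then show ?thesis unfolding U_def by (intro SUP_emeasure_incseq[symmetric]) (auto simp: N1_def)
      qed
      also have "\<dots> = (SUP k. emeasure N2 ({..<q k} \<times> {t'<..}))"
      proof (rule SUP_cong[OF refl])
        fix k
        have "{w\<in>low_exc a. (left_zero w, right_zero w) \<in> {..<q k} \<times> {t'<..}} = joint a (q k) t'"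
          by (auto simp: low_exc_def joint_def)
        moreover have "emeasure M (joint a (q k) t') = (\<integral>\<^sup>+x. exc_density a x * indicator ({..<q k} \<times> {t'<..}) x \<partial>?L)"
          using q[of k] by (intro emeasure_joint a) (auto simp: t'_def)
        ultimately show "emeasure N1 ({..<q k} \<times> {t'<..}) = emeasure N2 ({..<q k} \<times> {t'<..})"
          by (simp add: N1 N2)
      qed
      also have "\<dots> = emeasure N2 U"
      proof -
        have "incseq (\<lambda>k. {..<q k} \<times> {t'<..})"
          using qm by (auto simp: incseq_def mono_def intro: less_le_trans)
        then show ?thesis unfolding U_def using sL by (intro SUP_emeasure_incseq) (auto simp: N2_def)
      qed
      also have "\<dots> = emeasure N2 ({..<s} \<times> {t<..})"
      proof -
        have "exc_density a x * indicator U x = exc_density a x * indicator ({..<s} \<times> {t<..}) x" for x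
        proof (cases x)
          case (Pair u v)
          then show ?thesis using Umem[of u v] by (cases "u < 1 \<and> 1 < v") (auto simp: exc_density_def indicator_def)
        qed
        then show ?thesis using Us by (simp add: N2)
      qed
      finally show ?thesis .
    qed
  qed
  then show ?thesis using N1[OF B] N2[OF B] by simp
qed

end

section \<open>Asymptotics\<close>

text \<open>The conditions say that \<open>a\<close> squared agrees with \<epsilon>^2 (v - u) up to
  the factor \<rho>. For the upper bound the smallest admissible \<open>a\<close> enters the
  prefactor and the largest the exponent; the lower bound keeps only the first term, with the two
  roles exchanged.\<close>

lemma
  assumes pos: "0 < \<epsilon>" "0 < a" "0 < \<rho>" and uv: "0 < u" "u < 1" "1 < v"
  shows exc_density_upper: "\<epsilon> * sqrt (v - u) \<le> a \<Longrightarrow> a\<^sup>2 \<le> \<rho> * (\<epsilon>\<^sup>2 * (v - u)) \<Longrightarrow>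
      exc_density a (u, v) \<le> (\<Sum>n. ennreal (pi\<^sup>2 / (2 * \<epsilon> ^ 3) * ((real (Suc n))\<^sup>2 * exp (- ((real (Suc n))\<^sup>2 * (pi\<^sup>2 / (2 * \<epsilon>\<^sup>2 * \<rho>)))))))
        * mass_density (u, v)"
    and exc_density_lower: "a \<le> \<epsilon> * sqrt (v - u) \<Longrightarrow> \<epsilon>\<^sup>2 * (v - u) \<le> \<rho> * a\<^sup>2 \<Longrightarrow>
      ennreal (pi\<^sup>2 / (2 * \<epsilon> ^ 3) * exp (- (pi\<^sup>2 * \<rho> / (2 * \<epsilon>\<^sup>2)))) * mass_density (u, v) \<le> exc_density a (u, v)"
proof -
  define l where "l = v - u"
  define m where "m = 1 / (l * sqrt l) / sqrt (2 * pi * u)"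
  have l: "0 < l" using uv by (simp add: l_def)
  have m0: "0 \<le> m" using l uv by (simp add: m_def)
  have mass: "mass_density (u, v) = ennreal m" using uv by (simp add: mass_density_def l_def m_def)
  let ?N = "\<lambda>n. real (Suc n)"
  let ?T = "\<lambda>n. (?N n * pi / a)\<^sup>2 / (2 * a) * exp (- ((?N n * pi / a)\<^sup>2 * (v - u) / 2)) / sqrt (2 * pi * u)"
  have exc: "exc_density a (u, v) = (\<Sum>n. ennreal (?T n))" using uv by (simp add: exc_density_def)
  have cube: "(\<epsilon> * sqrt l) ^ 3 = \<epsilon> ^ 3 * (l * sqrt l)"
    using l by (simp add: power_mult_distrib power3_eq_cube)
  have T: "?T n = (?N n)\<^sup>2 * pi\<^sup>2 / (2 * a ^ 3) * exp (- ((?N n)\<^sup>2 * (pi\<^sup>2 * l / (2 * a\<^sup>2)))) / sqrt (2 * pi * u)" for n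
  proof -
    have "(?N n * pi / a)\<^sup>2 / (2 * a) = (?N n)\<^sup>2 * pi\<^sup>2 / (2 * a ^ 3)"
      by (simp add: power2_eq_square power3_eq_cube field_simps)
    moreover have "(?N n * pi / a)\<^sup>2 * (v - u) / 2 = (?N n)\<^sup>2 * (pi\<^sup>2 * l / (2 * a\<^sup>2))"
      by (simp add: power_mult_distrib power_divide l_def)
    ultimately show ?thesis by simp
  qed
  \<comment> \<open>The cube of \<open>\<epsilon> * sqrt l\<close> splits off l powr (3 / 2), which
    goes into the mass density.\<close>
  have R: "X / (2 * (\<epsilon> * sqrt l) ^ 3) * y / sqrt (2 * pi * u) = X / (2 * \<epsilon> ^ 3) * y * m" for X y :: real
    unfolding cube m_def by simp
  show "exc_density a (u, v) \<le> (\<Sum>n. ennreal (pi\<^sup>2 / (2 * \<epsilon> ^ 3) * ((?N n)\<^sup>2 * exp (- ((?N n)\<^sup>2 * (pi\<^sup>2 / (2 * \<epsilon>\<^sup>2 * \<rho>)))))))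
        * mass_density (u, v)"
    if a: "\<epsilon> * sqrt (v - u) \<le> a" "a\<^sup>2 \<le> \<rho> * (\<epsilon>\<^sup>2 * (v - u))"
  proof -
    have "?T n \<le> pi\<^sup>2 / (2 * \<epsilon> ^ 3) * ((?N n)\<^sup>2 * exp (- ((?N n)\<^sup>2 * (pi\<^sup>2 / (2 * \<epsilon>\<^sup>2 * \<rho>))))) * m" for n
    proof -
      have "(\<epsilon> * sqrt l) ^ 3 \<le> a ^ 3" using a pos l by (intro power_mono) (auto simp: l_def)
      then have 1: "(?N n)\<^sup>2 * pi\<^sup>2 / (2 * a ^ 3) \<le> (?N n)\<^sup>2 * pi\<^sup>2 / (2 * (\<epsilon> * sqrt l) ^ 3)"
        using pos l by (intro divide_left_mono) auto
      have "pi\<^sup>2 * l / (2 * (\<rho> * (\<epsilon>\<^sup>2 * l))) \<le> pi\<^sup>2 * l / (2 * a\<^sup>2)"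
        using a pos l by (intro divide_left_mono) (auto simp: l_def)
      moreover have "pi\<^sup>2 * l / (2 * (\<rho> * (\<epsilon>\<^sup>2 * l))) = pi\<^sup>2 / (2 * \<epsilon>\<^sup>2 * \<rho>)" using l by simp
      ultimately have "(?N n)\<^sup>2 * (pi\<^sup>2 / (2 * \<epsilon>\<^sup>2 * \<rho>)) \<le> (?N n)\<^sup>2 * (pi\<^sup>2 * l / (2 * a\<^sup>2))"
        by (intro mult_left_mono) auto
      then have 2: "exp (- ((?N n)\<^sup>2 * (pi\<^sup>2 * l / (2 * a\<^sup>2)))) \<le> exp (- ((?N n)\<^sup>2 * (pi\<^sup>2 / (2 * \<epsilon>\<^sup>2 * \<rho>))))" by simp
      have "?T n \<le> (?N n)\<^sup>2 * pi\<^sup>2 / (2 * (\<epsilon> * sqrt l) ^ 3) * exp (- ((?N n)\<^sup>2 * (pi\<^sup>2 / (2 * \<epsilon>\<^sup>2 * \<rho>)))) / sqrt (2 * pi * u)"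
        unfolding T using 1 2 pos l uv by (intro divide_right_mono mult_mono) auto
      then show ?thesis unfolding R by (simp add: mult_ac)
    qed
    then have "exc_density a (u, v) \<le> (\<Sum>n. ennreal (pi\<^sup>2 / (2 * \<epsilon> ^ 3) * ((?N n)\<^sup>2 * exp (- ((?N n)\<^sup>2 * (pi\<^sup>2 / (2 * \<epsilon>\<^sup>2 * \<rho>)))))) * ennreal m)"
      unfolding exc using pos m0 by (intro suminf_le summableI) (subst ennreal_mult'[symmetric], auto intro!: ennreal_leI)
    then show ?thesis unfolding mass by simp
  qed
  show "ennreal (pi\<^sup>2 / (2 * \<epsilon> ^ 3) * exp (- (pi\<^sup>2 * \<rho> / (2 * \<epsilon>\<^sup>2)))) * mass_density (u, v) \<le> exc_density a (u, v)"
    if a: "a \<le> \<epsilon> * sqrt (v - u)" "\<epsilon>\<^sup>2 * (v - u) \<le> \<rho> * a\<^sup>2"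
  proof -
    have "a ^ 3 \<le> (\<epsilon> * sqrt l) ^ 3" using a pos l by (intro power_mono) (auto simp: l_def)
    then have 1: "pi\<^sup>2 / (2 * (\<epsilon> * sqrt l) ^ 3) \<le> pi\<^sup>2 / (2 * a ^ 3)"
      using pos l by (intro divide_left_mono) auto
    have "pi\<^sup>2 * l / (2 * a\<^sup>2) \<le> pi\<^sup>2 * \<rho> / (2 * \<epsilon>\<^sup>2)"
    proof -
      have "pi\<^sup>2 * (\<epsilon>\<^sup>2 * l) \<le> pi\<^sup>2 * (\<rho> * a\<^sup>2)" using a by (intro mult_left_mono) (auto simp: l_def)
      then show ?thesis using pos by (simp add: field_simps)
    qed
    then have 2: "exp (- (pi\<^sup>2 * \<rho> / (2 * \<epsilon>\<^sup>2))) \<le> exp (- (pi\<^sup>2 * l / (2 * a\<^sup>2)))" by simp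
    have "pi\<^sup>2 / (2 * (\<epsilon> * sqrt l) ^ 3) * exp (- (pi\<^sup>2 * \<rho> / (2 * \<epsilon>\<^sup>2))) / sqrt (2 * pi * u) \<le> pi\<^sup>2 / (2 * a ^ 3) * exp (- (pi\<^sup>2 * l / (2 * a\<^sup>2))) / sqrt (2 * pi * u)"
      using 1 2 pos l uv by (intro divide_right_mono mult_mono) auto
    also have "\<dots> = ?T 0" unfolding T by simp
    finally have "pi\<^sup>2 / (2 * \<epsilon> ^ 3) * exp (- (pi\<^sup>2 * \<rho> / (2 * \<epsilon>\<^sup>2))) * m \<le> ?T 0" unfolding R .
    then have "ennreal (pi\<^sup>2 / (2 * \<epsilon> ^ 3) * exp (- (pi\<^sup>2 * \<rho> / (2 * \<epsilon>\<^sup>2)))) * mass_density (u, v) \<le> ennreal (?T 0)"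
      unfolding mass using pos by (subst ennreal_mult'[symmetric]) (auto intro!: ennreal_leI)
    also have "\<dots> \<le> exc_density a (u, v)" unfolding exc
      using sum_le_suminf[of "\<lambda>n. ennreal (?T n)" "{0}"] by (simp add: summableI)
    finally show ?thesis .
  qed
qed

text \<open>The first term is exp (- c). For the others, with k = (n + 2)^2 and c at least 1, k c is
  at least (k - 2) + 2 c; this extracts exp (- 2 c) and leaves the convergent series
  \<open>f\<close>, which does not depend on \<open>c\<close>.\<close>

lemma theta_series_bound:
  obtains R where "0 \<le> R" "\<And>c. 1 \<le> c \<Longrightarrow>
    (\<Sum>n. ennreal ((real (Suc n))\<^sup>2 * exp (- ((real (Suc n))\<^sup>2 * c)))) \<le> ennreal (exp (- c) + R * exp (- (2 * c)))"
proof -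
  define f where "f n = (real n + 2)\<^sup>2 * exp (- ((real n + 2)\<^sup>2 - 2))" for n
  \<comment> \<open>Since exp x is at least x^2 / 2 and k - 2 is at least k / 2, exp (k - 2) is at
    least k^2 / 8.\<close>
  have fb: "f n \<le> 8 * (1 / (real (Suc n))\<^sup>2)" for n
  proof -
    define k where "k = (real n + 2)\<^sup>2"
    have k4: "4 \<le> k" unfolding k_def using power_mono[of 2 "real n + 2" 2] by simp
    have "(k / 2)\<^sup>2 \<le> (k - 2)\<^sup>2" using k4 by (intro power_mono) auto
    then have "k\<^sup>2 / 8 \<le> (k - 2)\<^sup>2 / 2" by (simp add: power_divide)
    also have "\<dots> \<le> exp (k - 2)" using exp_lower_Taylor_quadratic[of "k - 2"] k4 by simp
    finally have e: "k\<^sup>2 / 8 \<le> exp (k - 2)" .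
    have "k * exp (- (k - 2)) = k / exp (k - 2)" by (simp add: exp_minus divide_inverse del: minus_diff_eq)
    also have "\<dots> \<le> k / (k\<^sup>2 / 8)" using e k4 by (intro divide_left_mono) auto
    also have "\<dots> = 8 / k" using k4 by (simp add: power2_eq_square)
    also have "\<dots> \<le> 8 / (real (Suc n))\<^sup>2" unfolding k_def by (intro divide_left_mono power_mono) auto
    finally show ?thesis by (simp add: f_def k_def)
  qed
  have f0: "0 \<le> f n" for n by (simp add: f_def)
  have "summable (\<lambda>n. 1 / (real (Suc n))\<^sup>2)"
    using inverse_power_summable[of 2, where 'a=real] by (subst summable_Suc_iff) (simp_all add: divide_inverse)
  then have "summable (\<lambda>n. 8 * (1 / (real (Suc n))\<^sup>2))" by (rule summable_mult)
  then have fs: "summable f"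
    by (rule summable_comparison_test') (use fb f0 in auto)
  show thesis
  proof (rule that[of "suminf f"])
    show "0 \<le> suminf f" using fs f0 by (rule suminf_nonneg)
    fix c :: real assume c: "1 \<le> c"
    let ?g = "\<lambda>n. (real (Suc n))\<^sup>2 * exp (- ((real (Suc n))\<^sup>2 * c))"
    have g: "?g (Suc n) \<le> f n * exp (- (2 * c))" for n
    proof -
      define k where "k = (real n + 2)\<^sup>2"
      have k4: "4 \<le> k" unfolding k_def using power_mono[of 2 "real n + 2" 2] by simp
      have "(k - 2) * 1 \<le> (k - 2) * c" using c k4 by (intro mult_left_mono) auto
      then have "- (k * c) \<le> - (k - 2) + - (2 * c)" by (simp add: algebra_simps)
      then have "exp (- (k * c)) \<le> exp (- (k - 2)) * exp (- (2 * c))" unfolding exp_add[symmetric] by simp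
      then have "k * exp (- (k * c)) \<le> k * (exp (- (k - 2)) * exp (- (2 * c)))" using k4 by (intro mult_left_mono) auto
      moreover have "(real (Suc (Suc n)))\<^sup>2 = k" by (simp add: k_def add.commute)
      ultimately show ?thesis unfolding f_def k_def[symmetric] by (simp del: of_nat_Suc add: mult.assoc)
    qed
    have fs': "summable (\<lambda>n. f n * exp (- (2 * c)))" using fs by (rule summable_mult2)
    have gs': "summable (\<lambda>n. ?g (Suc n))"
      by (rule summable_comparison_test'[OF fs']) (use g in auto)
    then have gs: "summable ?g" by (subst (asm) summable_Suc_iff)
    have "suminf ?g = ?g 0 + (\<Sum>n. ?g (Suc n))" using suminf_split_head[OF gs] by simp
    also have "(\<Sum>n. ?g (Suc n)) \<le> (\<Sum>n. f n * exp (- (2 * c)))" using g gs' fs' by (rule suminf_le)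
    also have "\<dots> = suminf f * exp (- (2 * c))" using suminf_mult2[OF fs] by simp
    finally have "suminf ?g \<le> exp (- c) + suminf f * exp (- (2 * c))" by simp
    moreover have "(\<Sum>n. ennreal (?g n)) = ennreal (suminf ?g)" using gs by (intro suminf_ennreal2) auto
    ultimately show "(\<Sum>n. ennreal (?g n)) \<le> ennreal (exp (- c) + suminf f * exp (- (2 * c)))"
      by (simp add: ennreal_leI)
  qed
qed

section \<open>Geometric cells of the excursion length\<close>

lemma log_cell:
  assumes "1 < \<rho>" "0 < l" "\<lfloor>log \<rho> l\<rfloor> = k"
  shows "\<rho> powr of_int k \<le> l" "l < \<rho> * \<rho> powr of_int k"
proof -
  have "of_int k \<le> log \<rho> l" using assms(3) by linarith
  then show "\<rho> powr of_int k \<le> l" using assms by (simp add: le_log_iff)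
  have "log \<rho> l < of_int k + 1" using assms(3) by linarith
  then have "l < \<rho> powr (of_int k + 1)" using assms by (simp add: log_less_iff)
  then show "l < \<rho> * \<rho> powr of_int k" using assms by (simp add: powr_add mult.commute)
qed

context standard_brownian_motion
begin

text \<open>The event of the theorem for excursions above 0, with the normalizing square root
  multiplied out.\<close>

definition small_exc :: "real \<Rightarrow> 'a set" where
  "small_exc \<epsilon> = {w\<in>returns. 0 < W 1 w \<and> height w \<le> \<epsilon> * sqrt (right_zero w - left_zero w)}"

lemma small_exc_events [measurable]: "small_exc \<epsilon> \<in> events"
proof -
  have [measurable]: "W 1 \<in> borel_measurable M" by simp
  have "small_exc \<epsilon> = returns \<inter> {w\<in>space M. 0 < W 1 w \<and> height w \<le> \<epsilon> * sqrt (right_zero w - left_zero w)}"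
    by (auto simp: small_exc_def returns_def)
  also have "\<dots> \<in> events" by measurable
  finally show ?thesis .
qed

text \<open>
  Cutting the range of the excursion length \<open>l\<close> into the cells \<open>\<rho>\<^sup>k \<le> l < \<rho>\<^sup>k\<^sup>+\<^sup>1\<close> replaces the random threshold
  \<open>\<epsilon> * sqrt l\<close> by deterministic ones; the error disappears when \<open>\<rho>\<close> tends to 1.
\<close>

lemma
  assumes \<rho>: "1 < \<rho>" and \<epsilon>: "0 < \<epsilon>"
  shows small_exc_upper: "emeasure M (small_exc \<epsilon>) \<le>
      (\<Sum>n. ennreal (pi\<^sup>2 / (2 * \<epsilon> ^ 3) * ((real (Suc n))\<^sup>2 * exp (- ((real (Suc n))\<^sup>2 * (pi\<^sup>2 / (2 * \<epsilon>\<^sup>2 * \<rho>)))))))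
        * ennreal (sqrt (2 * pi))"
    and small_exc_lower: "ennreal (pi\<^sup>2 / (2 * \<epsilon> ^ 3) * exp (- (pi\<^sup>2 * \<rho> / (2 * \<epsilon>\<^sup>2)))) * ennreal (sqrt (2 * pi)) \<le> emeasure M (small_exc \<epsilon>)"
proof -
  let ?L = "lborel \<Otimes>\<^sub>M lborel :: (real \<times> real) measure"
  let ?z = "\<lambda>w. (left_zero w, right_zero w)"
  \<comment> \<open>Integer parts of the logarithm give countably many disjoint cells covering all
    positive lengths, so both masses become integrals over the counting measure.\<close>
  define cell where "cell k = {x :: real \<times> real. fst x < 1 \<and> 1 < snd x \<and> \<lfloor>log \<rho> (snd x - fst x)\<rfloor> = k}" for k
  have sL: "sets ?L = sets (borel \<Otimes>\<^sub>M borel)" by (intro sets_pair_measure_cong) auto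
  have cell: "cell k \<in> sets (borel \<Otimes>\<^sub>M borel)" for k
  proof -
    have "{x \<in> space (borel \<Otimes>\<^sub>M borel :: (real \<times> real) measure). fst x < 1 \<and> 1 < snd x \<and> \<lfloor>log \<rho> (snd x - fst x)\<rfloor> = k} \<in> sets (borel \<Otimes>\<^sub>M borel)"
      by measurable
    then show ?thesis by (simp add: cell_def space_pair_measure)
  qed
  have disj: "disjoint_family cell" by (auto simp: disjoint_family_on_def cell_def)
  define X where "X k = {w\<in>small_exc \<epsilon>. ?z w \<in> cell k}" for k
  have zm: "?z \<in> measurable M (borel \<Otimes>\<^sub>M borel)" by measurable
  have X: "X k \<in> events" for k
  proof -
    have "X k = small_exc \<epsilon> \<inter> (?z -` cell k \<inter> space M)" by (auto simp: X_def small_exc_def returns_def)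
    then show ?thesis using measurable_sets[OF zm cell] by auto
  qed
  have UX: "small_exc \<epsilon> = (\<Union>k. X k)"
    using zeros_around_1 by (auto simp: X_def cell_def small_exc_def)
  have EX: "emeasure M (small_exc \<epsilon>) = (\<integral>\<^sup>+k. emeasure M (X k) \<partial>count_space UNIV)"
    unfolding UX by (rule emeasure_UN_countable) (use X in \<open>auto simp: X_def disjoint_family_on_def cell_def\<close>)
  define \<Psi> where "\<Psi> = density ?L mass_density"
  have \<Psi>: "emeasure \<Psi> B = (\<integral>\<^sup>+x. mass_density x * indicator B x \<partial>?L)" if "B \<in> sets (borel \<Otimes>\<^sub>M borel)" for B
    unfolding \<Psi>_def using that sL by (subst emeasure_density) auto
  have total: "(\<integral>\<^sup>+k. emeasure \<Psi> (cell k) \<partial>count_space UNIV) = ennreal (sqrt (2 * pi))"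
  proof -
    have "(\<integral>\<^sup>+k. emeasure \<Psi> (cell k) \<partial>count_space UNIV) = emeasure \<Psi> (\<Union>k. cell k)"
      by (rule emeasure_UN_countable[symmetric]) (use cell disj sL in \<open>auto simp: \<Psi>_def\<close>)
    also have "\<dots> = (\<integral>\<^sup>+x. mass_density x * indicator (\<Union>k. cell k) x \<partial>?L)"
      using cell by (intro \<Psi> sets.countable_UN') auto
    also have "\<dots> = (\<integral>\<^sup>+x. mass_density x \<partial>?L)"
      by (intro nn_integral_cong) (auto simp: mass_density_def cell_def indicator_def split: prod.split)
    finally show ?thesis by (simp add: nn_integral_mass_density)
  qed
  define p where "p k = \<rho> powr of_int k" for k :: int
  have p: "0 < p k" for k using \<rho> by (simp add: p_def)
  have len: "p k \<le> v - u" "v - u < \<rho> * p k" if "(u, v) \<in> cell k" for u v k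
    using that log_cell[OF \<rho>, of "v - u" k] by (auto simp: cell_def p_def)
  have mass0: "mass_density (u, v) = 0" "exc_density a (u, v) = 0" if "\<not> 0 < u" for a u v
    using that by (auto simp: mass_density_def exc_density_def)
  show "emeasure M (small_exc \<epsilon>) \<le>
      (\<Sum>n. ennreal (pi\<^sup>2 / (2 * \<epsilon> ^ 3) * ((real (Suc n))\<^sup>2 * exp (- ((real (Suc n))\<^sup>2 * (pi\<^sup>2 / (2 * \<epsilon>\<^sup>2 * \<rho>)))))))
        * ennreal (sqrt (2 * pi))" (is "_ \<le> ?B * _")
  proof -
    have "emeasure M (X k) \<le> ?B * emeasure \<Psi> (cell k)" for k
    proof -
      \<comment> \<open>The threshold at the upper end of the cell. It strictly exceeds the random
        threshold on the cell, which provides the strict inequality in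
        \<open>low_exc\<close>.\<close>
      define a where "a = \<epsilon> * sqrt (\<rho> * p k)"
      have a: "0 < a" "a\<^sup>2 = \<epsilon>\<^sup>2 * (\<rho> * p k)" using \<epsilon> \<rho> p[of k] by (auto simp: a_def power_mult_distrib)
      have "X k \<subseteq> {w\<in>low_exc a. ?z w \<in> cell k}"
      proof
        fix w assume w: "w \<in> X k"
        then have "?z w \<in> cell k" by (simp add: X_def)
        from len(2)[OF this] have "\<epsilon> * sqrt (right_zero w - left_zero w) < a"
          unfolding a_def using \<epsilon> by (intro mult_strict_left_mono real_sqrt_less_mono)
        then show "w \<in> {w\<in>low_exc a. ?z w \<in> cell k}" using w by (auto simp: X_def small_exc_def low_exc_def)
      qed
      moreover have "{w\<in>low_exc a. ?z w \<in> cell k} \<in> events"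
      proof -
        have "{w\<in>low_exc a. ?z w \<in> cell k} = low_exc a \<inter> (?z -` cell k \<inter> space M)" by (auto simp: low_exc_def returns_def)
        then show ?thesis using measurable_sets[OF zm cell] by auto
      qed
      ultimately have "emeasure M (X k) \<le> emeasure M {w\<in>low_exc a. ?z w \<in> cell k}" by (rule emeasure_mono)
      also have "\<dots> = (\<integral>\<^sup>+x. exc_density a x * indicator (cell k) x \<partial>?L)" by (rule emeasure_low_exc[OF a(1) cell])
      also have "\<dots> \<le> (\<integral>\<^sup>+x. ?B * (mass_density x * indicator (cell k) x) \<partial>?L)"
      proof (intro nn_integral_mono)
        fix x show "exc_density a x * indicator (cell k) x \<le> ?B * (mass_density x * indicator (cell k) x)"
        proof (cases "x \<in> cell k \<and> 0 < fst x")
          case True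
          obtain u v where x: "x = (u, v)" by (cases x)
          have uv: "0 < u" "u < 1" "1 < v" and c: "(u, v) \<in> cell k" using True by (auto simp: x cell_def)
          have "\<epsilon> * sqrt (v - u) \<le> a" unfolding a_def using \<epsilon> len[OF c] by (intro mult_left_mono) auto
          moreover have "a\<^sup>2 \<le> \<rho> * (\<epsilon>\<^sup>2 * (v - u))" using mult_left_mono[OF len(1)[OF c], of "\<rho> * \<epsilon>\<^sup>2"] \<rho> by (simp add: a(2) mult_ac)
          ultimately have "exc_density a (u, v) \<le> ?B * mass_density (u, v)"
            using \<rho> by (intro exc_density_upper \<epsilon> a(1) uv) auto
          then show ?thesis using c by (simp add: x)
        next
          case False
          then show ?thesis using mass0 by (cases x) auto
        qed
      qed
      also have "\<dots> = ?B * (\<integral>\<^sup>+x. mass_density x * indicator (cell k) x \<partial>?L)"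
        using cell[of k] sL by (intro nn_integral_cmult) auto
      finally show ?thesis by (simp only: \<Psi>[OF cell])
    qed
    then have "emeasure M (small_exc \<epsilon>) \<le> (\<integral>\<^sup>+k. ?B * emeasure \<Psi> (cell k) \<partial>count_space UNIV)"
      unfolding EX by (intro nn_integral_mono)
    also have "\<dots> = ?B * ennreal (sqrt (2 * pi))" by (subst nn_integral_cmult) (auto simp: total)
    finally show ?thesis .
  qed
  show "ennreal (pi\<^sup>2 / (2 * \<epsilon> ^ 3) * exp (- (pi\<^sup>2 * \<rho> / (2 * \<epsilon>\<^sup>2)))) * ennreal (sqrt (2 * pi)) \<le> emeasure M (small_exc \<epsilon>)" (is "?B * _ \<le> _")
  proof -
    have "?B * emeasure \<Psi> (cell k) \<le> emeasure M (X k)" for k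
    proof -
      \<comment> \<open>The threshold at the lower end of the cell, at most the random one, so the
        inclusion of events is reversed.\<close>
      define a where "a = \<epsilon> * sqrt (p k)"
      have a: "0 < a" "a\<^sup>2 = \<epsilon>\<^sup>2 * p k" using \<epsilon> p[of k] by (auto simp: a_def power_mult_distrib)
      have "?B * emeasure \<Psi> (cell k) = (\<integral>\<^sup>+x. ?B * (mass_density x * indicator (cell k) x) \<partial>?L)"
        unfolding \<Psi>[OF cell] using cell[of k] sL by (intro nn_integral_cmult[symmetric]) auto
      also have "\<dots> \<le> (\<integral>\<^sup>+x. exc_density a x * indicator (cell k) x \<partial>?L)"
      proof (intro nn_integral_mono)
        fix x show "?B * (mass_density x * indicator (cell k) x) \<le> exc_density a x * indicator (cell k) x"
        proof (cases "x \<in> cell k \<and> 0 < fst x")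
          case True
          obtain u v where x: "x = (u, v)" by (cases x)
          have uv: "0 < u" "u < 1" "1 < v" and c: "(u, v) \<in> cell k" using True by (auto simp: x cell_def)
          have "a \<le> \<epsilon> * sqrt (v - u)" unfolding a_def using \<epsilon> len[OF c] by (intro mult_left_mono) auto
          moreover have "\<epsilon>\<^sup>2 * (v - u) \<le> \<rho> * a\<^sup>2" using mult_left_mono[OF less_imp_le[OF len(2)[OF c]], of "\<epsilon>\<^sup>2"] by (simp add: a(2) mult_ac)
          ultimately have "?B * mass_density (u, v) \<le> exc_density a (u, v)"
            using \<rho> by (intro exc_density_lower \<epsilon> a(1) uv) auto
          then show ?thesis using c by (simp add: x)
        next
          case False
          then show ?thesis using mass0 by (cases x) auto
        qed
      qed
      also have "\<dots> = emeasure M {w\<in>low_exc a. ?z w \<in> cell k}" by (rule emeasure_low_exc[OF a(1) cell, symmetric])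
      also have "\<dots> \<le> emeasure M (X k)"
      proof (rule emeasure_mono[OF _ X], rule subsetI)
        fix w assume w: "w \<in> {w\<in>low_exc a. ?z w \<in> cell k}"
        then have "?z w \<in> cell k" by simp
        from len(1)[OF this] have "a \<le> \<epsilon> * sqrt (right_zero w - left_zero w)"
          unfolding a_def using \<epsilon> by (intro mult_left_mono) auto
        then show "w \<in> X k" using w by (auto simp: X_def small_exc_def low_exc_def)
      qed
      finally show ?thesis .
    qed
    then have "(\<integral>\<^sup>+k. ?B * emeasure \<Psi> (cell k) \<partial>count_space UNIV) \<le> emeasure M (small_exc \<epsilon>)"
      unfolding EX by (intro nn_integral_mono)
    also have "(\<integral>\<^sup>+k. ?B * emeasure \<Psi> (cell k) \<partial>count_space UNIV) = ?B * ennreal (sqrt (2 * pi))" by (subst nn_integral_cmult) (auto simp: total)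
    finally show ?thesis .
  qed
qed

text \<open>The cell bounds hold for every ratio \<rho> > 1, with \<open>c\<close> replaced by c
  \<rho> below and c / \<rho> above. Both expressions are continuous at \<rho> = 1.\<close>

lemma prob_small_exc_bounds:
  assumes \<epsilon>: "0 < \<epsilon>" "\<epsilon> \<le> 1" and R: "0 \<le> R" "\<And>c. 1 \<le> c \<Longrightarrow>
    (\<Sum>n. ennreal ((real (Suc n))\<^sup>2 * exp (- ((real (Suc n))\<^sup>2 * c)))) \<le> ennreal (exp (- c) + R * exp (- (2 * c)))"
  defines "K \<equiv> pi\<^sup>2 / (2 * \<epsilon> ^ 3) * sqrt (2 * pi)" and "c \<equiv> pi\<^sup>2 / (2 * \<epsilon>\<^sup>2)"
  shows "K * exp (- c) \<le> prob (small_exc \<epsilon>)" "prob (small_exc \<epsilon>) \<le> K * (exp (- c) + R * exp (- (2 * c)))"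
proof -
  have lower: "K * exp (- (c * \<rho>)) \<le> prob (small_exc \<epsilon>)" if \<rho>: "1 < \<rho>" for \<rho>
  proof -
    have "ennreal (pi\<^sup>2 / (2 * \<epsilon> ^ 3) * exp (- (pi\<^sup>2 * \<rho> / (2 * \<epsilon>\<^sup>2)))) * ennreal (sqrt (2 * pi)) = ennreal (K * exp (- (c * \<rho>)))"
      using \<epsilon> by (subst ennreal_mult'[symmetric]) (auto simp: K_def c_def mult_ac)
    with small_exc_lower[OF \<rho> \<epsilon>(1)] show ?thesis by (simp add: emeasure_eq_measure)
  qed
  have upper: "prob (small_exc \<epsilon>) \<le> K * (exp (- (c / \<rho>)) + R * exp (- (2 * (c / \<rho>))))" if \<rho>: "1 < \<rho>" "\<rho> \<le> 2" for \<rho>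
  proof -
    have c\<rho>: "pi\<^sup>2 / (2 * \<epsilon>\<^sup>2 * \<rho>) = c / \<rho>" by (simp add: c_def)
    \<comment> \<open>The bounds on \<open>\<epsilon>\<close> and \<open>\<rho>\<close> keep c /
      \<rho> at least pi^2 / 4, hence at least 1, as the theta bound demands.\<close>
    have "\<epsilon>\<^sup>2 \<le> 1" using \<epsilon> by (simp add: power_le_one)
    then have "2 * \<epsilon>\<^sup>2 * \<rho> \<le> 2 * 1 * 2" using \<rho> by (intro mult_mono) auto
    also have "\<dots> \<le> pi\<^sup>2" using power_mono[OF pi_ge_two, of 2] by simp
    finally have c1: "1 \<le> c / \<rho>" unfolding c\<rho>[symmetric] using \<epsilon> \<rho> by simp
    have "emeasure M (small_exc \<epsilon>) \<le> ennreal (pi\<^sup>2 / (2 * \<epsilon> ^ 3)) * (\<Sum>n. ennreal ((real (Suc n))\<^sup>2 * exp (- ((real (Suc n))\<^sup>2 * (c / \<rho>))))) * ennreal (sqrt (2 * pi))"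
      using small_exc_upper[OF \<rho>(1) \<epsilon>(1)] \<epsilon> unfolding c\<rho> by (subst (asm) ennreal_mult') (auto simp del: of_nat_Suc)
    also have "\<dots> \<le> ennreal (pi\<^sup>2 / (2 * \<epsilon> ^ 3)) * ennreal (exp (- (c / \<rho>)) + R * exp (- (2 * (c / \<rho>)))) * ennreal (sqrt (2 * pi))"
      by (intro mult_left_mono mult_right_mono R(2) c1) auto
    also have "\<dots> = ennreal (K * (exp (- (c / \<rho>)) + R * exp (- (2 * (c / \<rho>)))))"
    proof -
      have mult3: "ennreal x * ennreal y * ennreal z = ennreal (x * y * z)" if "0 \<le> x" "0 \<le> y" for x y z
        using that by (simp add: ennreal_mult')
      have "ennreal (pi\<^sup>2 / (2 * \<epsilon> ^ 3)) * ennreal (exp (- (c / \<rho>)) + R * exp (- (2 * (c / \<rho>)))) * ennreal (sqrt (2 * pi)) =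
          ennreal (pi\<^sup>2 / (2 * \<epsilon> ^ 3) * (exp (- (c / \<rho>)) + R * exp (- (2 * (c / \<rho>)))) * sqrt (2 * pi))"
        by (rule mult3) (use \<epsilon> R(1) in auto)
      also have "pi\<^sup>2 / (2 * \<epsilon> ^ 3) * (exp (- (c / \<rho>)) + R * exp (- (2 * (c / \<rho>)))) * sqrt (2 * pi) = K * (exp (- (c / \<rho>)) + R * exp (- (2 * (c / \<rho>))))"
        by (simp add: K_def)
      finally show ?thesis .
    qed
    finally show ?thesis using R(1) \<epsilon> by (simp add: emeasure_eq_measure K_def)
  qed
  have ev: "\<forall>\<^sub>F \<rho> in at_right 1. \<rho> \<in> {1<..<2::real}" by (rule eventually_at_right_real) simp
  have "((\<lambda>\<rho>. K * exp (- (c * \<rho>))) \<longlongrightarrow> K * exp (- (c * 1))) (at_right 1)"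
    by (intro tendsto_intros)
  then have "((\<lambda>\<rho>. K * exp (- (c * \<rho>))) \<longlongrightarrow> K * exp (- c)) (at_right 1)" by simp
  then show "K * exp (- c) \<le> prob (small_exc \<epsilon>)"
  proof (rule tendsto_upperbound)
    show "\<forall>\<^sub>F \<rho> in at_right 1. K * exp (- (c * \<rho>)) \<le> prob (small_exc \<epsilon>)"
      using ev by eventually_elim (rule lower, simp)
  qed simp
  have "((\<lambda>\<rho>. K * (exp (- (c / \<rho>)) + R * exp (- (2 * (c / \<rho>))))) \<longlongrightarrow> K * (exp (- (c / 1)) + R * exp (- (2 * (c / 1))))) (at_right 1)"
    by (intro tendsto_intros) auto
  then have "((\<lambda>\<rho>. K * (exp (- (c / \<rho>)) + R * exp (- (2 * (c / \<rho>))))) \<longlongrightarrow> K * (exp (- c) + R * exp (- (2 * c)))) (at_right 1)" by simp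
  then show "prob (small_exc \<epsilon>) \<le> K * (exp (- c) + R * exp (- (2 * c)))"
  proof (rule tendsto_lowerbound)
    show "\<forall>\<^sub>F \<rho> in at_right 1. prob (small_exc \<epsilon>) \<le> K * (exp (- (c / \<rho>)) + R * exp (- (2 * (c / \<rho>))))"
      using ev by eventually_elim (rule upper, simp_all)
  qed simp
qed

text \<open>Recurrence follows from the ruin identity with s = t = 1 and barrier k + 1: hitting 0
  before the barrier is part of \<open>returns\<close>, and its probability tends to that of
  \<open>0 < W 1\<close> as the barrier goes to infinity.\<close>

lemma AE_returns: "AE w in M. 0 < W 1 w \<longrightarrow> w \<in> returns"
proof -
  have [measurable]: "W 1 \<in> borel_measurable M" by simp
  define P where "P = {w\<in>space M. 0 < W 1 w}"
  have P [measurable]: "P \<in> events" unfolding P_def by measurable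
  define A where "A k = left_low (real (Suc k)) 1 \<inter> stays {0<..<real (Suc k)} 1 1" for k
  have A [measurable]: "A k \<in> events" for k
    using left_low_past[of "real (Suc k)" 1 0] sets_past_events stays_events[of "{0<..<real (Suc k)}" 1 1]
    unfolding A_def by (intro sets.Int) auto
  have Ain: "0 < W 1 w" "W 1 w < real (Suc k)" "w \<in> space M" if "w \<in> A k" for k w
    using that by (auto simp: A_def stays_def)
  have "(\<integral>w. indicator (A k) w * (1 - W 1 w / real (Suc k)) \<partial>M) \<le> prob (P \<inter> returns)" for k
  proof -
    have "(\<integral>w. indicator (A k) w * (1 - W 1 w / real (Suc k)) \<partial>M) = prob (joint (real (Suc k)) 1 1)"
      using prob_joint_eq_integral[of "real (Suc k)" 1 1] by (simp add: A_def)
    also have "\<dots> \<le> prob (P \<inter> returns)"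
    proof (rule finite_measure_mono)
      show "joint (real (Suc k)) 1 1 \<subseteq> P \<inter> returns" by (auto simp: joint_def P_def returns_def)
    qed measurable
    finally show ?thesis .
  qed
  moreover have "(\<lambda>k. \<integral>w. indicator (A k) w * (1 - W 1 w / real (Suc k)) \<partial>M) \<longlonglongrightarrow> (\<integral>w. indicator P w \<partial>M)"
  proof (rule integral_dominated_convergence[where w="\<lambda>_. 1"])
    show "AE w in M. (\<lambda>k. indicator (A k) w * (1 - W 1 w / real (Suc k))) \<longlonglongrightarrow> indicator P w"
    proof (rule AE_I2)
      fix w assume wM: "w \<in> space M"
      show "(\<lambda>k. indicator (A k) w * (1 - W 1 w / real (Suc k))) \<longlonglongrightarrow> indicator P w"
      proof (cases "w \<in> P")
        case False
        then have "w \<notin> A k" for k using Ain[of w k] by (auto simp: P_def)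
        then show ?thesis using False by simp
      next
        case True
        then have pos: "0 < W 1 w" by (simp add: P_def)
        note lz = continuous_on_W_Icc01[OF wM] start_zero[OF wM]
        \<comment> \<open>The path is bounded on \<open>[0, 1]\<close> and thus belongs to
          \<open>A k\<close> for all large \<open>k\<close>.\<close>
        obtain y where y: "y \<in> {0..1}" "\<And>r. r \<in> {0..1} \<Longrightarrow> W r w \<le> W y w"
          using continuous_attains_sup[OF _ _ lz(1)] by auto
        obtain N :: nat where N: "W y w < real N" using reals_Archimedean2 by blast
        have "w \<in> A k" if "N \<le> k" for k
        proof -
          have "W r w < real (Suc k)" if "r \<in> {0..1}" for r using y(2)[OF that] N \<open>N \<le> k\<close> by simp
          then show ?thesis using pos wM left_zero_range[OF wM] last_zero_less_1[OF lz pos]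
            by (auto simp: A_def left_low_def stays_def simp del: of_nat_Suc)
        qed
        then have ev: "\<forall>\<^sub>F k in sequentially. indicator (A k) w * (1 - W 1 w / real (Suc k)) = 1 - W 1 w / real (Suc k)"
          unfolding eventually_sequentially by (intro exI[of _ N]) simp
        have "(\<lambda>k. 1 - W 1 w / real (Suc k)) \<longlonglongrightarrow> 1 - 0"
          by (intro tendsto_diff tendsto_const LIMSEQ_Suc[OF lim_const_over_n])
        then show ?thesis using True by (subst tendsto_cong[OF ev]) simp
      qed
    qed
    show "AE w in M. norm (indicator (A k) w * (1 - W 1 w / real (Suc k))) \<le> 1" for k
    proof (rule AE_I2)
      fix w
      show "norm (indicator (A k) w * (1 - W 1 w / real (Suc k))) \<le> 1"
      proof (cases "w \<in> A k")
        case True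
        from Ain[OF this] have "0 \<le> W 1 w / real (Suc k)" "W 1 w / real (Suc k) \<le> 1" by simp_all
        then show ?thesis using True by (simp del: of_nat_Suc)
      qed simp
    qed
  qed auto
  ultimately have "(\<integral>w. indicator P w \<partial>M) \<le> prob (P \<inter> returns)"
    by (intro LIMSEQ_le_const2) auto
  then have "prob P \<le> prob (P \<inter> returns)" by simp
  then have "prob (P - returns) \<le> 0" by (simp add: finite_measure_Diff')
  then have "prob (P - returns) = 0" by (simp add: antisym)
  then have "emeasure M (P - returns) = 0" by (simp add: emeasure_eq_measure)
  then show ?thesis
    by (rule AE_I[rotated 1]) (auto simp: P_def)
qed

section \<open>Null events, normalization and the reflected motion\<close>

lemma AE_W_nonzero: "AE w in M. W 1 w \<noteq> 0"
proof -
  have "emeasure M (W 1 -` {0} \<inter> space M) = (\<integral>\<^sup>+x. ennreal (normal_density 0 (sqrt 1) x) * indicator {0} x \<partial>lborel)"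
    by (rule distributed_emeasure[OF distributed_W]) auto
  also have "\<dots> = 0" by (simp add: nn_integral_indicator_singleton)
  finally show ?thesis
    by (intro AE_I[of _ _ "W 1 -` {0} \<inter> space M"]) (auto intro: measurable_sets)
qed

lemma path_max_excursion:
  assumes w: "w \<in> space M"
  shows "path_max (brownian_excursion (\<lambda>t. W t w)) = (if w \<in> returns then height w / sqrt (right_zero w - left_zero w) else 0)"
proof (cases "w \<in> returns")
  case False
  then have "brownian_excursion (\<lambda>t. W t w) = (\<lambda>_. 0)"
    using w by (auto simp: fun_eq_iff brownian_excursion_def returns_def Let_def)
  then show ?thesis using False by (simp add: path_max_def)
next
  case True
  let ?f = "\<lambda>u. \<bar>W (left_zero w + u * (right_zero w - left_zero w)) w\<bar>"
  let ?c = "sqrt (right_zero w - left_zero w)"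
  have exc: "brownian_excursion (\<lambda>t. W t w) = (\<lambda>u. ?f u / ?c)"
    using True by (auto simp: fun_eq_iff brownian_excursion_def returns_def right_zero_def Let_def)
  obtain u where u: "u \<in> {0..1}" "height w = ?f u" "\<And>x. x \<in> {0..1} \<Longrightarrow> ?f x \<le> height w"
    using height_attained[OF w] by blast
  have c: "0 \<le> ?c" using left_zero_range[OF w] right_zero_ge[of w] by simp
  have "path_max (brownian_excursion (\<lambda>t. W t w)) = ?f u / ?c"
    unfolding path_max_def exc
  proof (rule cSup_eq_maximum)
    show "?f u / ?c \<in> (\<lambda>u. ?f u / ?c) ` {0..1}" using u(1) by blast
    fix y assume "y \<in> (\<lambda>u. ?f u / ?c) ` {0..1}"
    then show "y \<le> ?f u / ?c" using u c by (auto intro!: divide_right_mono)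
  qed
  then show ?thesis using True u(2) by simp
qed

end

text \<open>Reflection covers \<open>W 1 < 0\<close>: the zeros and the height are unchanged while
  the sign condition flips.\<close>

lemma standard_brownian_motion_uminus:
  assumes "standard_brownian_motion M W"
  shows "standard_brownian_motion M (\<lambda>t w. - W t w)"
proof -
  interpret standard_brownian_motion M W by fact
  show ?thesis
  proof
    show "- W 0 w = 0" if "w \<in> space M" for w using start_zero[OF that] by simp
    show "continuous_on {0..} (\<lambda>t. - W t w)" if "w \<in> space M" for w
      by (intro continuous_intros continuous_paths that)
    show "distributed M lborel (\<lambda>w. - W t w - - W s w) (normal_density 0 (sqrt (t - s)))" if "0 \<le> s" "s < t" for s t
    proof -
      have "distributed M lborel (\<lambda>w. 0 + - 1 * (W t w - W s w)) (normal_density (0 + - 1 * 0) (\<bar>- 1\<bar> * sqrt (t - s)))"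
        by (rule normal_density_affine[OF gaussian_increments[OF that]]) (use that in auto)
      then show ?thesis by simp
    qed
    fix n :: nat and t :: "nat \<Rightarrow> real" assume t: "0 \<le> t 0" "\<forall>i<n. t i < t (Suc i)"
    have "indep_vars (\<lambda>_. borel) (\<lambda>i w. uminus (W (t (Suc i)) w - W (t i) w)) {..<n}"
      by (rule indep_vars_compose2[OF independent_increments[OF t]]) auto
    then show "indep_vars (\<lambda>_. borel) (\<lambda>i w. - W (t (Suc i)) w - - W (t i) w) {..<n}" by simp
  qed
qed

theorem proposition11:
  fixes M :: "'a measure" and W :: "real \<Rightarrow> 'a \<Rightarrow> real"
  assumes "standard_brownian_motion M W"
  shows "(\<lambda>\<epsilon>. measure M {\<omega> \<in> space M. path_max (brownian_excursion (\<lambda>t. W t \<omega>)) \<le> \<epsilon>})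
           \<sim>[at_right 0]
         (\<lambda>\<epsilon>. pi ^ 2 * sqrt (2 * pi) / \<epsilon> ^ 3 * exp (- (pi ^ 2 / (2 * \<epsilon> ^ 2))))"
proof -
  let ?p = "\<lambda>\<epsilon>. measure M {w \<in> space M. path_max (brownian_excursion (\<lambda>t. W t w)) \<le> \<epsilon>}"
  let ?f = "\<lambda>\<epsilon>. pi ^ 2 * sqrt (2 * pi) / \<epsilon> ^ 3 * exp (- (pi ^ 2 / (2 * \<epsilon> ^ 2)))"
  interpret P: standard_brownian_motion M W by fact
  interpret N: standard_brownian_motion M "\<lambda>t w. - W t w"
    by (rule standard_brownian_motion_uminus) fact
  have same: "N.returns = P.returns" "N.right_zero w = P.right_zero w" "N.height w = P.height w" for w
  proof -
    show "N.returns = P.returns" by (simp add: N.returns_def P.returns_def)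
    then show r: "N.right_zero w = P.right_zero w" for w
      by (simp add: N.right_zero_def P.right_zero_def next_zero_def)
    show "N.height w = P.height w"
      unfolding N.height_def P.height_def r by (simp add: last_zero_def)
  qed
  have lz: "last_zero (\<lambda>t. - W t w) = last_zero (\<lambda>t. W t w)" for w by (simp add: last_zero_def)
  \<comment> \<open>Almost surely \<open>W 1\<close> is nonzero and the path returns, so the two
    signs split the event into disjoint parts. The excursion interval is then nondegenerate and its
    square root can be multiplied out.\<close>
  have prob: "?p \<epsilon> = measure M (P.small_exc \<epsilon>) + measure M (N.small_exc \<epsilon>)" if "0 < \<epsilon>" for \<epsilon>
  proof -
    have "?p \<epsilon> = measure M (P.small_exc \<epsilon> \<union> N.small_exc \<epsilon>)"
    proof (rule P.finite_measure_eq_AE)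
      show "AE w in M. w \<in> {w \<in> space M. path_max (brownian_excursion (\<lambda>t. W t w)) \<le> \<epsilon>} \<longleftrightarrow> w \<in> P.small_exc \<epsilon> \<union> N.small_exc \<epsilon>"
        using P.AE_returns N.AE_returns P.AE_W_nonzero AE_space
      proof eventually_elim
        case (elim w)
        then have ret: "w \<in> P.returns" by (auto simp: same)
        have "P.left_zero w < P.right_zero w"
          using P.zeros_around_1[of w] N.zeros_around_1[of w] ret elim by (cases "0 < W 1 w") (auto simp: same lz)
        then have "P.height w / sqrt (P.right_zero w - P.left_zero w) \<le> \<epsilon> \<longleftrightarrow> P.height w \<le> \<epsilon> * sqrt (P.right_zero w - P.left_zero w)"
          by (simp add: pos_divide_le_eq)
        then show ?case using ret elim
          by (auto simp: P.path_max_excursion P.small_exc_def N.small_exc_def same lz)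
      qed
      have "{w \<in> space M. path_max (brownian_excursion (\<lambda>t. W t w)) \<le> \<epsilon>} =
        {w \<in> space M. (if w \<in> P.returns then P.height w / sqrt (P.right_zero w - P.left_zero w) else 0) \<le> \<epsilon>}"
        using P.path_max_excursion by auto
      also have "\<dots> \<in> P.events" by measurable
      finally show "{w \<in> space M. path_max (brownian_excursion (\<lambda>t. W t w)) \<le> \<epsilon>} \<in> P.events" .
    qed auto
    also have "\<dots> = measure M (P.small_exc \<epsilon>) + measure M (N.small_exc \<epsilon>)"
      by (rule P.finite_measure_Union) (auto simp: P.small_exc_def N.small_exc_def)
    finally show ?thesis .
  qed
  obtain R where R: "0 \<le> R" "\<And>c. 1 \<le> c \<Longrightarrow>
    (\<Sum>n. ennreal ((real (Suc n))\<^sup>2 * exp (- ((real (Suc n))\<^sup>2 * c)))) \<le> ennreal (exp (- c) + R * exp (- (2 * c)))"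
    using theta_series_bound by blast
  \<comment> \<open>The one-sided bounds for the two signs add up, which cancels the 2 in the
    denominator of \<open>K\<close>. The lower bound is the claimed expression itself; above, the
    relative error is at most R exp (- c), estimated by R / c because c is at most exp c.\<close>
  have bounds: "?f \<epsilon> \<le> ?p \<epsilon> \<and> ?p \<epsilon> \<le> ?f \<epsilon> * (1 + R * (2 * \<epsilon>\<^sup>2 / pi\<^sup>2))" if \<epsilon>: "0 < \<epsilon>" "\<epsilon> \<le> 1" for \<epsilon>
  proof -
    define c where "c = pi\<^sup>2 / (2 * \<epsilon>\<^sup>2)"
    define K where "K = pi\<^sup>2 / (2 * \<epsilon> ^ 3) * sqrt (2 * pi)"
    have K: "?f \<epsilon> = 2 * K * exp (- c)" by (simp add: K_def c_def)
    have pos: "0 < c" "0 \<le> K" using \<epsilon> by (auto simp: c_def K_def)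
    have "exp (- (2 * c)) = exp (- c) * exp (- c)" by (simp add: exp_add[symmetric])
    moreover have "exp (- c) \<le> 2 * \<epsilon>\<^sup>2 / pi\<^sup>2"
    proof -
      have "exp (- c) = 1 / exp c" by (simp add: exp_minus divide_inverse)
      also have "\<dots> \<le> 1 / c"
      proof (rule divide_left_mono)
        show "c \<le> exp c" using exp_ge_add_one_self[of c] by linarith
      qed (use pos in auto)
      finally show ?thesis by (simp add: c_def)
    qed
    ultimately have "R * exp (- (2 * c)) \<le> exp (- c) * (R * (2 * \<epsilon>\<^sup>2 / pi\<^sup>2))"
      using R(1) by (simp add: mult_left_mono mult.left_commute del: times_divide_eq_right)
    then have "K * (exp (- c) + R * exp (- (2 * c))) \<le> K * (exp (- c) * (1 + R * (2 * \<epsilon>\<^sup>2 / pi\<^sup>2)))"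
      using pos by (intro mult_left_mono) (auto simp: distrib_left)
    moreover have "K * exp (- c) \<le> measure M (P.small_exc \<epsilon>)" "measure M (P.small_exc \<epsilon>) \<le> K * (exp (- c) + R * exp (- (2 * c)))"
      unfolding K_def c_def by (rule P.prob_small_exc_bounds[OF \<epsilon> R(1)], erule R(2))+
    moreover have "K * exp (- c) \<le> measure M (N.small_exc \<epsilon>)" "measure M (N.small_exc \<epsilon>) \<le> K * (exp (- c) + R * exp (- (2 * c)))"
      unfolding K_def c_def by (rule N.prob_small_exc_bounds[OF \<epsilon> R(1)], erule R(2))+
    moreover have "?f \<epsilon> * (1 + R * (2 * \<epsilon>\<^sup>2 / pi\<^sup>2)) = 2 * (K * (exp (- c) * (1 + R * (2 * \<epsilon>\<^sup>2 / pi\<^sup>2))))"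
      unfolding K by (simp only: mult.assoc)
    ultimately show ?thesis unfolding prob[OF \<epsilon>(1)] K[unfolded mult.assoc] by linarith
  qed
  have ev: "\<forall>\<^sub>F \<epsilon> in at_right 0. \<epsilon> \<in> {0<..<1::real}" by (rule eventually_at_right_real) simp
  show ?thesis
  proof (rule asymp_equivI')
    show "((\<lambda>\<epsilon>. ?p \<epsilon> / ?f \<epsilon>) \<longlongrightarrow> 1) (at_right 0)"
    proof (rule tendsto_sandwich)
      show "\<forall>\<^sub>F \<epsilon> in at_right 0. 1 \<le> ?p \<epsilon> / ?f \<epsilon>"
        using ev
      proof eventually_elim
        case (elim \<epsilon>)
        then have f: "0 < ?f \<epsilon>" by simp
        have "?f \<epsilon> \<le> ?p \<epsilon>" using bounds[of \<epsilon>] elim by simp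
        then show ?case by (subst le_divide_eq_1_pos[OF f])
      qed
      show "\<forall>\<^sub>F \<epsilon> in at_right 0. ?p \<epsilon> / ?f \<epsilon> \<le> 1 + R * (2 * \<epsilon>\<^sup>2 / pi\<^sup>2)"
        using ev
      proof eventually_elim
        case (elim \<epsilon>)
        then have f: "0 < ?f \<epsilon>" by simp
        have "?p \<epsilon> \<le> (1 + R * (2 * \<epsilon>\<^sup>2 / pi\<^sup>2)) * ?f \<epsilon>"
          using bounds[of \<epsilon>, THEN conjunct2] elim by (simp only: mult.commute greaterThanLessThan_iff less_imp_le)
        then show ?case by (subst pos_divide_le_eq[OF f])
      qed
      have "((\<lambda>\<epsilon>. 1 + R * (2 * \<epsilon>\<^sup>2 / pi\<^sup>2)) \<longlongrightarrow> 1 + R * (2 * 0\<^sup>2 / pi\<^sup>2)) (at_right 0)"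
        by (intro tendsto_intros) auto
      then show "((\<lambda>\<epsilon>. 1 + R * (2 * \<epsilon>\<^sup>2 / pi\<^sup>2)) \<longlongrightarrow> 1) (at_right 0)" by simp
    qed (rule tendsto_const)
  qed
qed

end
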